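(* Let $1\le p,q,r<\infty$, and let $\mu$ be a positive locally finite Borel measure on $\mathbb C^n$. Then the following conditions are equivalent: 1. $J_\mu\in\Pi_r(F_\varphi^p,L_\varphi^q(\mu))$; 2. $\widehat\mu_{q,\delta}\in\mathfrak D_{p,q}^{\,r}$ for some, equivalently every, $\delta>0$; 3. $\{\mu(B(a_j,\delta))^{1/q}\}_j\in\mathfrak d_{p,q}^{\,r}$ for some, equivalently every, $\delta$-lattice $\{a_j\}$. Moreover, $$\pi_r(J_\mu)\asymp\|\widehat\mu_{q,\delta}\|_{\mathfrak D_{p,q}^{\,r}}\asymp\|\{\mu(B(a_j,\delta))^{1/q}\}_j\|_{\mathfrak d_{p,q}^{\,r}},$$ with constants independent of $\mu$.
   Context: $n\ge1$; $v$ is Lebesgue measure on $\mathbb C^n\cong\mathbb R^{2n}$; $B(z,t)$ is the Euclidean ball. $\varphi\in C^2(\mathbb C^n;\mathbb R)$ satisfies $m_\varphi I_{2n}\le\operatorname{Hess}_{\mathbb R}\varphi(z)\le M_\varphi I_{2n}$ for all $z$, with constants $0<m_\varphi\le M_\varphi<\infty$. For $1\le s<\infty$, $L_\varphi^s=L^s(\mathbb C^n,e^{-s\varphi}dv)$ and $F_\varphi^s$ is its subspace of entire functions, with norm $\|g\|_{s,\varphi}=\|ge^{-\varphi}\|_{L^s(v)}$. A Borel measure is locally finite if it is finite on compact sets. $L_\varphi^q(\mu)=L^q(\mathbb C^n,e^{-q\varphi}d\mu)$, and $J_\mu:F_\varphi^p\to L_\varphi^q(\mu)$, $J_\mu g=g$,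 whenever this inclusion is well defined. $\widehat\mu_{q,\delta}(z)=\mu(B(z,\delta))^{1/q}$. A sequence $\{a_j\}$ is a $\delta$-lattice if the balls $B(a_j,\delta)$ cover $\mathbb C^n$ and the balls $B(a_j,c\delta)$ are pairwise disjoint for one fixed $c\in(0,1)$. $A:X\to Y$ is $r$-summing if $(\sum_j\|Ax_j\|^r)^{1/r}\le C\sup_{x^*\in B_{X^*}}(\sum_j|x^*(x_j)|^r)^{1/r}$ for all finite families $(x_j)$ in $X$; $\pi_r(A)$ is the least $C$ and $\Pi_r(X,Y)$ is the class of such operators. Norms are read as $+\infty$ when membership fails. For a scalar sequence $b=(b_j)$, $D_b:\ell^p\to\ell^q$, $D_b(c_j)=(b_jc_j)$; $\mathfrak d_{p,q}^{\,r}=\{b:D_b\in\Pi_r(\ell^p,\ell^q)\}$ with norm $\|b\|=\pi_r(D_b)$ (invariant under permutations of coordinates). For $j\in\mathbb Z^{2n}$ (enumerated by $\mathbb N$) let $E_j=j+[-1/2,1/2)^{2n}$. For measurable $u$ put $u_j^\#=\operatorname{ess\,sup}_{E_j}|u|$ (essential supremum with respect to $v$) and $\|u\|_{\mathfrak D_{p,q}^{\,r}}=\|(u_j^\#)_j\|_{\mathfrak d_{p,q}^{\,r}}$; $\mathfrak D_{p,q}^{\,r}$ is the space of $u$ with finite norm. Constants in $\asymp$ may depend on $p,q,r,n$, the Hessian bounds, the fixed radius $\delta$ and the fixed lattice separation and overlap parameters; they are independent of $\mu$ and uniform over translates of a fixed lattice. *)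

theory Defs
  imports "HOL-Probability.Probability"
begin

section \<open>Normed spaces of functions and absolutely summing operators\<close>

text \<open>
  All spaces involved are complex vector spaces of scalar functions with pointwise operations.
  A space is given by its vectors and its norm. Functions are not identified
  almost everywhere, so \<open>nrm\<close> may be only a seminorm on \<open>vecs\<close>; the functionals of
  \<open>dual_ball\<close> vanish on vectors of norm 0, so they are those of the quotient space.
\<close>

record 'a fun_space =
  vecs :: "('a \<Rightarrow> complex) set"
  nrm :: "('a \<Rightarrow> complex) \<Rightarrow> real"

definition dual_ball :: "'a fun_space \<Rightarrow> (('a \<Rightarrow> complex) \<Rightarrow> complex) set" where
  "dual_ball X = {l.
     (\<forall>f\<in>vecs X. \<forall>g\<in>vecs X. l (\<lambda>t. f t + g t) = l f + l g) \<and>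
     (\<forall>c. \<forall>f\<in>vecs X. l (\<lambda>t. c * f t) = c * l f) \<and>
     (\<forall>f\<in>vecs X. norm (l f) \<le> nrm X f)}"

definition linear_op ::
  "'a fun_space \<Rightarrow> 'b fun_space \<Rightarrow> (('a \<Rightarrow> complex) \<Rightarrow> ('b \<Rightarrow> complex)) \<Rightarrow> bool" where
  "linear_op X Y A \<longleftrightarrow>
     (\<forall>f\<in>vecs X. A f \<in> vecs Y) \<and>
     (\<forall>f\<in>vecs X. \<forall>g\<in>vecs X. A (\<lambda>t. f t + g t) = (\<lambda>t. A f t + A g t)) \<and>
     (\<forall>c. \<forall>f\<in>vecs X. A (\<lambda>t. c * f t) = (\<lambda>t. c * A f t))"

text \<open>
  Finite families are lists. The supremum is one of reals: it ranges over a nonempty set bounded by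
  the same expression with \<open>nrm X x\<close> in place of \<open>norm (l x)\<close>.
\<close>

definition summing_consts ::
  "real \<Rightarrow> 'a fun_space \<Rightarrow> 'b fun_space \<Rightarrow> (('a \<Rightarrow> complex) \<Rightarrow> ('b \<Rightarrow> complex)) \<Rightarrow> real set" where
  "summing_consts r X Y A = {C. 0 \<le> C \<and> (\<forall>xs. set xs \<subseteq> vecs X \<longrightarrow>
     (\<Sum>x\<leftarrow>xs. nrm Y (A x) powr r) powr (1/r)
       \<le> C * (SUP l\<in>dual_ball X. (\<Sum>x\<leftarrow>xs. norm (l x) powr r) powr (1/r)))}"

definition summing_ops ::
  "real \<Rightarrow> 'a fun_space \<Rightarrow> 'b fun_space \<Rightarrow> (('a \<Rightarrow> complex) \<Rightarrow> ('b \<Rightarrow> complex)) set" where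
  "summing_ops r X Y = {A. linear_op X Y A \<and> summing_consts r X Y A \<noteq> {}}"

definition summing_norm ::
  "real \<Rightarrow> 'a fun_space \<Rightarrow> 'b fun_space \<Rightarrow> (('a \<Rightarrow> complex) \<Rightarrow> ('b \<Rightarrow> complex)) \<Rightarrow> ennreal" where
  "summing_norm r X Y A =
     (if A \<in> summing_ops r X Y then ennreal (Inf (summing_consts r X Y A)) else \<infinity>)"

definition Lspace :: "real \<Rightarrow> 'a measure \<Rightarrow> 'a fun_space" where
  "Lspace s N = \<lparr>
     vecs = {f \<in> borel_measurable N. integrable N (\<lambda>t. norm (f t) powr s)},
     nrm = (\<lambda>f. (\<integral>t. norm (f t) powr s \<partial>N) powr (1/s))\<rparr>"

section \<open>Weighted Fock spaces\<close>

text \<open>\<open>D\<close> and \<open>H\<close> are the first and second derivatives of \<open>\<phi>\<close>, hence unique, and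
  \<open>H z h h\<close> is the quadratic form of the real Hessian.\<close>

definition hessian_bounds :: "real \<Rightarrow> real \<Rightarrow> (complex ^ 'n \<Rightarrow> real) \<Rightarrow> bool" where
  "hessian_bounds m M \<phi> \<longleftrightarrow>
     (\<exists>(D :: complex ^ 'n \<Rightarrow> (complex ^ 'n) \<Rightarrow>\<^sub>L real)
       (H :: complex ^ 'n \<Rightarrow> (complex ^ 'n) \<Rightarrow>\<^sub>L ((complex ^ 'n) \<Rightarrow>\<^sub>L real)).
        (\<forall>z. (\<phi> has_derivative blinfun_apply (D z)) (at z)) \<and>
        (\<forall>z. (D has_derivative blinfun_apply (H z)) (at z)) \<and>
        continuous_on UNIV H \<and>
        (\<forall>z h. m * (norm h)\<^sup>2 \<le> blinfun_apply (blinfun_apply (H z) h) h \<and>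
               blinfun_apply (blinfun_apply (H z) h) h \<le> M * (norm h)\<^sup>2))"

definition entire :: "(complex ^ 'n \<Rightarrow> complex) \<Rightarrow> bool" where
  "entire g \<longleftrightarrow>
     (\<forall>z. \<exists>L. (g has_derivative L) (at z) \<and> (\<forall>c h. L (c *s h) = c * L h))"

definition weighted_L ::
  "(complex ^ 'n \<Rightarrow> real) \<Rightarrow> real \<Rightarrow> (complex ^ 'n) measure \<Rightarrow> (complex ^ 'n) fun_space" where
  "weighted_L \<phi> s \<mu> = Lspace s (density \<mu> (\<lambda>z. ennreal (exp (- s * \<phi> z))))"

definition fock :: "(complex ^ 'n \<Rightarrow> real) \<Rightarrow> real \<Rightarrow> (complex ^ 'n) fun_space" where
  "fock \<phi> s = \<lparr>
     vecs = {g \<in> vecs (weighted_L \<phi> s lebesgue). entire g},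
     nrm = nrm (weighted_L \<phi> s lebesgue)\<rparr>"

definition locally_finite_borel :: "'a::topological_space measure \<Rightarrow> bool" where
  "locally_finite_borel \<mu> \<longleftrightarrow>
     sets \<mu> = sets borel \<and> (\<forall>K. compact K \<longrightarrow> emeasure \<mu> K < \<infinity>)"

definition ball_avg :: "(complex ^ 'n) measure \<Rightarrow> real \<Rightarrow> real \<Rightarrow> complex ^ 'n \<Rightarrow> real" where
  "ball_avg \<mu> q \<delta> z = measure \<mu> (ball z \<delta>) powr (1/q)"

definition separated_lattice :: "real \<Rightarrow> real \<Rightarrow> (nat \<Rightarrow> complex ^ 'n) \<Rightarrow> bool" where
  "separated_lattice c \<delta> a \<longleftrightarrow>
     (\<Union>j. ball (a j) \<delta>) = UNIV \<and> disjoint_family (\<lambda>j. ball (a j) (c * \<delta>))"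

definition delta_lattice :: "real \<Rightarrow> (nat \<Rightarrow> complex ^ 'n) \<Rightarrow> bool" where
  "delta_lattice \<delta> a \<longleftrightarrow> (\<exists>c. 0 < c \<and> c < 1 \<and> separated_lattice c \<delta> a)"

section \<open>Diagonal symbols\<close>

abbreviation ell :: "real \<Rightarrow> nat fun_space" where
  "ell s \<equiv> Lspace s (count_space UNIV)"

definition diag_op :: "(nat \<Rightarrow> complex) \<Rightarrow> (nat \<Rightarrow> complex) \<Rightarrow> (nat \<Rightarrow> complex)" where
  "diag_op b x = (\<lambda>j. b j * x j)"

definition diag_space :: "real \<Rightarrow> real \<Rightarrow> real \<Rightarrow> (nat \<Rightarrow> complex) set" where
  "diag_space p q r = {b. diag_op b \<in> summing_ops r (ell p) (ell q)}"

definition diag_norm :: "real \<Rightarrow> real \<Rightarrow> real \<Rightarrow> (nat \<Rightarrow> complex) \<Rightarrow> ennreal" where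
  "diag_norm p q r b = summing_norm r (ell p) (ell q) (diag_op b)"

definition integer_points :: "(complex ^ 'n) set" where
  "integer_points = {z. \<forall>i. Re (z $ i) \<in> \<int> \<and> Im (z $ i) \<in> \<int>}"

definition unit_cube :: "complex ^ 'n \<Rightarrow> (complex ^ 'n) set" where
  "unit_cube j = {z. \<forall>i. Re (z $ i - j $ i) \<in> {-1/2..<1/2} \<and> Im (z $ i - j $ i) \<in> {-1/2..<1/2}}"

text \<open>The set of integer points is countably infinite, so \<open>from_nat_into\<close> enumerates it
  bijectively.\<close>

definition cube_sup :: "(complex ^ 'n \<Rightarrow> complex) \<Rightarrow> nat \<Rightarrow> ennreal" where
  "cube_sup u k =
     esssup (lebesgue_on (unit_cube (from_nat_into integer_points k))) (\<lambda>z. ennreal (norm (u z)))"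

definition symbol_norm :: "real \<Rightarrow> real \<Rightarrow> real \<Rightarrow> (complex ^ 'n \<Rightarrow> complex) \<Rightarrow> ennreal" where
  "symbol_norm p q r u =
     (if \<forall>k. cube_sup u k < \<infinity>
      then diag_norm p q r (\<lambda>k. complex_of_real (enn2real (cube_sup u k))) else \<infinity>)"

definition symbol_space :: "real \<Rightarrow> real \<Rightarrow> real \<Rightarrow> (complex ^ 'n \<Rightarrow> complex) set" where
  "symbol_space p q r = {u \<in> borel_measurable lebesgue. symbol_norm p q r u < \<infinity>}"

definition comparable :: "real \<Rightarrow> ennreal \<Rightarrow> ennreal \<Rightarrow> bool" where
  "comparable K x y \<longleftrightarrow> x \<le> ennreal K * y \<and> y \<le> ennreal K * x"

end

theory Submission
  imports Defs "HOL-Complex_Analysis.Complex_Analysis"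
begin

text \<open>
  The theorem compares the embedding of a weighted Fock space into \<open>L\<^sup>q\<close> of a measure with the diagonal
  operator on sequence spaces whose entries are the local masses of the measure to the power \<open>1/q\<close>. The
  Hessian bounds enter only through the tangent of the weight at a point \<open>a\<close>: its complexification has an
  entire exponential whose weighted modulus lies between two Gaussians centred at \<open>a\<close> (\<open>peak_functions\<close>).

  Upper bound (\<open>summing_norm_le_diag_norm\<close>). Dividing by a peak function removes the weight locally, so the
  weighted modulus of an entire function has the sub-mean value property (\<open>weighted_modulus_le_ball_mean\<close>).
  On a piece of space near a point \<open>c k\<close> the function is therefore dominated by the integral, over offsets \<open>t\<close>
  in a fixed ball, of its samples at \<open>c k + t\<close>. For every single \<open>t\<close>, sampling along a separated sequence is bounded
  from the Fock space to \<open>\<ell>\<^sup>p\<close> (\<open>sampling_operator\<close>), so the weighted samples inherit the summing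
  inequality of the diagonal operator. Minkowski's integral inequality moves the integral over \<open>t\<close> outside
  all norms (\<open>local_means_summing\<close>).

  Lower bound (\<open>diag_norm_le_summing_norm\<close>). Superpositions of peak functions at separated points are
  bounded from \<open>\<ell>\<^sup>p\<close> to the Fock space by a Schur test (\<open>synthesis_operator\<close>). Twisting the
  coefficients by characters of a cyclic group does not change this bound, and averaging the twisted superpositions
  against the conjugate characters isolates a single peak function (\<open>coefficients_le_average\<close>). Since a peak
  function is bounded below near its centre, the diagonal operator is controlled by the average of the
  embeddings of the twists.

  Both bounds concern separated centres, the upper one together with any cover by pieces near them.
  Lattices are an instance. So are the integer points with
  their unit cubes, once the mass of a cube is compared with the essential supremum of the masses of
  \<open>\<delta>\<close>-balls centred in it (\<open>cube_measure_le_cube_sup\<close>). As both norms are comparable with the summing norm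
  of the embedding for every radius and every lattice, the choice of these does not matter.
\<close>

section \<open>Power means and Minkowski inequalities\<close>

text \<open>
  The graph of \<open>x powr p\<close> lies above its tangents. Everything below that concerns powers with a real
  exponent (Jensen, Hoelder, Minkowski, the Schur test) is this inequality, summed or integrated.
\<close>

lemma powr_tangent_le:
  fixes a x p :: real
  assumes "1 \<le> p" "0 \<le> a" "0 \<le> x"
  shows "p * a powr (p - 1) * x \<le> x powr p + (p - 1) * a powr p"
proof (cases "p = 1")
  case True then show ?thesis using assms by (cases "a = 0") auto
next
  case False
  then have p: "p > 1" using assms by simp
  \<comment> \<open>Young's inequality for the conjugate exponents \<open>p\<close> and \<open>p / (p - 1)\<close>\<close>
  have "x * a powr (p - 1) \<le> x powr p / p + (a powr (p - 1)) powr (p / (p - 1)) / (p / (p - 1))"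
    using p assms by (intro Youngs_inequality) (auto simp: field_simps)
  also have "(a powr (p - 1)) powr (p / (p - 1)) = a powr p"
    using p by (simp add: powr_powr)
  finally show ?thesis using p by (simp add: field_simps)
qed

lemma powr_base_mult:
  fixes a p :: real
  assumes "0 \<le> a" shows "a powr (p - 1) * a = a powr p"
  using powr_mult_base[OF assms, of "p - 1"] by (simp add: mult.commute)

lemma member_le_powr_sum:
  fixes u :: "'i \<Rightarrow> real"
  assumes "finite A" "i \<in> A" "\<And>i. 0 \<le> u i" "0 < r"
  shows "u i \<le> (\<Sum>i\<in>A. u i powr r) powr (1 / r)"
proof -
  have "u i = (u i powr r) powr (1 / r)" using assms by (simp add: powr_powr)
  also have "\<dots> \<le> (\<Sum>i\<in>A. u i powr r) powr (1 / r)"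
    using assms by (intro powr_mono2 member_le_sum) auto
  finally show ?thesis .
qed

lemma powr_sum_le:
  fixes f :: "'s \<Rightarrow> real"
  assumes A: "finite A" and f: "\<And>s. s \<in> A \<Longrightarrow> 0 \<le> f s" and q: "0 < q"
  shows "(\<Sum>s\<in>A. f s) powr q \<le> real (card A) powr q * (\<Sum>s\<in>A. f s powr q)"
proof (cases "A = {}")
  case False
  define b where "b = Max (f ` A)"
  obtain t where t: "t \<in> A" "f t = b" unfolding b_def
    using Max_in[of "f ` A"] A False by (metis (no_types, lifting) finite_imageI image_iff image_is_empty)
  have "(\<Sum>s\<in>A. f s) \<le> real (card A) * b"
    using A by (intro sum_bounded_above) (auto simp: b_def)
  then have "(\<Sum>s\<in>A. f s) powr q \<le> (real (card A) * b) powr q"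
    using q f by (intro powr_mono2 sum_nonneg) auto
  also have "\<dots> = real (card A) powr q * f t powr q"
    using f t by (simp add: powr_mult)
  also have "\<dots> \<le> real (card A) powr q * (\<Sum>s\<in>A. f s powr q)"
    using member_le_sum[of t A "\<lambda>s. f s powr q"] A t by (intro mult_left_mono) auto
  finally show ?thesis .
qed (use q in simp)

text \<open>
  Jensen's inequality for a weighted mean; it is the pointwise half of the Schur test in
  \<open>synthesis_operator\<close>.
\<close>

lemma weighted_sum_powr_le:
  fixes y g :: "'k \<Rightarrow> real"
  assumes p: "1 \<le> p" and K: "finite K" and y: "\<And>k. 0 \<le> y k" and g: "\<And>k. 0 < g k"
    and G: "(\<Sum>k\<in>K. g k) \<le> G"
  shows "(\<Sum>k\<in>K. y k * g k) powr p \<le> G powr (p - 1) * (\<Sum>k\<in>K. y k powr p * g k)"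
proof (cases "K = {}")
  case False
  define \<Gamma> where "\<Gamma> = (\<Sum>k\<in>K. g k)"
  have \<Gamma>: "0 < \<Gamma>" unfolding \<Gamma>_def using K False g by (intro sum_pos) auto
  define a where "a = (\<Sum>k\<in>K. y k * g k) / \<Gamma>"
  have a: "0 \<le> a" unfolding a_def using \<Gamma> y g by (intro divide_nonneg_pos sum_nonneg mult_nonneg_nonneg) (auto intro: less_imp_le)
  have "(\<Sum>k\<in>K. (p * a powr (p - 1) * y k) * g k) \<le> (\<Sum>k\<in>K. (y k powr p + (p - 1) * a powr p) * g k)"
    using g by (intro sum_mono mult_right_mono powr_tangent_le p a y) (auto intro: less_imp_le)
  then have "p * a powr (p - 1) * (\<Sum>k\<in>K. y k * g k) \<le> (\<Sum>k\<in>K. y k powr p * g k) + (p - 1) * a powr p * \<Gamma>"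
    by (simp add: sum_distrib_left distrib_right sum.distrib mult.assoc \<Gamma>_def)
  moreover have "p * a powr (p - 1) * (\<Sum>k\<in>K. y k * g k) = p * (a powr (p - 1) * a) * \<Gamma>"
    using \<Gamma> by (simp add: a_def)
  ultimately have *: "a powr p * \<Gamma> \<le> (\<Sum>k\<in>K. y k powr p * g k)"
    by (simp add: powr_base_mult[OF a] left_diff_distrib)
  have "(\<Sum>k\<in>K. y k * g k) powr p = (a * \<Gamma>) powr p" using \<Gamma> by (simp add: a_def)
  also have "\<dots> = a powr p * (\<Gamma> powr (p - 1) * \<Gamma>)"
    using a \<Gamma> by (simp add: powr_mult powr_base_mult)
  also have "\<dots> = \<Gamma> powr (p - 1) * (a powr p * \<Gamma>)" by simp
  also have "\<dots> \<le> G powr (p - 1) * (\<Sum>k\<in>K. y k powr p * g k)"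
    using * p G \<Gamma> by (intro mult_mono powr_mono2) (auto simp: \<Gamma>_def intro: sum_nonneg)
  finally show ?thesis .
qed simp

text \<open>
  Hoelder's inequality against \<open>v powr (q - 1)\<close> with \<open>v\<close> of unit norm. Using this form instead of a
  conjugate exponent treats \<open>q = 1\<close> together with \<open>q > 1\<close>.
\<close>

lemma holder_unit:
  fixes v f :: "'a \<Rightarrow> real"
  assumes q: "1 \<le> q" and v: "\<And>x. 0 \<le> v x" and f: "\<And>x. 0 \<le> f x"
    and [measurable]: "v \<in> borel_measurable N" "f \<in> borel_measurable N"
    and iv: "integrable N (\<lambda>x. v x powr q)" and unit: "(LINT x|N. v x powr q) = 1"
    and ifq: "integrable N (\<lambda>x. f x powr q)"
  shows "integrable N (\<lambda>x. v x powr (q - 1) * f x)"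
    and "(LINT x|N. v x powr (q - 1) * f x) \<le> (LINT x|N. f x powr q) powr (1 / q)"
proof -
  have bound: "v x powr (q - 1) * f x \<le> f x powr q + (q - 1) * v x powr q" for x
  proof -
    have "1 * (v x powr (q - 1) * f x) \<le> q * (v x powr (q - 1) * f x)"
      using q f v by (intro mult_right_mono) auto
    then show ?thesis using powr_tangent_le[OF q v f, of x x] by simp
  qed
  show int: "integrable N (\<lambda>x. v x powr (q - 1) * f x)"
  proof (rule Bochner_Integration.integrable_bound)
    show "integrable N (\<lambda>x. f x powr q + (q - 1) * v x powr q)" using iv ifq by simp
    show "AE x in N. norm (v x powr (q - 1) * f x) \<le> norm (f x powr q + (q - 1) * v x powr q)"
    proof (rule AE_I2)
      fix x
      have "0 \<le> f x powr q + (q - 1) * v x powr q" "0 \<le> v x powr (q - 1) * f x" using q f by auto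
      then show "norm (v x powr (q - 1) * f x) \<le> norm (f x powr q + (q - 1) * v x powr q)"
        using bound[of x] by simp
    qed
  qed measurable
  define S where "S = (LINT x|N. f x powr q)"
  have "0 \<le> S" by (simp add: S_def)
  \<comment> \<open>The tangent inequality is applied to \<open>f\<close> scaled to unit norm, so the degenerate case \<open>f = 0\<close> a.e. comes first.\<close>
  show "(LINT x|N. v x powr (q - 1) * f x) \<le> (LINT x|N. f x powr q) powr (1 / q)"
  proof (cases "S = 0")
    case True
    then have "AE x in N. f x powr q = 0"
      using integral_nonneg_eq_0_iff_AE[OF ifq] by (simp add: S_def)
    then have "AE x in N. v x powr (q - 1) * f x = 0" by eventually_elim simp
    then have "(LINT x|N. v x powr (q - 1) * f x) = 0" by (rule integral_eq_zero_AE)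
    then show ?thesis by simp
  next
    case False
    then have S: "0 < S" using \<open>0 \<le> S\<close> by simp
    define s where "s = S powr (1 / q)"
    have s: "0 < s" "s powr q = S" using S q by (auto simp: s_def powr_powr)
    have "(LINT x|N. q / s * (v x powr (q - 1) * f x)) \<le> (LINT x|N. f x powr q / S + (q - 1) * v x powr q)"
    proof (rule integral_mono)
      fix x
      have "q * v x powr (q - 1) * (f x / s) \<le> (f x / s) powr q + (q - 1) * v x powr q"
        using s f by (intro powr_tangent_le q v) auto
      then show "q / s * (v x powr (q - 1) * f x) \<le> f x powr q / S + (q - 1) * v x powr q"
        using s f by (simp add: powr_divide mult.assoc)
    qed (use int iv ifq in auto)
    also have "\<dots> = q" using iv ifq unit S by (simp add: S_def[symmetric])
    finally have "q * (LINT x|N. v x powr (q - 1) * f x) \<le> q * s"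
      using s by (simp add: field_simps)
    then have "(LINT x|N. v x powr (q - 1) * f x) \<le> s"
      using q by (subst (asm) mult_le_cancel_left_pos) auto
    then show ?thesis by (simp add: s_def S_def)
  qed
qed

lemma minkowski_sum:
  fixes f :: "'s \<Rightarrow> 'a \<Rightarrow> real"
  assumes q: "1 \<le> q" and A: "finite A" and f: "\<And>s x. 0 \<le> f s x"
    and [measurable]: "\<And>s. s \<in> A \<Longrightarrow> f s \<in> borel_measurable N"
    and int: "\<And>s. s \<in> A \<Longrightarrow> integrable N (\<lambda>x. f s x powr q)"
  shows "integrable N (\<lambda>x. (\<Sum>s\<in>A. f s x) powr q)"
    and "(LINT x|N. (\<Sum>s\<in>A. f s x) powr q) powr (1 / q) \<le> (\<Sum>s\<in>A. (LINT x|N. f s x powr q) powr (1 / q))"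
proof -
  define F where "F x = (\<Sum>s\<in>A. f s x)" for x
  have F: "0 \<le> F x" for x by (simp add: F_def f sum_nonneg)
  have [measurable]: "F \<in> borel_measurable N" unfolding F_def by measurable
  have iF: "integrable N (\<lambda>x. F x powr q)"
  proof (rule Bochner_Integration.integrable_bound)
    show "integrable N (\<lambda>x. real (card A) powr q * (\<Sum>s\<in>A. f s x powr q))" using int by simp
    show "AE x in N. norm (F x powr q) \<le> norm (real (card A) powr q * (\<Sum>s\<in>A. f s x powr q))"
    proof (rule AE_I2)
      fix x
      have "F x powr q \<le> real (card A) powr q * (\<Sum>s\<in>A. f s x powr q)"
        unfolding F_def using powr_sum_le[OF A, of "\<lambda>s. f s x" q] f q by simp
      then show "norm (F x powr q) \<le> norm (real (card A) powr q * (\<Sum>s\<in>A. f s x powr q))"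
        by (simp add: sum_nonneg)
    qed
  qed measurable
  then show "integrable N (\<lambda>x. (\<Sum>s\<in>A. f s x) powr q)" by (simp add: F_def)
  define S where "S = (LINT x|N. F x powr q)"
  have "0 \<le> S" by (simp add: S_def)
  have "S powr (1 / q) \<le> (\<Sum>s\<in>A. (LINT x|N. f s x powr q) powr (1 / q))"
  proof (cases "S = 0")
    case True then show ?thesis by (simp add: sum_nonneg)
  next
    case False
    then have S: "0 < S" using \<open>0 \<le> S\<close> by simp
    define s where "s = S powr (1 / q)"
    have s: "0 < s" "s powr q = S" using S q by (auto simp: s_def powr_powr)
    define v where "v x = F x / s" for x
    have v: "0 \<le> v x" for x using s F by (simp add: v_def)
    have vq: "v x powr q = F x powr q / S" for x using s F by (simp add: v_def powr_divide)
    have [measurable]: "v \<in> borel_measurable N" unfolding v_def by measurable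
    have unit: "(LINT x|N. v x powr q) = 1" using S by (simp add: vq) (simp add: S_def)
    note H = holder_unit[OF q v f _ _ _ unit int]
    have iv: "integrable N (\<lambda>x. v x powr q)" using iF by (simp add: vq)
    \<comment> \<open>\<open>v\<close> is the normalised sum, which is the vector at which the duality is attained.\<close>
    have "s = (LINT x|N. s * v x powr q)" by (simp add: unit)
    also have "\<dots> = (LINT x|N. (\<Sum>t\<in>A. v x powr (q - 1) * f t x))"
    proof (rule Bochner_Integration.integral_cong[OF refl])
      fix x
      have "s * v x powr q = v x powr (q - 1) * (s * v x)"
        using powr_base_mult[OF v, of x q] by simp
      also have "s * v x = F x" using s by (simp add: v_def)
      finally show "s * v x powr q = (\<Sum>t\<in>A. v x powr (q - 1) * f t x)"
        by (simp add: F_def sum_distrib_left)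
    qed
    also have "\<dots> = (\<Sum>t\<in>A. (LINT x|N. v x powr (q - 1) * f t x))"
      using iv by (intro Bochner_Integration.integral_sum H(1)) auto
    also have "\<dots> \<le> (\<Sum>t\<in>A. (LINT x|N. f t x powr q) powr (1 / q))"
      using iv by (intro sum_mono H(2)) auto
    finally show ?thesis by (simp add: s_def)
  qed
  then show "(LINT x|N. (\<Sum>s\<in>A. f s x) powr q) powr (1 / q) \<le> (\<Sum>s\<in>A. (LINT x|N. f s x powr q) powr (1 / q))"
    by (simp add: S_def F_def)
qed

text \<open>
  Minkowski's integral inequality for an \<open>\<ell>\<^sup>q\<close> norm over a finite index set. It is what allows the
  local mean over the offset \<open>t\<close> to be pulled out of the mixed norms of a summing inequality.
\<close>

lemma minkowski_integral:
  fixes f :: "'k \<Rightarrow> 'a \<Rightarrow> real"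
  assumes q: "1 \<le> q" and K: "finite K" and f: "\<And>k x. 0 \<le> f k x"
    and int: "\<And>k. k \<in> K \<Longrightarrow> integrable N (f k)"
    and intq: "integrable N (\<lambda>x. (\<Sum>k\<in>K. f k x powr q) powr (1 / q))"
  shows "(\<Sum>k\<in>K. (LINT x|N. f k x) powr q) powr (1 / q) \<le> (LINT x|N. (\<Sum>k\<in>K. f k x powr q) powr (1 / q))"
proof -
  define I where "I k = (LINT x|N. f k x)" for k
  have I: "0 \<le> I k" for k by (simp add: I_def f)
  define S where "S = (\<Sum>k\<in>K. I k powr q)"
  have "0 \<le> S" by (simp add: S_def sum_nonneg)
  have "S powr (1 / q) \<le> (LINT x|N. (\<Sum>k\<in>K. f k x powr q) powr (1 / q))"
  proof (cases "S = 0")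
    case True then show ?thesis by simp
  next
    case False
    then have S: "0 < S" using \<open>0 \<le> S\<close> by simp
    define s where "s = S powr (1 / q)"
    have s: "0 < s" "s powr q = S" using S q by (auto simp: s_def powr_powr)
    define v where "v k = I k / s" for k
    have v: "0 \<le> v k" for k using s I by (simp add: v_def)
    have vq: "v k powr q = I k powr q / S" for k using s I by (simp add: v_def powr_divide)
    have unit: "(LINT k|count_space K. v k powr q) = 1"
      using S K by (simp add: vq lebesgue_integral_count_space_finite sum_divide_distrib[symmetric]) (simp add: S_def)
    \<comment> \<open>Pairing with the unit vector that norms \<open>I\<close> makes the left-hand side linear in \<open>f\<close>.\<close>
    have pointwise: "(\<Sum>k\<in>K. v k powr (q - 1) * f k x) \<le> (\<Sum>k\<in>K. f k x powr q) powr (1 / q)" for x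
      using holder_unit(2)[of q v "\<lambda>k. f k x" "count_space K", OF q v f _ _ _ unit] K
      by (simp add: integrable_count_space lebesgue_integral_count_space_finite)
    have "s = (\<Sum>k\<in>K. s * v k powr q)"
      using unit K by (simp add: lebesgue_integral_count_space_finite sum_distrib_left[symmetric])
    also have "\<dots> = (\<Sum>k\<in>K. v k powr (q - 1) * I k)"
    proof (rule sum.cong[OF refl])
      fix k
      have "s * v k powr q = v k powr (q - 1) * (s * v k)"
        using powr_base_mult[OF v, of k q] by simp
      then show "s * v k powr q = v k powr (q - 1) * I k" using s by (simp add: v_def)
    qed
    also have "\<dots> = (LINT x|N. (\<Sum>k\<in>K. v k powr (q - 1) * f k x))"
      using int by (simp add: I_def Bochner_Integration.integral_sum)
    also have "\<dots> \<le> (LINT x|N. (\<Sum>k\<in>K. f k x powr q) powr (1 / q))"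
      using int by (intro integral_mono intq pointwise) auto
    finally show ?thesis by (simp add: s_def)
  qed
  then show ?thesis by (simp add: S_def I_def)
qed

lemma minkowski_sum_sum:
  fixes f :: "'s \<Rightarrow> 'k \<Rightarrow> real"
  assumes "1 \<le> q" "finite A" "finite K" "\<And>s k. 0 \<le> f s k"
  shows "(\<Sum>k\<in>K. (\<Sum>s\<in>A. f s k) powr q) powr (1 / q) \<le> (\<Sum>s\<in>A. (\<Sum>k\<in>K. f s k powr q) powr (1 / q))"
  using minkowski_sum(2)[of q A f "count_space K"] assms
  by (simp add: integrable_count_space lebesgue_integral_count_space_finite)

text \<open>
  A summing inequality for a sequence-valued operator follows from its finite sections with a uniform
  constant; the bound also gives the convergence of the full series.
\<close>

lemma mixed_norm_limit:
  fixes a :: "'i \<Rightarrow> nat \<Rightarrow> real"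
  assumes q: "0 < q" and r: "0 < r" and A: "finite A" and a: "\<And>i k. 0 \<le> a i k"
    and bd: "\<And>N. 0 < N \<Longrightarrow> (\<Sum>i\<in>A. ((\<Sum>k<N. a i k) powr (1 / q)) powr r) powr (1 / r) \<le> W"
  shows "\<And>i. i \<in> A \<Longrightarrow> summable (a i)"
    and "(\<Sum>i\<in>A. ((\<Sum>k. a i k) powr (1 / q)) powr r) powr (1 / r) \<le> W"
proof -
  show summ: "summable (a i)" if i: "i \<in> A" for i
  proof (rule summableI_nonneg_bounded)
    fix N
    have "(\<Sum>k<Suc N. a i k) powr (1 / q) \<le> W"
      using member_le_powr_sum[OF A i, of "\<lambda>i. (\<Sum>k<Suc N. a i k) powr (1 / q)" r] r bd[of "Suc N"] by simp
    then have "((\<Sum>k<Suc N. a i k) powr (1 / q)) powr q \<le> W powr q"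
      using q by (intro powr_mono2) auto
    then have "(\<Sum>k<Suc N. a i k) \<le> W powr q"
      using q by (simp add: powr_powr sum_nonneg a)
    then show "(\<Sum>k<N. a i k) \<le> W powr q" using a[of i N] by simp
  qed (rule a)
  have "(\<lambda>N. (\<Sum>i\<in>A. ((\<Sum>k<N. a i k) powr (1 / q)) powr r) powr (1 / r))
     \<longlonglongrightarrow> (\<Sum>i\<in>A. ((\<Sum>k. a i k) powr (1 / q)) powr r) powr (1 / r)"
    using q r summ a
    by (intro tendsto_powr' tendsto_sum tendsto_const summable_LIMSEQ)
       (auto intro!: always_eventually sum_nonneg)
  then show "(\<Sum>i\<in>A. ((\<Sum>k. a i k) powr (1 / q)) powr r) powr (1 / r) \<le> W"
    using bd by (elim LIMSEQ_le_const2) (intro exI[of _ 1], auto)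
qed

section \<open>Summing operators\<close>

text \<open>
  The supremum in the definition of \<open>r\<close>-summing operators, known as the weak \<open>\<ell>\<^sup>r\<close> norm of the family.
\<close>

definition weak_norm :: "real \<Rightarrow> 'a fun_space \<Rightarrow> ('a \<Rightarrow> complex) list \<Rightarrow> real" where
  "weak_norm r X xs = (SUP l\<in>dual_ball X. (\<Sum>x\<leftarrow>xs. norm (l x) powr r) powr (1 / r))"

lemma weak_norm_upper:
  assumes "set xs \<subseteq> vecs X" "l \<in> dual_ball X" "0 < r"
  shows "(\<Sum>x\<leftarrow>xs. norm (l x) powr r) powr (1 / r) \<le> weak_norm r X xs"
  unfolding weak_norm_def
proof (rule cSUP_upper[OF assms(2)], rule bdd_aboveI2)
  fix l assume "l \<in> dual_ball X"
  then have l: "\<And>x. x \<in> set xs \<Longrightarrow> norm (l x) \<le> nrm X x" using assms(1) by (auto simp: dual_ball_def)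
  have "(\<Sum>x\<leftarrow>xs. norm (l x) powr r) \<le> (\<Sum>x\<leftarrow>xs. nrm X x powr r)"
    using l assms(3) by (intro sum_list_mono powr_mono2) auto
  then show "(\<Sum>x\<leftarrow>xs. norm (l x) powr r) powr (1 / r) \<le> (\<Sum>x\<leftarrow>xs. nrm X x powr r) powr (1 / r)"
    using assms(3) by (intro powr_mono2) (auto intro!: sum_list_nonneg)
qed

lemma zero_in_dual_ball:
  assumes "\<And>f. 0 \<le> nrm X f"
  shows "(\<lambda>_. 0) \<in> dual_ball X"
  using assms by (simp add: dual_ball_def)

lemma weak_norm_nonneg:
  assumes "set xs \<subseteq> vecs X" "\<And>f. 0 \<le> nrm X f" "0 < r"
  shows "0 \<le> weak_norm r X xs"
  using weak_norm_upper[OF assms(1) zero_in_dual_ball[OF assms(2)] assms(3)]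
  by (metis order_trans powr_ge_zero)

text \<open>
  The ideal property from the right: functionals on the target pull back to functionals on the source.
\<close>

lemma weak_norm_image_le:
  assumes T: "linear_op X Z T" and bd: "\<And>f. f \<in> vecs X \<Longrightarrow> nrm Z (T f) \<le> C * nrm X f"
    and C: "0 < C" and nn: "\<And>f. 0 \<le> nrm Z f" and xs: "set xs \<subseteq> vecs X" and r: "0 < r"
  shows "weak_norm r Z (map T xs) \<le> C * weak_norm r X xs"
  unfolding weak_norm_def[of r Z]
proof (rule cSUP_least)
  show "dual_ball Z \<noteq> {}" using zero_in_dual_ball[OF nn] by blast
  fix l assume l: "l \<in> dual_ball Z"
  have TZ: "\<And>f. f \<in> vecs X \<Longrightarrow> T f \<in> vecs Z"
    and Tadd: "\<And>f g. f \<in> vecs X \<Longrightarrow> g \<in> vecs X \<Longrightarrow> T (\<lambda>t. f t + g t) = (\<lambda>t. T f t + T g t)"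
    and Tmul: "\<And>c f. f \<in> vecs X \<Longrightarrow> T (\<lambda>t. c * f t) = (\<lambda>t. c * T f t)"
    using T by (auto simp: linear_op_def)
  have "(\<lambda>f. l (T f) / of_real C) \<in> dual_ball X"
    unfolding dual_ball_def
  proof (safe)
    fix f g assume f: "f \<in> vecs X" and g: "g \<in> vecs X"
    then show "l (T (\<lambda>t. f t + g t)) / of_real C = l (T f) / of_real C + l (T g) / of_real C"
      using l TZ[OF f] TZ[OF g] by (simp add: Tadd dual_ball_def add_divide_distrib)
  next
    fix c f assume f: "f \<in> vecs X"
    then show "l (T (\<lambda>t. c * f t)) / of_real C = c * (l (T f) / of_real C)"
      using l TZ[OF f] by (simp add: Tmul dual_ball_def)
  next
    fix f assume f: "f \<in> vecs X"
    have "norm (l (T f)) \<le> nrm Z (T f)" using l TZ[OF f] by (simp add: dual_ball_def)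
    also have "\<dots> \<le> C * nrm X f" by (rule bd[OF f])
    finally show "norm (l (T f) / of_real C) \<le> nrm X f"
      using C by (simp add: norm_divide field_simps)
  qed
  from weak_norm_upper[OF xs this r]
  have "C * (\<Sum>x\<leftarrow>xs. norm (l (T x) / of_real C) powr r) powr (1 / r) \<le> C * weak_norm r X xs"
    using C by simp
  also have "C * (\<Sum>x\<leftarrow>xs. norm (l (T x) / of_real C) powr r) powr (1 / r)
      = (\<Sum>x\<leftarrow>map T xs. norm (l x) powr r) powr (1 / r)"
  proof -
    have "(\<Sum>x\<leftarrow>xs. norm (l (T x) / of_real C) powr r) = (\<Sum>x\<leftarrow>xs. norm (l (T x)) powr r * (1 / C powr r))"
      using C by (simp add: norm_divide powr_divide)
    also have "\<dots> = (\<Sum>x\<leftarrow>xs. norm (l (T x)) powr r) * (1 / C powr r)" by (rule sum_list_mult_const)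
    finally show ?thesis
      using C r by (simp add: powr_divide powr_powr o_def sum_list_nonneg)
  qed
  finally show "(\<Sum>x\<leftarrow>map T xs. norm (l x) powr r) powr (1 / r) \<le> C * weak_norm r X xs" .
qed

lemma summing_constsD:
  assumes "C \<in> summing_consts r X Y A" "set xs \<subseteq> vecs X"
  shows "(\<Sum>x\<leftarrow>xs. nrm Y (A x) powr r) powr (1 / r) \<le> C * weak_norm r X xs"
  using assms by (auto simp: summing_consts_def weak_norm_def)

text \<open>
  Comparing two summing norms amounts to transporting each admissible constant of one operator to the
  other. Linearity has to be transported as well, because the norm is infinite for a map that is not linear
  between the two spaces.
\<close>

lemma summing_norm_le_mult:
  assumes K: "0 < K"
    and imp: "\<And>C. linear_op X Y A \<Longrightarrow> C \<in> summing_consts r X Y A \<Longrightarrow>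
      linear_op X' Y' A' \<and> K * C \<in> summing_consts r X' Y' A'"
  shows "summing_norm r X' Y' A' \<le> ennreal K * summing_norm r X Y A"
proof (cases "A \<in> summing_ops r X Y")
  case True
  then obtain C where lin: "linear_op X Y A" and C: "C \<in> summing_consts r X Y A"
    by (auto simp: summing_ops_def)
  have A': "A' \<in> summing_ops r X' Y'" using imp[OF lin C] by (auto simp: summing_ops_def)
  have nn: "0 \<le> Inf (summing_consts r X Y A)"
    using C by (intro cInf_greatest) (auto simp: summing_consts_def)
  have "Inf (summing_consts r X' Y' A') / K \<le> Inf (summing_consts r X Y A)"
  proof (rule cInf_greatest)
    fix c assume "c \<in> summing_consts r X Y A"
    then have "K * c \<in> summing_consts r X' Y' A'" using imp[OF lin] by blast
    then have "Inf (summing_consts r X' Y' A') \<le> K * c"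
      by (intro cInf_lower bdd_belowI[of _ 0]) (auto simp: summing_consts_def)
    then show "Inf (summing_consts r X' Y' A') / K \<le> c" using K by (simp add: field_simps)
  qed (use C in auto)
  then have "Inf (summing_consts r X' Y' A') \<le> K * Inf (summing_consts r X Y A)"
    using K by (simp add: field_simps)
  then show ?thesis using True A' K nn
    by (simp add: summing_norm_def ennreal_mult[symmetric] ennreal_leI)
next
  case False then show ?thesis using K by (simp add: summing_norm_def ennreal_mult_top)
qed

lemma sum_list_powr_nth: "(\<Sum>x\<leftarrow>xs. f x) = (\<Sum>i<length xs. f (xs ! i))"
  by (simp add: sum_list_sum_nth atLeast0LessThan)

section \<open>Lebesgue measure on Euclidean spaces\<close>

lemma nn_integral_shift:
  fixes f :: "'a::euclidean_space \<Rightarrow> ennreal"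
  assumes [measurable]: "f \<in> borel_measurable borel"
  shows "(\<integral>\<^sup>+x. f (y + x) \<partial>lborel) = (\<integral>\<^sup>+x. f x \<partial>lborel)"
proof -
  have "(\<integral>\<^sup>+x. f (y + x) \<partial>lborel) = (\<integral>\<^sup>+x. f x \<partial>distr lborel borel ((+) y))"
    by (simp add: nn_integral_distr)
  then show ?thesis by (simp add: lborel_distr_plus)
qed

text \<open>
  The image measure is invariant under translations, and the classical uniqueness argument for such
  measures identifies it with Lebesgue measure up to a factor. The unit ball, which every isometry
  preserves, shows that the factor is 1.
\<close>

lemma lborel_distr_isometry:
  fixes T :: "'a::euclidean_space \<Rightarrow> 'a"
  assumes T: "linear T" and iso: "\<And>x. norm (T x) = norm x"
  shows "distr lborel borel T = lborel"
proof -
  define N where "N = distr lborel borel T"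
  have [measurable]: "T \<in> borel_measurable borel"
    using T by (intro borel_measurable_continuous_onI linear_continuous_on) (simp add: linear_conv_bounded_linear)
  have setsN [simp, measurable_cong]: "sets N = sets borel" and [simp]: "space N = UNIV" by (auto simp: N_def)
  have surj: "surj T"
    by (rule linear_inj_imp_surj[OF T]) (metis T iso linear_injective_0 norm_eq_zero)
  have ballN: "emeasure N (ball 0 r) = emeasure lborel (ball (0::'a) r)" for r
    by (simp add: N_def emeasure_distr) (simp add: vimage_def iso mem_ball_0 ball_def)
  interpret N: sigma_finite_measure N
  proof
    have "x \<in> \<Union> (range (\<lambda>n. ball 0 (real n)))" for x :: 'a
      using reals_Archimedean2[of "norm x"] by auto
    then show "\<exists>A. countable A \<and> A \<subseteq> sets N \<and> \<Union> A = space N \<and> (\<forall>a\<in>A. emeasure N a \<noteq> \<infinity>)"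
      by (intro exI[of _ "range (\<lambda>n. ball 0 (real n))"])
        (auto simp: ballN emeasure_lborel_ball_finite[THEN less_imp_neq, simplified])
  qed
  interpret P: pair_sigma_finite N lborel ..
  have shift: "(\<integral>\<^sup>+x. f x \<partial>N) = (\<integral>\<^sup>+x. f (x + y) \<partial>N)" if [measurable]: "f \<in> borel_measurable borel" for f and y
  proof -
    obtain v where v: "y = T v" using surj by blast
    have "(\<integral>\<^sup>+x. f (x + y) \<partial>N) = (\<integral>\<^sup>+x. f (T (v + x)) \<partial>lborel)"
      by (simp add: N_def nn_integral_distr v linear_add[OF T] add.commute)
    also have "\<dots> = (\<integral>\<^sup>+x. f (T x) \<partial>distr lborel borel ((+) v))"
      by (simp add: nn_integral_distr)
    also have "\<dots> = (\<integral>\<^sup>+x. f x \<partial>N)"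
      by (simp add: lborel_distr_plus) (simp add: N_def nn_integral_distr)
    finally show ?thesis by simp
  qed
  define B where "B = ball (0::'a) 1"
  have [measurable]: "B \<in> sets borel" by (simp add: B_def)
  have "emeasure N X = emeasure lborel X" if [measurable]: "X \<in> sets borel" for X
  proof -
    \<comment> \<open>Both sides below are the double integral of \<open>1\<^sub>X(x) 1\<^sub>B(y - x)\<close> against the two measures, evaluated in the two
      possible orders; \<open>B = - B\<close> has the same mass for both.\<close>
    have "emeasure N X * emeasure lborel B = (\<integral>\<^sup>+x. indicator X x * emeasure lborel B \<partial>N)"
      by (simp add: nn_integral_multc)
    also have "\<dots> = (\<integral>\<^sup>+x. \<integral>\<^sup>+y. indicator X x * indicator B (-x + y) \<partial>lborel \<partial>N)"
    proof (rule nn_integral_cong)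
      fix x
      have "(\<integral>\<^sup>+y. indicator B (-x + y) \<partial>lborel) = emeasure lborel B"
        by (subst nn_integral_shift) auto
      then show "indicator X x * emeasure lborel B = (\<integral>\<^sup>+y. indicator X x * indicator B (-x + y) \<partial>lborel)"
        by (simp add: nn_integral_cmult)
    qed
    also have "\<dots> = (\<integral>\<^sup>+y. \<integral>\<^sup>+x. indicator X x * indicator B (-x + y) \<partial>N \<partial>lborel)"
      by (rule P.Fubini'[symmetric]) measurable
    also have "\<dots> = (\<integral>\<^sup>+y. \<integral>\<^sup>+x. indicator X (x + y) * indicator B (-x) \<partial>N \<partial>lborel)"
    proof (rule nn_integral_cong)
      fix y
      show "(\<integral>\<^sup>+x. indicator X x * indicator B (-x + y) \<partial>N) = (\<integral>\<^sup>+x. indicator X (x + y) * indicator B (-x) \<partial>N)"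
        by (subst shift[where y = y]) simp_all
    qed
    also have "\<dots> = (\<integral>\<^sup>+x. \<integral>\<^sup>+y. indicator X (x + y) * indicator B (-x) \<partial>lborel \<partial>N)"
      by (rule P.Fubini') measurable
    also have "\<dots> = (\<integral>\<^sup>+x. emeasure lborel X * indicator B x \<partial>N)"
    proof (rule nn_integral_cong)
      fix x
      have "(\<integral>\<^sup>+y. indicator X (x + y) \<partial>lborel) = emeasure lborel X"
        by (subst nn_integral_shift) auto
      then show "(\<integral>\<^sup>+y. indicator X (x + y) * indicator B (-x) \<partial>lborel) = emeasure lborel X * indicator B x"
        by (simp add: nn_integral_multc B_def indicator_def)
    qed
    also have "\<dots> = emeasure lborel X * emeasure lborel B"
      by (simp add: nn_integral_cmult) (simp add: B_def ballN)
    finally have eq: "emeasure lborel B * emeasure N X = emeasure lborel B * emeasure lborel X"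
      by (simp add: mult.commute)
    have "unit_ball_vol (real DIM('a)) \<noteq> 0"
      using unit_ball_vol_pos[of "real DIM('a)"] by linarith
    then have "emeasure lborel B \<noteq> 0" "emeasure lborel B \<noteq> \<top>"
      using emeasure_lborel_ball_finite[of "0::'a" 1] by (auto simp: B_def emeasure_ball)
    then show ?thesis
      using eq by (simp add: ennreal_mult_cancel_left)
  qed
  then show ?thesis unfolding N_def by (intro measure_eqI) (auto simp flip: N_def)
qed

lemma set_integral_ball_shift:
  fixes f :: "'a::euclidean_space \<Rightarrow> real"
  assumes [measurable]: "f \<in> borel_measurable borel"
  shows "(LINT w:ball z \<rho>|lborel. f w) = (LINT t:ball 0 \<rho>|lborel. f (z + t))"
proof -
  have "(LINT w:ball z \<rho>|lborel. f w) = (LINT w:ball z \<rho>|distr lborel borel ((+) z). f w)"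
    by (simp add: lborel_distr_plus)
  also have "\<dots> = (LINT t:ball 0 \<rho>|lborel. f (z + t))"
    unfolding set_lebesgue_integral_def
    by (subst integral_distr) (auto intro!: Bochner_Integration.integral_cong simp: indicator_def dist_norm)
  finally show ?thesis .
qed

lemma set_integrable_continuous_ball:
  fixes f :: "'a::euclidean_space \<Rightarrow> real"
  assumes "continuous_on UNIV f"
  shows "set_integrable lborel (ball z \<rho>) f"
proof (rule set_integrable_subset)
  show "set_integrable lborel (cball z \<rho>) f"
    unfolding set_integrable_def
    using assms by (intro borel_integrable_compact) (auto intro: continuous_on_subset)
qed auto

lemma sum_set_integral_disjoint_le:
  fixes f :: "'a \<Rightarrow> real"
  assumes f: "integrable N f" "\<And>x. 0 \<le> f x" and "finite K"
    and A: "disjoint_family_on A K" "\<And>k. k \<in> K \<Longrightarrow> A k \<in> sets N"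
  shows "(\<Sum>k\<in>K. LINT x:A k|N. f x) \<le> (LINT x|N. f x)"
proof -
  have int: "integrable N (\<lambda>x. indicator (A k) x *\<^sub>R f x)" if "k \<in> K" for k
    using f A(2)[OF that] integrable_mult_indicator by blast
  have "(\<Sum>k\<in>K. LINT x:A k|N. f x) = (LINT x|N. (\<Sum>k\<in>K. indicator (A k) x *\<^sub>R f x))"
    unfolding set_lebesgue_integral_def using int by (simp add: Bochner_Integration.integral_sum)
  also have "\<dots> \<le> (LINT x|N. f x)"
  proof (rule integral_mono)
    fix x
    have "(\<Sum>k\<in>K. indicator (A k) x *\<^sub>R f x) = indicator (\<Union>k\<in>K. A k) x * f x"
      using \<open>finite K\<close> A(1) by (simp add: indicator_UN_disjoint sum_distrib_right)
    then show "(\<Sum>k\<in>K. indicator (A k) x *\<^sub>R f x) \<le> f x"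
      using f(2)[of x] by (simp add: indicator_def)
  qed (use int f in auto)
  finally show ?thesis .
qed

lemma content_ball_center:
  fixes z w :: "'a::euclidean_space"
  shows "measure lborel (ball z \<rho>) = measure lborel (ball w \<rho>)"
  by (cases "\<rho> \<ge> 0") (auto simp: content_ball ball_empty)

lemma content_ball_gt_0:
  fixes z :: "'a::euclidean_space"
  assumes "0 < \<rho>"
  shows "0 < measure lborel (ball z \<rho>)"
  using assms unit_ball_vol_pos[of "real DIM('a)"] by (simp add: content_ball)

text \<open>
  Jensen's inequality for the mean over a ball, obtained by integrating the tangent at the mean value.
\<close>

lemma ball_mean_powr_le:
  fixes f :: "'a::euclidean_space \<Rightarrow> real"
  assumes cont: "continuous_on UNIV f" and nonneg: "\<And>x. 0 \<le> f x" and p: "1 \<le> p" and "0 < \<rho>"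
  shows "((LINT w:ball z \<rho>|lborel. f w) / measure lborel (ball z \<rho>)) powr p * measure lborel (ball z \<rho>)
    \<le> (LINT w:ball z \<rho>|lborel. f w powr p)"
proof -
  define V where "V = measure lborel (ball z \<rho>)"
  have V: "0 < V" unfolding V_def by (rule content_ball_gt_0[OF \<open>0 < \<rho>\<close>])
  define a where "a = (LINT w:ball z \<rho>|lborel. f w) / V"
  have "0 \<le> (LINT w:ball z \<rho>|lborel. f w)"
    using nonneg by (auto simp: set_lebesgue_integral_def intro!: integral_nonneg_AE)
  then have a: "0 \<le> a" using V by (simp add: a_def)
  have fp: "continuous_on UNIV (\<lambda>x. f x powr p)"
    using p nonneg by (intro continuous_on_powr' cont continuous_on_const) auto
  note int = set_integrable_continuous_ball[OF cont, of z \<rho>] set_integrable_continuous_ball[OF fp, of z \<rho>]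
    set_integrable_continuous_ball[OF continuous_on_const, of z \<rho>]
  have const: "(LINT w:ball z \<rho>|lborel. c) = c * V" for c :: real
    using V by (simp add: set_lebesgue_integral_def V_def)
  have "(LINT w:ball z \<rho>|lborel. p * a powr (p - 1) * f w) \<le> (LINT w:ball z \<rho>|lborel. f w powr p + (p - 1) * a powr p)"
    using int by (intro set_integral_mono set_integral_add(1) set_integrable_mult_right powr_tangent_le p a nonneg) auto
  then have "p * a powr (p - 1) * (a * V) \<le> (LINT w:ball z \<rho>|lborel. f w powr p) + (p - 1) * a powr p * V"
    using int V by (simp add: set_integral_add(2) const set_integral_mult_right a_def mult_ac)
  moreover have "p * a powr (p - 1) * (a * V) = p * (a * a powr (p - 1)) * V" by simp
  moreover have "a * a powr (p - 1) = a powr p"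
    using a powr_mult_base[of a "p - 1"] by simp
  ultimately have "a powr p * V \<le> (LINT w:ball z \<rho>|lborel. f w powr p)"
    by (simp add: left_diff_distrib)
  then show ?thesis by (simp add: a_def V_def)
qed

lemma disjoint_family_ballI:
  fixes a :: "nat \<Rightarrow> 'a::real_normed_vector"
  assumes "\<And>i j. i \<noteq> j \<Longrightarrow> 2 * \<rho> \<le> norm (a i - a j)"
  shows "disjoint_family (\<lambda>k. ball (a k) \<rho>)"
  unfolding disjoint_family_on_def
proof (safe)
  fix i j :: nat and x assume "i \<noteq> j" "x \<in> ball (a i) \<rho>" "x \<in> ball (a j) \<rho>"
  then have "dist (a i) (a j) < 2 * \<rho>" using dist_triangle2[of "a i" "a j" x] by simp
  then show "x \<in> {}" using assms[OF \<open>i \<noteq> j\<close>] by (simp add: dist_norm)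
qed

lemma disjoint_family_ball_shift:
  fixes c :: "nat \<Rightarrow> 'a::real_normed_vector"
  assumes "disjoint_family (\<lambda>k. ball (c k) \<rho>)"
  shows "disjoint_family (\<lambda>k. ball (c k + t) \<rho>)"
  unfolding disjoint_family_on_def
proof (safe)
  fix i j :: nat and x assume "i \<noteq> j" and x: "x \<in> ball (c i + t) \<rho>" "x \<in> ball (c j + t) \<rho>"
  have "x - t \<in> ball (c i) \<rho> \<inter> ball (c j) \<rho>" using x by (auto simp: dist_norm algebra_simps)
  moreover have "ball (c i) \<rho> \<inter> ball (c j) \<rho> = {}"
    using assms \<open>i \<noteq> j\<close> unfolding disjoint_family_on_def by blast
  ultimately show "x \<in> {}" by blast
qed

text \<open>
  The Gaussian is a product of one-dimensional normal densities.
\<close>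

lemma gaussian_integrable:
  fixes z :: "'a::euclidean_space"
  assumes c: "0 < c"
  shows "integrable lborel (\<lambda>w::'a. exp (- c * (norm (z - w))\<^sup>2))"
proof -
  have one: "(\<integral>\<^sup>+t. ennreal (exp (- c * t\<^sup>2)) \<partial>lborel) < \<infinity>"
  proof -
    have "integrable lborel (\<lambda>t. normal_density 0 (1 / sqrt (2 * c)) t)"
      using c by (intro integrable_normal_density) auto
    then have "integrable lborel (\<lambda>t. sqrt (pi / c) * normal_density 0 (1 / sqrt (2 * c)) t)"
      by simp
    then have "integrable lborel (\<lambda>t::real. exp (- c * t\<^sup>2))"
      using c by (simp add: normal_density_def power_divide field_simps real_sqrt_divide real_sqrt_mult)
    then show ?thesis unfolding real_integrable_def by (auto simp: less_top)
  qed
  have "(\<integral>\<^sup>+w. ennreal (exp (- c * (norm (w::'a))\<^sup>2)) \<partial>lborel)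
     = (\<integral>\<^sup>+w. (\<Prod>b\<in>Basis. ennreal (exp (- c * ((w::'a) \<bullet> b)\<^sup>2))) \<partial>lborel)"
  proof (intro nn_integral_cong)
    fix w :: 'a
    have "(norm w)\<^sup>2 = (\<Sum>b\<in>Basis. (w \<bullet> b)\<^sup>2)"
      unfolding power2_norm_eq_inner by (subst euclidean_inner) (simp only: power2_eq_square)
    then have "exp (- c * (norm w)\<^sup>2) = (\<Prod>b\<in>Basis. exp (- c * (w \<bullet> b)\<^sup>2))"
      by (simp only: exp_sum[OF finite_Basis, symmetric] sum_distrib_left[symmetric])
    then show "ennreal (exp (- c * (norm w)\<^sup>2)) = (\<Prod>b\<in>Basis. ennreal (exp (- c * (w \<bullet> b)\<^sup>2)))"
      by (simp add: prod_ennreal)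
  qed
  also have "\<dots> = (\<Prod>b\<in>(Basis::'a set). (\<integral>\<^sup>+t. ennreal (exp (- c * t\<^sup>2)) \<partial>lborel))"
    by (rule nn_integral_lborel_prod) auto
  also have "\<dots> < \<infinity>" using one by (simp add: ennreal_prod_eq_top power_less_top_ennreal)
  finally have "(\<integral>\<^sup>+w. ennreal (exp (- c * (norm (- z + w :: 'a))\<^sup>2)) \<partial>lborel) < \<infinity>"
    by (subst nn_integral_shift[of "\<lambda>w. ennreal (exp (- c * (norm w)\<^sup>2))"]) auto
  then show ?thesis
    by (intro integrableI_nonneg) (auto simp: norm_minus_commute)
qed

text \<open>
  The Gaussians at separated centres are dominated by the integrals of one integrable function over
  disjoint balls. The bound is uniform over all \<open>\<rho>\<close>-separated sequences, which makes the later
  constants uniform over lattices with the same separation.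
\<close>

lemma gaussian_sum_bounded:
  fixes \<rho> \<kappa> :: real
  assumes "0 < \<rho>" "0 < \<kappa>"
  obtains G where "0 < G" and "\<And>(c :: nat \<Rightarrow> 'a::euclidean_space) K z. disjoint_family (\<lambda>k. ball (c k) \<rho>) \<Longrightarrow> finite K \<Longrightarrow>
     (\<Sum>k\<in>K. exp (- \<kappa> * (norm (z - c k))\<^sup>2)) \<le> G"
proof -
  define V where "V = measure lborel (ball (0::'a) \<rho>)"
  have V: "0 < V" unfolding V_def by (rule content_ball_gt_0[OF \<open>0 < \<rho>\<close>])
  define I where "I = (LINT w::'a|lborel. exp (- (\<kappa> / 2) * (norm w)\<^sup>2))"
  have Ish: "(LINT w::'a|lborel. exp (- (\<kappa> / 2) * (norm (z - w))\<^sup>2)) = I" for z :: 'a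
  proof -
    have "(LINT w::'a|lborel. exp (- (\<kappa> / 2) * (norm (z - w))\<^sup>2))
      = (LINT w::'a|distr lborel borel ((+) z). exp (- (\<kappa> / 2) * (norm (z - w))\<^sup>2))"
      by (simp add: lborel_distr_plus)
    also have "\<dots> = I" unfolding I_def by (subst integral_distr) auto
    finally show ?thesis .
  qed
  show ?thesis
  proof (rule that[of "exp (\<kappa> * \<rho>\<^sup>2) * I / V + 1"])
    \<comment> \<open>The summand 1 makes the bound visibly positive.\<close>
    have "0 \<le> I" by (simp add: I_def)
    then show "0 < exp (\<kappa> * \<rho>\<^sup>2) * I / V + 1" using V by (simp add: add_nonneg_pos)
    fix c :: "nat \<Rightarrow> 'a" and K :: "nat set" and z :: 'a
    assume dis: "disjoint_family (\<lambda>k. ball (c k) \<rho>)" and K: "finite K"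
    define f where "f w = exp (- (\<kappa> / 2) * (norm (z - w))\<^sup>2)" for w :: 'a
    have fi: "integrable lborel f" unfolding f_def using gaussian_integrable[of "\<kappa> / 2" z] \<open>0 < \<kappa>\<close> by simp
    have "V * exp (- \<kappa> * (norm (z - c k))\<^sup>2) \<le> exp (\<kappa> * \<rho>\<^sup>2) * (LINT w:ball (c k) \<rho>|lborel. f w)" for k
    proof -
      \<comment> \<open>On the ball around \<open>c k\<close> the Gaussian at \<open>c k\<close> is dominated by a wider Gaussian at \<open>w\<close>.\<close>
      have "(LINT w:ball (c k) \<rho>|lborel. exp (- \<kappa> * (norm (z - c k))\<^sup>2)) \<le> (LINT w:ball (c k) \<rho>|lborel. exp (\<kappa> * \<rho>\<^sup>2) * f w)"
      proof (rule set_integral_mono)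
        show "set_integrable lborel (ball (c k) \<rho>) (\<lambda>w. exp (\<kappa> * \<rho>\<^sup>2) * f w)" unfolding f_def
          by (intro set_integrable_continuous_ball continuous_intros)
        fix w assume w: "w \<in> ball (c k) \<rho>"
        have "norm (z - w) \<le> norm (z - c k) + norm (c k - w)" using norm_triangle_ineq[of "z - c k" "c k - w"] by simp
        also have "\<dots> \<le> norm (z - c k) + \<rho>" using w by (simp add: dist_norm)
        finally have "(norm (z - w))\<^sup>2 \<le> (norm (z - c k) + \<rho>)\<^sup>2" by (intro power_mono) auto
        also have "\<dots> \<le> 2 * (norm (z - c k))\<^sup>2 + 2 * \<rho>\<^sup>2"
          using sum_squares_bound[of "norm (z - c k)" \<rho>] by (simp add: power2_sum)
        finally have "\<kappa> / 2 * (norm (z - w))\<^sup>2 \<le> \<kappa> / 2 * (2 * (norm (z - c k))\<^sup>2 + 2 * \<rho>\<^sup>2)"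
          using \<open>0 < \<kappa>\<close> by (intro mult_left_mono) auto
        then show "exp (- \<kappa> * (norm (z - c k))\<^sup>2) \<le> exp (\<kappa> * \<rho>\<^sup>2) * f w"
          unfolding f_def exp_add[symmetric] by (simp add: algebra_simps)
      qed (intro set_integrable_continuous_ball continuous_intros)
      moreover have "(LINT w:ball (c k) \<rho>|lborel. exp (- \<kappa> * (norm (z - c k))\<^sup>2)) = V * exp (- \<kappa> * (norm (z - c k))\<^sup>2)"
        by (simp add: set_lebesgue_integral_def V_def content_ball_center[of 0 \<rho> "c k"])
      ultimately show ?thesis by (simp add: set_integral_mult_right)
    qed
    then have "(\<Sum>k\<in>K. V * exp (- \<kappa> * (norm (z - c k))\<^sup>2)) \<le> (\<Sum>k\<in>K. exp (\<kappa> * \<rho>\<^sup>2) * (LINT w:ball (c k) \<rho>|lborel. f w))"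
      by (rule sum_mono)
    also have "\<dots> \<le> exp (\<kappa> * \<rho>\<^sup>2) * (LINT w|lborel. f w)"
      unfolding sum_distrib_left[symmetric]
      using dis K by (intro mult_left_mono sum_set_integral_disjoint_le fi)
        (auto simp: f_def disjoint_family_on_def)
    finally have "V * (\<Sum>k\<in>K. exp (- \<kappa> * (norm (z - c k))\<^sup>2)) \<le> exp (\<kappa> * \<rho>\<^sup>2) * I"
      by (simp only: sum_distrib_left[symmetric] f_def Ish)
    then have "(\<Sum>k\<in>K. exp (- \<kappa> * (norm (z - c k))\<^sup>2)) \<le> exp (\<kappa> * \<rho>\<^sup>2) * I / V"
      using V by (simp add: field_simps)
    then show "(\<Sum>k\<in>K. exp (- \<kappa> * (norm (z - c k))\<^sup>2)) \<le> exp (\<kappa> * \<rho>\<^sup>2) * I / V + 1" by simp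
  qed
qed

lemma locally_finite_emeasure:
  fixes c :: "'a::euclidean_space"
  assumes "locally_finite_borel \<mu>" "P \<in> sets borel" "P \<subseteq> ball c R"
  shows "emeasure \<mu> P = ennreal (measure \<mu> P)"
proof -
  have "emeasure \<mu> P \<le> emeasure \<mu> (cball c R)"
    using assms by (intro emeasure_mono) (auto simp: locally_finite_borel_def)
  also have "\<dots> < \<infinity>" using assms(1) compact_cball[of c R] unfolding locally_finite_borel_def by blast
  finally show ?thesis by (simp add: emeasure_eq_ennreal_measure less_top)
qed

text \<open>
  The mass of a ball is a lower semicontinuous function of its centre.
\<close>

lemma ball_measure_measurable:
  fixes \<mu> :: "'a::euclidean_space measure"
  assumes \<mu>: "locally_finite_borel \<mu>"
  shows "(\<lambda>z. measure \<mu> (ball z \<delta>)) \<in> borel_measurable borel"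
  unfolding borel_measurable_iff_greater
proof (intro allI)
  fix a
  have sets\<mu>: "sets \<mu> = sets borel" using \<mu> by (simp add: locally_finite_borel_def)
  have fin: "emeasure \<mu> (ball z r) \<noteq> \<infinity>" for z r
    using locally_finite_emeasure[OF \<mu> _ order_refl, of z r] by simp
  have "open {z. a < measure \<mu> (ball z \<delta>)}"
    unfolding open_dist
  proof
    fix z assume "z \<in> {z. a < measure \<mu> (ball z \<delta>)}"
    then have a: "a < measure \<mu> (ball z \<delta>)" by simp
    define A where "A i = ball z (\<delta> - 1 / real (Suc i))" for i
    have UA: "(\<Union>i. A i) = ball z \<delta>"
    proof (safe)
      fix x assume "x \<in> ball z \<delta>"
      then have "0 < \<delta> - dist z x" by simp
      then obtain i where "1 / real (Suc i) < \<delta> - dist z x" using nat_approx_posE by metis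
      then have "x \<in> A i" unfolding A_def mem_ball by linarith
      then show "x \<in> (\<Union>i. A i)" by blast
    next
      fix x i assume "x \<in> A i"
      moreover have "0 \<le> 1 / real (Suc i)" by simp
      ultimately show "x \<in> ball z \<delta>" unfolding A_def mem_ball by linarith
    qed
    have "incseq A"
      unfolding incseq_Suc_iff A_def by (intro allI subset_ball diff_left_mono divide_left_mono) auto
    moreover have "range A \<subseteq> sets \<mu>" by (auto simp: A_def sets\<mu>)
    ultimately have "(\<lambda>i. measure \<mu> (A i)) \<longlonglongrightarrow> measure \<mu> (ball z \<delta>)"
      using Lim_measure_incseq[of A \<mu>] fin UA by simp
    from order_tendstoD(1)[OF this a] obtain i where i: "a < measure \<mu> (A i)"
      by (auto simp: eventually_sequentially)
    show "\<exists>e>0. \<forall>y. dist y z < e \<longrightarrow> y \<in> {z. a < measure \<mu> (ball z \<delta>)}"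
    proof (intro exI[of _ "1 / real (Suc i)"] conjI allI impI)
      fix y assume y: "dist y z < 1 / real (Suc i)"
      have "A i \<subseteq> ball y \<delta>"
      proof
        fix x assume "x \<in> A i"
        then have "dist z x < \<delta> - 1 / real (Suc i)" by (simp add: A_def)
        then show "x \<in> ball y \<delta>" using y dist_triangle[of y x z] unfolding mem_ball by linarith
      qed
      then have "measure \<mu> (A i) \<le> measure \<mu> (ball y \<delta>)"
        using fin by (intro measure_mono_fmeasurable) (auto simp: A_def sets\<mu> fmeasurable_def top.not_eq_extremum)
      then show "y \<in> {z. a < measure \<mu> (ball z \<delta>)}" using i by simp
    qed simp
  qed
  then show "{w \<in> space borel. a < measure \<mu> (ball w \<delta>)} \<in> sets borel" by simp
qed

lemma AE_lebesgue_on_open_witness: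
  assumes "AE z in lebesgue_on E. P z" "E \<in> sets lebesgue" "open U" "U \<noteq> {}" "U \<subseteq> E"
  obtains z where "z \<in> U" "P z"
proof -
  have "AE z in lebesgue. z \<in> E \<longrightarrow> P z"
    using assms(1,2) by (simp add: AE_restrict_space_iff)
  then obtain N where N: "N \<in> null_sets lebesgue" "{z. \<not> (z \<in> E \<longrightarrow> P z)} \<subseteq> N"
    by (auto simp: eventually_ae_filter)
  have "\<not> U \<subseteq> N"
    using open_not_negligible[OF assms(3,4)] N(1) negligible_subset negligible_iff_null_sets by blast
  then show ?thesis using that N(2) assms(5) by blast
qed

section \<open>Entire functions of several variables\<close>

lemma norm_smult: "norm (c *s z) = norm c * norm (z :: complex ^ 'n)"
  unfolding norm_vec_def vector_scalar_mult_def
  by (simp add: norm_mult L2_set_right_distrib)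

lemma has_derivative_smult_left: "((\<lambda>c. c *s (w :: complex ^ 'n)) has_derivative (\<lambda>c. c *s w)) (at x)"
proof -
  have "bounded_linear (\<lambda>c. c *s w)"
    by (rule bounded_linear_intro[where K = "norm w"])
      (auto simp: vec_eq_iff algebra_simps norm_smult)
  then show ?thesis by (rule bounded_linear_imp_has_derivative)
qed

lemma entire_continuous: "entire g \<Longrightarrow> continuous_on UNIV g"
  unfolding entire_def by (metis continuous_at_imp_continuous_on has_derivative_continuous)

lemma entire_divide:
  assumes "entire g" "entire k" "\<And>z. k z \<noteq> 0"
  shows "entire (\<lambda>z. g z / k z)"
  unfolding entire_def
proof
  fix z
  obtain L where L: "(g has_derivative L) (at z)" "\<And>c h. L (c *s h) = c * L h"
    using assms(1) unfolding entire_def by blast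
  obtain L' where L': "(k has_derivative L') (at z)" "\<And>c h. L' (c *s h) = c * L' h"
    using assms(2) unfolding entire_def by blast
  show "\<exists>L. ((\<lambda>z. g z / k z) has_derivative L) (at z) \<and> (\<forall>c h. L (c *s h) = c * L h)"
    by (rule exI, rule conjI, rule has_derivative_divide[OF L(1) L'(1) assms(3)])
      (simp add: L(2) L'(2) algebra_simps)
qed

lemma entire_const_mult: "entire g \<Longrightarrow> entire (\<lambda>z. a * g z)"
  unfolding entire_def
proof
  fix z assume "\<forall>z. \<exists>L. (g has_derivative L) (at z) \<and> (\<forall>c h. L (c *s h) = c * L h)"
  then obtain L where "(g has_derivative L) (at z)" "\<And>c h. L (c *s h) = c * L h" by blast
  then show "\<exists>L. ((\<lambda>z. a * g z) has_derivative L) (at z) \<and> (\<forall>c h. L (c *s h) = c * L h)"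
    by (intro exI[of _ "\<lambda>h. a * L h"]) (auto intro: has_derivative_mult_right)
qed

lemma entire_sum:
  assumes "\<And>k. k \<in> K \<Longrightarrow> entire (g k)"
  shows "entire (\<lambda>z. \<Sum>k\<in>K. g k z)"
  unfolding entire_def
proof
  fix z
  have "\<forall>k. \<exists>L. k \<in> K \<longrightarrow> (g k has_derivative L) (at z) \<and> (\<forall>c h. L (c *s h) = c * L h)"
    using assms unfolding entire_def by blast
  then obtain L where L: "\<And>k. k \<in> K \<Longrightarrow> (g k has_derivative L k) (at z)"
    "\<And>k c h. k \<in> K \<Longrightarrow> L k (c *s h) = c * L k h" by metis
  then show "\<exists>L. ((\<lambda>z. \<Sum>k\<in>K. g k z) has_derivative L) (at z) \<and> (\<forall>c h. L (c *s h) = c * L h)"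
    by (intro exI[of _ "\<lambda>h. \<Sum>k\<in>K. L k h"]) (auto intro: has_derivative_sum simp: sum_distrib_left)
qed

text \<open>
  Cauchy's formula on the complex line through \<open>z\<close> in direction \<open>w\<close>.
\<close>

lemma norm_entire_le_circle_mean:
  fixes g :: "complex ^ 'n \<Rightarrow> complex"
  assumes g: "entire g"
  shows "ennreal (norm (g z)) \<le>
    (\<integral>\<^sup>+\<theta>. ennreal (norm (g (z + exp (2 * of_real pi * \<i> * of_real \<theta>) *s w))) * indicator {0..1} \<theta> \<partial>lborel)"
proof -
  define f where "f \<zeta> = g (z + \<zeta> *s w)" for \<zeta>
  define e where "e \<theta> = exp (2 * of_real pi * \<i> * of_real \<theta>)" for \<theta> :: real
  have "\<exists>f'. (f has_field_derivative f') (at \<zeta>)" for \<zeta>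
  proof -
    obtain L where L: "(g has_derivative L) (at (z + \<zeta> *s w))" "\<And>c h. L (c *s h) = c * L h"
      using g unfolding entire_def by blast
    have "((\<lambda>\<zeta>. z + \<zeta> *s w) has_derivative (\<lambda>c. c *s w)) (at \<zeta>)"
      using has_derivative_add[OF has_derivative_const has_derivative_smult_left] by simp
    from has_derivative_compose[OF this L(1)]
    have "((\<lambda>\<zeta>. g (z + \<zeta> *s w)) has_derivative (\<lambda>c. L w * c)) (at \<zeta>)"
      by (simp only: L(2) mult.commute)
    then have "(f has_field_derivative L w) (at \<zeta>)"
      unfolding has_field_derivative_def f_def[abs_def] .
    then show ?thesis by blast
  qed
  then have "f field_differentiable at \<zeta>" for \<zeta> unfolding field_differentiable_def by blast
  then have hol: "f holomorphic_on UNIV" by (simp add: holomorphic_on_def field_differentiable_at_within)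
  have cont: "continuous_on UNIV (\<lambda>\<theta>. norm (f (e \<theta>)))"
  proof -
    have f: "continuous_on UNIV f" using hol by (rule holomorphic_on_imp_continuous_on)
    have e: "continuous_on UNIV e" unfolding e_def by (intro continuous_intros)
    show ?thesis by (rule continuous_on_norm[OF continuous_on_compose2[OF f e]]) simp
  qed
  have "((\<lambda>u. f u / (u - 0)) has_contour_integral (2 * of_real pi * \<i> * f 0)) (circlepath 0 1)"
    by (rule Cauchy_integral_circlepath_simple) (auto intro: holomorphic_on_subset[OF hol])
  then have "((\<lambda>\<theta>. f (circlepath 0 1 \<theta>) / (circlepath 0 1 \<theta> - 0)
      * vector_derivative (circlepath 0 1) (at \<theta> within {0..1})) has_integral (2 * of_real pi * \<i> * f 0)) {0..1}"
    unfolding has_contour_integral_def .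
  then have "((\<lambda>\<theta>. 2 * of_real pi * \<i> * f (e \<theta>)) has_integral (2 * of_real pi * \<i> * f 0)) {0..1}"
  proof (rule has_integral_eq[rotated])
    fix \<theta> :: real assume "\<theta> \<in> {0..1}"
    then have "vector_derivative (circlepath 0 1) (at \<theta> within {0..1}) = 2 * of_real pi * \<i> * e \<theta>"
      by (subst vector_derivative_circlepath01) (auto simp: e_def)
    moreover have "circlepath 0 1 \<theta> = e \<theta>" by (simp add: circlepath e_def)
    moreover have "e \<theta> \<noteq> 0" by (simp add: e_def)
    ultimately show "f (circlepath 0 1 \<theta>) / (circlepath 0 1 \<theta> - 0)
      * vector_derivative (circlepath 0 1) (at \<theta> within {0..1}) = 2 * of_real pi * \<i> * f (e \<theta>)"
      by simp
  qed
  from has_integral_mult_right[OF this, of "1 / (2 * of_real pi * \<i>)"]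
  have "((\<lambda>\<theta>. f (e \<theta>)) has_integral f 0) {0..1}" by simp
  then have fi: "(\<lambda>\<theta>. f (e \<theta>)) integrable_on {0..1}" "integral {0..1} (\<lambda>\<theta>. f (e \<theta>)) = f 0"
    by (rule has_integral_integrable, rule integral_unique)
  have "(\<lambda>\<theta>. norm (f (e \<theta>))) integrable_on {0..1}"
    by (rule integrable_continuous_interval[OF continuous_on_subset[OF cont subset_UNIV]])
  from integral_norm_bound_integral[OF fi(1) this order_refl]
  have "norm (f 0) \<le> integral {0..1} (\<lambda>\<theta>. norm (f (e \<theta>)))" unfolding fi(2) .
  also have "\<dots> = (LINT \<theta>:{0..1}|lborel. norm (f (e \<theta>)))"
    using cont by (intro set_borel_integral_eq_integral(2)[symmetric] borel_integrable_atLeastAtMost') (auto intro: continuous_on_subset)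
  finally have "ennreal (norm (f 0)) \<le> ennreal (LINT \<theta>:{0..1}|lborel. norm (f (e \<theta>)))"
    by (rule ennreal_leI)
  also have "\<dots> = (\<integral>\<^sup>+\<theta>. ennreal (indicator {0..1} \<theta> * norm (f (e \<theta>))) \<partial>lborel)"
    using borel_integrable_atLeastAtMost'[of 0 1 "\<lambda>\<theta>. norm (f (e \<theta>))"] cont
    unfolding set_lebesgue_integral_def set_integrable_def
    by (subst nn_integral_eq_integral) (auto intro: continuous_on_subset)
  also have "\<dots> = (\<integral>\<^sup>+\<theta>. ennreal (norm (f (e \<theta>))) * indicator {0..1} \<theta> \<partial>lborel)"
    by (intro nn_integral_cong) (auto simp: indicator_def)
  finally show ?thesis by (simp add: f_def e_def)
qed

text \<open>
  Averaging the circle means over all directions \<open>w\<close> in a ball gives the mean over the ball, because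
  the rotations \<open>w \<mapsto> e\<^sup>i\<^sup>\<theta> w\<close> preserve Lebesgue measure.
\<close>

lemma norm_entire_le_ball_mean:
  fixes g :: "complex ^ 'n \<Rightarrow> complex"
  assumes g: "entire g"
  shows "norm (g z) * measure lborel (ball z \<rho>) \<le> (LINT w:ball z \<rho>|lborel. norm (g w))"
proof -
  define e where "e \<theta> = exp (2 * of_real pi * \<i> * of_real \<theta>)" for \<theta> :: real
  have ne: "norm (e \<theta>) = 1" for \<theta> by (simp add: e_def)
  have cg: "continuous_on UNIV g" by (rule entire_continuous[OF g])
  then have [measurable]: "g \<in> borel_measurable borel" by (rule borel_measurable_continuous_onI)
  have [measurable]: "(\<lambda>(w, \<theta>). g (z + e \<theta> *s w)) \<in> borel_measurable (lborel \<Otimes>\<^sub>M lborel)"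
  proof -
    have "continuous_on UNIV (\<lambda>(w, \<theta>). g (z + e \<theta> *s w))"
      unfolding split_def e_def vector_scalar_mult_def
      by (intro continuous_on_compose2[OF cg] continuous_intros) auto
    from borel_measurable_continuous_onI[OF this] show ?thesis by (simp add: lborel_prod)
  qed
  have [measurable]: "ball (0::complex^'n) \<rho> \<in> sets borel" "ball z \<rho> \<in> sets borel" by auto
  have rot: "(\<integral>\<^sup>+w. ennreal (norm (g (z + e \<theta> *s w))) * indicator (ball 0 \<rho>) w \<partial>lborel)
     = (\<integral>\<^sup>+w. ennreal (norm (g (z + w))) * indicator (ball 0 \<rho>) w \<partial>lborel)" for \<theta>
  proof -
    define T where "T w = e \<theta> *s w" for w :: "complex ^ 'n"
    have T: "linear T" by (rule linearI) (auto simp: T_def vec_eq_iff algebra_simps)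
    have iso: "norm (T w) = norm w" for w by (simp add: T_def norm_smult ne)
    have [measurable]: "T \<in> borel_measurable borel"
      using T by (intro borel_measurable_continuous_onI linear_continuous_on) (simp add: linear_conv_bounded_linear)
    have "(\<integral>\<^sup>+w. ennreal (norm (g (z + w))) * indicator (ball 0 \<rho>) w \<partial>lborel)
      = (\<integral>\<^sup>+w. ennreal (norm (g (z + w))) * indicator (ball 0 \<rho>) w \<partial>distr lborel borel T)"
      by (simp add: lborel_distr_isometry[OF T iso])
    also have "\<dots> = (\<integral>\<^sup>+w. ennreal (norm (g (z + T w))) * indicator (ball 0 \<rho>) (T w) \<partial>lborel)"
      by (rule nn_integral_distr) measurable
    finally show ?thesis by (simp add: T_def[symmetric] indicator_def iso)
  qed
  have "ennreal (norm (g z)) * emeasure lborel (ball (0::complex^'n) \<rho>)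
     = (\<integral>\<^sup>+w. ennreal (norm (g z)) * indicator (ball (0::complex^'n) \<rho>) w \<partial>lborel)"
    by (simp add: nn_integral_cmult)
  also have "\<dots> \<le> (\<integral>\<^sup>+w. (\<integral>\<^sup>+\<theta>. ennreal (norm (g (z + e \<theta> *s w))) * indicator {0..1} \<theta> \<partial>lborel)
      * indicator (ball (0::complex^'n) \<rho>) w \<partial>lborel)"
    using norm_entire_le_circle_mean[OF g]
    by (intro nn_integral_mono mult_right_mono) (auto simp: e_def)
  also have "\<dots> = (\<integral>\<^sup>+w. (\<integral>\<^sup>+\<theta>. ennreal (norm (g (z + e \<theta> *s w))) * indicator {0..1} \<theta>
      * indicator (ball (0::complex^'n) \<rho>) w \<partial>lborel) \<partial>lborel)"
    by (intro nn_integral_cong nn_integral_multc[symmetric]) measurable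
  also have "\<dots> = (\<integral>\<^sup>+\<theta>. (\<integral>\<^sup>+w. ennreal (norm (g (z + e \<theta> *s w))) * indicator {0..1} \<theta>
      * indicator (ball (0::complex^'n) \<rho>) w \<partial>lborel) \<partial>lborel)"
    by (rule lborel_pair.Fubini'[symmetric]) measurable
  also have "\<dots> = (\<integral>\<^sup>+\<theta>. (\<integral>\<^sup>+w. ennreal (norm (g (z + w))) * indicator (ball 0 \<rho>) w \<partial>lborel)
       * indicator {0..1::real} \<theta> \<partial>lborel)"
  proof (intro nn_integral_cong)
    fix \<theta> :: real
    show "(\<integral>\<^sup>+w. ennreal (norm (g (z + e \<theta> *s w))) * indicator {0..1} \<theta> * indicator (ball (0::complex^'n) \<rho>) w \<partial>lborel)
      = (\<integral>\<^sup>+w. ennreal (norm (g (z + w))) * indicator (ball 0 \<rho>) w \<partial>lborel) * indicator {0..1} \<theta>"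
      using rot[of \<theta>] by (cases "\<theta> \<in> {0..1}") auto
  qed
  also have "\<dots> = (\<integral>\<^sup>+w. ennreal (norm (g (z + w))) * indicator (ball 0 \<rho>) w \<partial>lborel)"
    by (simp add: nn_integral_cmult)
  also have "\<dots> = (\<integral>\<^sup>+w. ennreal (norm (g (z + w))) * indicator (ball z \<rho>) (z + w) \<partial>lborel)"
    by (intro nn_integral_cong) (auto simp: indicator_def dist_norm)
  also have "\<dots> = (\<integral>\<^sup>+w. ennreal (norm (g w)) * indicator (ball z \<rho>) w \<partial>lborel)"
    by (rule nn_integral_shift[of "\<lambda>w. ennreal (norm (g w)) * indicator (ball z \<rho>) w"]) measurable
  also have "\<dots> = (\<integral>\<^sup>+w. ennreal (indicator (ball z \<rho>) w * norm (g w)) \<partial>lborel)"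
    by (intro nn_integral_cong) (auto simp: indicator_def)
  also have "\<dots> = ennreal (LINT w:ball z \<rho>|lborel. norm (g w))"
    using set_integrable_continuous_ball[of "\<lambda>w. norm (g w)" z \<rho>] cg
    unfolding set_lebesgue_integral_def set_integrable_def
    by (subst nn_integral_eq_integral) (auto intro: continuous_intros)
  finally have "ennreal (norm (g z)) * emeasure lborel (ball (0::complex^'n) \<rho>)
     \<le> ennreal (LINT w:ball z \<rho>|lborel. norm (g w))" .
  moreover have "emeasure lborel (ball (0::complex^'n) \<rho>) = ennreal (measure lborel (ball z \<rho>))"
  proof -
    have "emeasure lborel (ball (0::complex^'n) \<rho>) = ennreal (measure lborel (ball (0::complex^'n) \<rho>))"
      using emeasure_lborel_ball_finite[of "0::complex^'n" \<rho>] by (simp add: emeasure_eq_ennreal_measure top.not_eq_extremum)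
    also have "measure lborel (ball (0::complex^'n) \<rho>) = measure lborel (ball z \<rho>)"
      by (cases "\<rho> \<ge> 0") (auto simp: content_ball ball_empty)
    finally show ?thesis .
  qed
  ultimately have "ennreal (norm (g z) * measure lborel (ball z \<rho>)) \<le> ennreal (LINT w:ball z \<rho>|lborel. norm (g w))"
    by (simp add: ennreal_mult')
  then show ?thesis
    by (subst (asm) ennreal_le_iff) (auto simp: set_lebesgue_integral_def intro!: integral_nonneg_AE)
qed

section \<open>Weights with bounded Hessian\<close>

text \<open>
  Taylor's formula of order two along the segment from \<open>a\<close> to \<open>a + h\<close>.
\<close>

lemma hessian_bounds_tangent:
  fixes \<phi> :: "complex ^ 'n \<Rightarrow> real"
  assumes "hessian_bounds m M \<phi>"
  obtains D :: "complex ^ 'n \<Rightarrow> (complex ^ 'n) \<Rightarrow>\<^sub>L real"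
  where "\<And>z. (\<phi> has_derivative blinfun_apply (D z)) (at z)"
    and "\<And>a h. \<phi> a + D a h + m / 2 * (norm h)\<^sup>2 \<le> \<phi> (a + h)"
    and "\<And>a h. \<phi> (a + h) \<le> \<phi> a + D a h + M / 2 * (norm h)\<^sup>2"
proof -
  obtain D :: "complex ^ 'n \<Rightarrow> (complex ^ 'n) \<Rightarrow>\<^sub>L real"
    and H :: "complex ^ 'n \<Rightarrow> (complex ^ 'n) \<Rightarrow>\<^sub>L ((complex ^ 'n) \<Rightarrow>\<^sub>L real)"
    where D: "\<And>z. (\<phi> has_derivative blinfun_apply (D z)) (at z)"
    and H: "\<And>z. (D has_derivative blinfun_apply (H z)) (at z)"
    and B: "\<And>z h. m * (norm h)\<^sup>2 \<le> H z h h" "\<And>z h. H z h h \<le> M * (norm h)\<^sup>2"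
    using assms unfolding hessian_bounds_def by blast
  have main: "\<exists>t. \<phi> (a + h) = \<phi> a + D a h + H (a + t *\<^sub>R h) h h / 2" for a h
  proof -
    define d where "d k s = (if k = 0 then \<phi> (a + s *\<^sub>R h) else if k = Suc 0 then D (a + s *\<^sub>R h) h
      else H (a + s *\<^sub>R h) h h)" for k :: nat and s :: real
    have d_eq: "d 0 = (\<lambda>s. \<phi> (a + s *\<^sub>R h))" "d (Suc 0) = (\<lambda>s. D (a + s *\<^sub>R h) h)"
        "d 2 = (\<lambda>s. H (a + s *\<^sub>R h) h h)"
      by (auto simp: d_def)
    have line: "((\<lambda>s. a + s *\<^sub>R h) has_derivative (\<lambda>s. s *\<^sub>R h)) (at s)" for s
      by (auto intro!: derivative_eq_intros)
    have d0: "(d 0 has_field_derivative d (Suc 0) s) (at s)" for s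
    proof -
      have "((\<lambda>s. \<phi> (a + s *\<^sub>R h)) has_derivative (\<lambda>t. D (a + s *\<^sub>R h) (t *\<^sub>R h))) (at s)"
        by (rule has_derivative_compose[OF line D])
      then show ?thesis by (simp add: d_eq has_field_derivative_def blinfun.scaleR_right mult_commute_abs)
    qed
    have d1: "(d (Suc 0) has_field_derivative d 2 s) (at s)" for s
    proof -
      have "((\<lambda>s. D (a + s *\<^sub>R h)) has_derivative (\<lambda>t. H (a + s *\<^sub>R h) (t *\<^sub>R h))) (at s)"
        by (rule has_derivative_compose[OF line H])
      then have "((\<lambda>s. D (a + s *\<^sub>R h) h) has_derivative (\<lambda>t. H (a + s *\<^sub>R h) (t *\<^sub>R h) h)) (at s)"
        by (rule bounded_linear.has_derivative[OF blinfun.bounded_linear_left])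
      then show ?thesis by (simp add: d_eq has_field_derivative_def blinfun.scaleR_right blinfun.scaleR_left mult_commute_abs)
    qed
    have "\<exists>t. 0 < t \<and> t < 1 \<and> d 0 1 = (\<Sum>k<2. d k 0 / fact k * 1 ^ k) + d 2 t / fact 2 * 1 ^ 2"
      by (rule Maclaurin) (use d0 d1 in \<open>auto simp: less_2_cases_iff numeral_2_eq_2 less_Suc_eq\<close>)
    then show ?thesis by (auto simp: d_def numeral_2_eq_2 fact_reduce)
  qed
  show ?thesis
  proof (rule that[OF D])
    fix a h
    obtain t where t: "\<phi> (a + h) = \<phi> a + D a h + H (a + t *\<^sub>R h) h h / 2" using main by blast
    show "\<phi> a + D a h + m / 2 * (norm h)\<^sup>2 \<le> \<phi> (a + h)"
      using B(1)[of h "a + t *\<^sub>R h"] t by simp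
    show "\<phi> (a + h) \<le> \<phi> a + D a h + M / 2 * (norm h)\<^sup>2"
      using B(2)[where z = "a + t *\<^sub>R h" and h = h] t by simp
  qed
qed

lemma hessian_bounds_continuous:
  assumes "hessian_bounds m M \<phi>"
  shows "continuous_on UNIV \<phi>"
  using hessian_bounds_tangent[OF assms] has_derivative_continuous
  by (metis continuous_at_imp_continuous_on)

text \<open>
  The real differential of \<open>\<phi>\<close> at \<open>a\<close> is the real part of a complex-linear functional, so the
  exponential of the complexified tangent map at \<open>a\<close> is entire and nowhere zero. By the Hessian bounds its weighted
  modulus is pinched between two Gaussians centred at \<open>a\<close>. These functions serve as test functions for the
  lower bound and as local gauges that remove the weight in the upper bound.
\<close>

lemma peak_functions:
  fixes \<phi> :: "complex ^ 'n \<Rightarrow> real"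
  assumes "hessian_bounds m M \<phi>"
  obtains k :: "complex ^ 'n \<Rightarrow> complex ^ 'n \<Rightarrow> complex"
  where "\<And>a. entire (k a)" and "\<And>a z. k a z \<noteq> 0"
    and "\<And>a z. exp (- (M / 2) * (norm (z - a))\<^sup>2) \<le> norm (k a z) * exp (- \<phi> z)"
    and "\<And>a z. norm (k a z) * exp (- \<phi> z) \<le> exp (- (m / 2) * (norm (z - a))\<^sup>2)"
proof -
  obtain D :: "complex ^ 'n \<Rightarrow> (complex ^ 'n) \<Rightarrow>\<^sub>L real"
    where lo: "\<And>a h. \<phi> a + D a h + m / 2 * (norm h)\<^sup>2 \<le> \<phi> (a + h)"
    and up: "\<And>a h. \<phi> (a + h) \<le> \<phi> a + D a h + M / 2 * (norm h)\<^sup>2"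
    using hessian_bounds_tangent[OF assms] by metis
  \<comment> \<open>The complex-linear functional whose real part is the real differential.\<close>
  define L where "L a h = Complex (D a h) (- D a (\<i> *s h))" for a h
  have Lsc: "L a (c *s h) = c * L a h" for a c h
  proof -
    have *: "c *s h = Re c *\<^sub>R h + Im c *\<^sub>R (\<i> *s h)" "\<i> *s (c *s h) = Re c *\<^sub>R (\<i> *s h) - Im c *\<^sub>R h"
      by (auto simp: vec_eq_iff complex_eq_iff)
    have "D a (c *s h) = Re c * D a h + Im c * D a (\<i> *s h)"
      by (subst *(1)) (simp add: blinfun.add_right blinfun.scaleR_right)
    moreover have "D a (\<i> *s (c *s h)) = Re c * D a (\<i> *s h) - Im c * D a h"
      by (subst *(2)) (simp add: blinfun.diff_right blinfun.scaleR_right)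
    ultimately show ?thesis unfolding L_def by (simp add: complex_eq_iff)
  qed
  have Ladd: "L a (h + h') = L a h + L a h'" for a h h'
    by (auto simp: L_def complex_eq_iff blinfun.add_right vector_add_ldistrib)
  have Llin: "bounded_linear (L a)" for a
  proof (subst linear_conv_bounded_linear[symmetric], rule linearI)
    fix r :: real and h :: "complex ^ 'n"
    have "r *\<^sub>R h = complex_of_real r *s h" 
      unfolding vec_eq_iff vector_scaleR_component vector_smult_component by (simp add: scaleR_conv_of_real)
    then show "L a (r *\<^sub>R h) = r *\<^sub>R L a h" by (simp only: Lsc scaleR_conv_of_real[of r "L a h"])
  qed (rule Ladd)
  define k where "k a z = exp (of_real (\<phi> a) + L a (z - a))" for a z
  have nk: "norm (k a z) * exp (- \<phi> z) = exp (\<phi> a + D a (z - a) - \<phi> z)" for a z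
    by (simp add: k_def L_def exp_add[symmetric] exp_diff exp_minus divide_inverse)
  show ?thesis
  proof (rule that)
    fix a z
    show "entire (k a)" unfolding entire_def
    proof
      fix z
      have "((\<lambda>z. of_real (\<phi> a) + L a (z - a)) has_derivative L a) (at z)"
        by (auto intro!: derivative_eq_intros bounded_linear.has_derivative[OF Llin])
      then have "(k a has_derivative (\<lambda>h. k a z * L a h)) (at z)"
        unfolding k_def by (rule has_derivative_compose[OF _ DERIV_exp[unfolded has_field_derivative_def]])
      then show "\<exists>L. (k a has_derivative L) (at z) \<and> (\<forall>c h. L (c *s h) = c * L h)"
        by (intro exI conjI) (auto simp: Lsc)
    qed
    show "k a z \<noteq> 0" by (simp add: k_def)
    show "exp (- (M / 2) * (norm (z - a))\<^sup>2) \<le> norm (k a z) * exp (- \<phi> z)"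
      using up[of a "z - a"] by (simp add: nk)
    show "norm (k a z) * exp (- \<phi> z) \<le> exp (- (m / 2) * (norm (z - a))\<^sup>2)"
      using lo[of a "z - a"] by (simp add: nk)
  qed
qed

lemma weighted_modulus_continuous:
  fixes \<phi> :: "complex ^ 'n \<Rightarrow> real"
  assumes "hessian_bounds m M \<phi>" "entire g"
  shows "continuous_on UNIV (\<lambda>z. norm (g z) * exp (- \<phi> z))"
  using hessian_bounds_continuous[OF assms(1)] entire_continuous[OF assms(2)]
  by (intro continuous_intros)

text \<open>
  The sub-mean value property survives the weight, with a constant that depends only on \<open>M\<close> and \<open>\<rho>\<close>.
\<close>

lemma weighted_modulus_le_ball_mean:
  fixes \<phi> :: "complex ^ 'n \<Rightarrow> real"
  assumes \<phi>: "hessian_bounds m M \<phi>" and M: "0 \<le> M" and g: "entire g" and \<rho>: "0 < \<rho>"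
  shows "norm (g z) * exp (- \<phi> z) \<le>
    exp (M / 2 * \<rho>\<^sup>2) * ((LINT w:ball z \<rho>|lborel. norm (g w) * exp (- \<phi> w)) / measure lborel (ball z \<rho>))"
proof -
  obtain k :: "complex ^ 'n \<Rightarrow> complex ^ 'n \<Rightarrow> complex" where k: "\<And>a. entire (k a)" "\<And>a z. k a z \<noteq> 0"
    and lo: "\<And>a z. exp (- (M / 2) * (norm (z - a))\<^sup>2) \<le> norm (k a z) * exp (- \<phi> z)"
    and up: "\<And>a z. norm (k a z) * exp (- \<phi> z) \<le> exp (- (m / 2) * (norm (z - a))\<^sup>2)"
    using peak_functions[OF \<phi>] by metis
  \<comment> \<open>Dividing by the peak function at \<open>z\<close> replaces the weight by a factor that is at most 1 at \<open>z\<close> and at least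
      \<open>exp (- M \<rho>\<^sup>2 / 2)\<close> on the ball.\<close>
  define G where "G w = g w / k z w" for w
  have G: "entire G" unfolding G_def by (rule entire_divide[OF g k])
  define F where "F w = norm (g w) * exp (- \<phi> w)" for w
  have F: "continuous_on UNIV F" unfolding F_def by (rule weighted_modulus_continuous[OF \<phi> g])
  have FG: "F w = norm (G w) * (norm (k z w) * exp (- \<phi> w))" for w
    using k(2)[of z w] by (simp add: F_def G_def norm_divide)
  define V where "V = measure lborel (ball z \<rho>)"
  have V: "0 < V" unfolding V_def by (rule content_ball_gt_0[OF \<rho>])
  have "norm (k z z) * exp (- \<phi> z) \<le> 1" using up[of z z] by simp
  then have "F z \<le> norm (G z) * 1" unfolding FG by (rule mult_left_mono) simp
  then have Vz: "F z * V \<le> norm (G z) * V" using V by (intro mult_right_mono) auto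
  have "norm (G z) * V \<le> (LINT w:ball z \<rho>|lborel. norm (G w))"
    unfolding V_def by (rule norm_entire_le_ball_mean[OF G])
  moreover have "(LINT w:ball z \<rho>|lborel. norm (G w)) \<le> (LINT w:ball z \<rho>|lborel. exp (M / 2 * \<rho>\<^sup>2) * F w)"
  proof (rule set_integral_mono)
    show "set_integrable lborel (ball z \<rho>) (\<lambda>w. norm (G w))"
      by (intro set_integrable_continuous_ball continuous_on_norm entire_continuous G)
    show "set_integrable lborel (ball z \<rho>) (\<lambda>w. exp (M / 2 * \<rho>\<^sup>2) * F w)"
      by (intro set_integrable_continuous_ball continuous_on_mult continuous_on_const F)
    fix w assume "w \<in> ball z \<rho>"
    then have "(norm (w - z))\<^sup>2 \<le> \<rho>\<^sup>2" by (intro power_mono) (auto simp: dist_norm norm_minus_commute)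
    then have "M / 2 * (norm (w - z))\<^sup>2 \<le> M / 2 * \<rho>\<^sup>2" using M by (intro mult_left_mono) auto
    then have "exp (- (M / 2 * \<rho>\<^sup>2)) \<le> norm (k z w) * exp (- \<phi> w)"
      using lo[where a = z and z = w] by (smt (verit) exp_le_cancel_iff mult_minus_left)
    then have "norm (G w) * exp (- (M / 2 * \<rho>\<^sup>2)) \<le> F w" unfolding FG by (rule mult_left_mono) simp
    then show "norm (G w) \<le> exp (M / 2 * \<rho>\<^sup>2) * F w"
      by (simp add: exp_minus field_simps)
  qed
  ultimately have "F z * V \<le> (LINT w:ball z \<rho>|lborel. exp (M / 2 * \<rho>\<^sup>2) * F w)"
    using Vz by linarith
  then have "F z * V \<le> exp (M / 2 * \<rho>\<^sup>2) * (LINT w:ball z \<rho>|lborel. F w)"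
    by (simp only: set_integral_mult_right)
  then show ?thesis using V unfolding V_def F_def by (simp add: field_simps)
qed

lemma weighted_modulus_powr_le_ball_mean:
  fixes \<phi> :: "complex ^ 'n \<Rightarrow> real"
  assumes \<phi>: "hessian_bounds m M \<phi>" and M: "0 \<le> M" and g: "entire g" and \<rho>: "0 < \<rho>" and p: "1 \<le> p"
  shows "(norm (g z) * exp (- \<phi> z)) powr p \<le> exp (M / 2 * \<rho>\<^sup>2) powr p / measure lborel (ball (0 :: complex ^ 'n) \<rho>)
     * (LINT w:ball z \<rho>|lborel. (norm (g w) * exp (- \<phi> w)) powr p)"
proof -
  define F where "F w = norm (g w) * exp (- \<phi> w)" for w
  define V where "V = measure lborel (ball z \<rho>)"
  have V: "0 < V" unfolding V_def by (rule content_ball_gt_0[OF \<rho>])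
  have F0: "0 \<le> F w" for w by (simp add: F_def)
  have F: "continuous_on UNIV F" unfolding F_def by (rule weighted_modulus_continuous[OF \<phi> g])
  have "F z powr p \<le> (exp (M / 2 * \<rho>\<^sup>2) * ((LINT w:ball z \<rho>|lborel. F w) / V)) powr p"
    using weighted_modulus_le_ball_mean[OF \<phi> M g \<rho>, of z] p F0 by (intro powr_mono2) (auto simp: F_def V_def)
  also have "\<dots> = exp (M / 2 * \<rho>\<^sup>2) powr p * ((LINT w:ball z \<rho>|lborel. F w) / V) powr p"
    using F0 V by (subst powr_mult) (auto simp: set_lebesgue_integral_def intro!: integral_nonneg_AE divide_nonneg_nonneg)
  also have "\<dots> \<le> exp (M / 2 * \<rho>\<^sup>2) powr p * ((LINT w:ball z \<rho>|lborel. F w powr p) / V)"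
    using ball_mean_powr_le[OF F F0 p \<rho>, of z] V
    by (intro mult_left_mono) (auto simp: V_def field_simps)
  finally show ?thesis by (simp add: F_def V_def content_ball_center[of 0 \<rho> z])
qed

section \<open>The function spaces\<close>

lemma ell_vecs_iff: "x \<in> vecs (ell s) \<longleftrightarrow> summable (\<lambda>k. norm (x k) powr s)"
  by (simp add: Lspace_def integrable_count_space_nat_iff)

lemma ell_nrm:
  assumes "x \<in> vecs (ell s)"
  shows "nrm (ell s) x = (\<Sum>k. norm (x k) powr s) powr (1 / s)"
  using assms by (simp add: Lspace_def integral_count_space_nat)

lemma Lspace_nrm_nonneg: "0 \<le> nrm (Lspace s N) f"
  by (simp add: Lspace_def)

lemma weighted_L_vecs_iff:
  assumes [measurable]: "\<phi> \<in> borel_measurable \<mu>"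
  shows "f \<in> vecs (weighted_L \<phi> s \<mu>) \<longleftrightarrow>
    f \<in> borel_measurable \<mu> \<and> integrable \<mu> (\<lambda>z. (norm (f z) * exp (- \<phi> z)) powr s)"
proof -
  have "exp (- (s * \<phi> z)) * norm (f z) powr s = (norm (f z) * exp (- \<phi> z)) powr s" for z
    by (subst powr_mult) (auto simp: powr_def)
  then show ?thesis
    unfolding weighted_L_def Lspace_def by (auto simp: integrable_density)
qed

lemma weighted_L_nrm:
  assumes [measurable]: "\<phi> \<in> borel_measurable \<mu>" "f \<in> borel_measurable \<mu>"
  shows "nrm (weighted_L \<phi> s \<mu>) f = (LINT z|\<mu>. (norm (f z) * exp (- \<phi> z)) powr s) powr (1 / s)"
proof -
  have "exp (- (s * \<phi> z)) * norm (f z) powr s = (norm (f z) * exp (- \<phi> z)) powr s" for z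
    by (subst powr_mult) (auto simp: powr_def)
  then show ?thesis
    unfolding weighted_L_def Lspace_def by (simp add: integral_density)
qed

lemma weighted_L_nrm_nonneg: "0 \<le> nrm (weighted_L \<phi> s \<mu>) f"
  by (simp add: weighted_L_def Lspace_nrm_nonneg)

lemma fock_nrm_nonneg: "0 \<le> nrm (fock \<phi> s) f"
  by (simp add: fock_def weighted_L_nrm_nonneg)

text \<open>
  Entire functions are Borel measurable, so the completed Lebesgue measure may be replaced by \<open>lborel\<close>.
\<close>

lemma fock_vecs_iff:
  assumes \<phi>: "continuous_on UNIV \<phi>"
  shows "f \<in> vecs (fock \<phi> s) \<longleftrightarrow> entire f \<and> integrable lborel (\<lambda>z. (norm (f z) * exp (- \<phi> z)) powr s)"
proof -
  have [measurable]: "\<phi> \<in> borel_measurable borel" by (rule borel_measurable_continuous_onI[OF \<phi>])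
  have [measurable]: "f \<in> borel_measurable borel" if "entire f"
    by (rule borel_measurable_continuous_onI[OF entire_continuous[OF that]])
  show ?thesis
    by (auto simp: fock_def weighted_L_vecs_iff measurable_completion integrable_completion)
qed

lemma fock_nrm:
  assumes \<phi>: "continuous_on UNIV \<phi>" and f: "entire f"
  shows "nrm (fock \<phi> s) f = (LINT z|lborel. (norm (f z) * exp (- \<phi> z)) powr s) powr (1 / s)"
proof -
  have [measurable]: "\<phi> \<in> borel_measurable borel" "f \<in> borel_measurable borel"
    using \<phi> entire_continuous[OF f] by (auto intro: borel_measurable_continuous_onI)
  show ?thesis
    by (simp add: fock_def weighted_L_nrm measurable_completion integral_completion)
qed

section \<open>Upper bound: sampling\<close>

text \<open>
  Sampling along any translate of a separated sequence is bounded, with a norm bound that does not depend on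
  the translate: the sub-mean value property bounds the samples by integrals over disjoint balls.
\<close>

lemma sampling_operator:
  fixes \<phi> :: "complex ^ 'n \<Rightarrow> real" and c :: "nat \<Rightarrow> complex ^ 'n" and t :: "complex ^ 'n"
  assumes \<phi>: "hessian_bounds m M \<phi>" and M: "0 \<le> M" and \<rho>: "0 < \<rho>" and p: "1 \<le> p"
    and dis: "disjoint_family (\<lambda>k. ball (c k) \<rho>)"
  defines "S \<equiv> \<lambda>x k. x (c k + t) * complex_of_real (exp (- \<phi> (c k + t)))"
  shows "linear_op (fock \<phi> p) (ell p) S"
    and "x \<in> vecs (fock \<phi> p) \<Longrightarrow> nrm (ell p) (S x) \<le>
      (exp (M / 2 * \<rho>\<^sup>2) powr p / measure lborel (ball (0 :: complex ^ 'n) \<rho>)) powr (1 / p) * nrm (fock \<phi> p) x"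
proof -
  note cont\<phi> = hessian_bounds_continuous[OF \<phi>]
  define A where "A = exp (M / 2 * \<rho>\<^sup>2) powr p / measure lborel (ball (0 :: complex ^ 'n) \<rho>)"
  have A: "0 < A" using content_ball_gt_0[OF \<rho>, where z = "0 :: complex ^ 'n"] by (simp add: A_def)
  have partial: "(\<Sum>k<N. norm (S x k) powr p) \<le> A * (LINT z|lborel. (norm (x z) * exp (- \<phi> z)) powr p)"
    if x: "x \<in> vecs (fock \<phi> p)" for x N
  proof -
    have ex: "entire x" and ix: "integrable lborel (\<lambda>z. (norm (x z) * exp (- \<phi> z)) powr p)"
      using x by (auto simp: fock_vecs_iff[OF cont\<phi>])
    have "(\<Sum>k<N. norm (S x k) powr p) \<le> (\<Sum>k<N. A * (LINT w:ball (c k + t) \<rho>|lborel. (norm (x w) * exp (- \<phi> w)) powr p))"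
      using weighted_modulus_powr_le_ball_mean[OF \<phi> M ex \<rho> p]
      by (intro sum_mono) (simp add: S_def norm_mult A_def)
    also have "\<dots> \<le> A * (LINT z|lborel. (norm (x z) * exp (- \<phi> z)) powr p)"
      unfolding sum_distrib_left[symmetric]
      using A disjoint_family_ball_shift[OF dis, of t]
      by (intro mult_left_mono sum_set_integral_disjoint_le ix) (auto simp: disjoint_family_on_def)
    finally show ?thesis .
  qed
  have summ: "summable (\<lambda>k. norm (S x k) powr p)" if "x \<in> vecs (fock \<phi> p)" for x
    by (rule summableI_nonneg_bounded[OF _ partial[OF that]]) simp
  show "linear_op (fock \<phi> p) (ell p) S"
    unfolding linear_op_def using summ by (auto simp: ell_vecs_iff S_def algebra_simps)
  show "nrm (ell p) (S x) \<le> (exp (M / 2 * \<rho>\<^sup>2) powr p / measure lborel (ball (0 :: complex ^ 'n) \<rho>)) powr (1 / p) * nrm (fock \<phi> p) x"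
    if x: "x \<in> vecs (fock \<phi> p)"
  proof -
    have ex: "entire x" using x by (auto simp: fock_vecs_iff[OF cont\<phi>])
    have "nrm (ell p) (S x) = (\<Sum>k. norm (S x k) powr p) powr (1 / p)"
      using summ[OF x] by (intro ell_nrm) (simp add: ell_vecs_iff)
    also have "\<dots> \<le> (A * (LINT z|lborel. (norm (x z) * exp (- \<phi> z)) powr p)) powr (1 / p)"
      using p summ[OF x] partial[OF x] by (intro powr_mono2 suminf_le_const suminf_nonneg) auto
    also have "\<dots> = A powr (1 / p) * nrm (fock \<phi> p) x"
      using A by (subst powr_mult) (auto simp: fock_nrm[OF cont\<phi> ex])
    finally show ?thesis by (simp add: A_def)
  qed
qed

text \<open>
  On the piece \<open>P k\<close> the weighted modulus is at most a constant times its integral \<open>I k\<close> over a larger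
  ball around \<open>c k\<close>. Lattice balls are among the admissible pieces, so the
  measure is estimated by a sum over a cover and not over a partition.
\<close>

lemma weighted_L_le_local_means:
  fixes \<phi> :: "complex ^ 'n \<Rightarrow> real"
  assumes \<phi>: "hessian_bounds m M \<phi>" and M: "0 \<le> M" and \<rho>: "0 < \<rho>" and q: "1 \<le> q"
    and \<mu>: "locally_finite_borel \<mu>" and B: "0 < B"
    and P: "\<And>k. P k \<in> sets borel" "\<And>k. P k \<subseteq> ball (c k) R" "(\<Union>k::nat. P k) = UNIV"
    and \<beta>: "\<And>k. 0 \<le> \<beta> k" "\<And>k. measure \<mu> (P k) \<le> B * \<beta> k powr q"
    and x: "entire x"
  defines "I \<equiv> \<lambda>k. (LINT t:ball 0 (R + \<rho>)|lborel. norm (x (c k + t)) * exp (- \<phi> (c k + t)))"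
  assumes summ: "summable (\<lambda>k. (\<beta> k * I k) powr q)"
  shows "x \<in> vecs (weighted_L \<phi> q \<mu>)"
    and "nrm (weighted_L \<phi> q \<mu>) x \<le> exp (M / 2 * \<rho>\<^sup>2) / measure lborel (ball (0 :: complex ^ 'n) \<rho>) * B powr (1 / q)
      * (\<Sum>k. (\<beta> k * I k) powr q) powr (1 / q)"
proof -
  define V where "V = measure lborel (ball (0 :: complex ^ 'n) \<rho>)"
  have V: "0 < V" unfolding V_def by (rule content_ball_gt_0[OF \<rho>])
  define C where "C = exp (M / 2 * \<rho>\<^sup>2) / V"
  have C: "0 < C" using V by (simp add: C_def)
  define F where "F z = norm (x z) * exp (- \<phi> z)" for z
  have F0: "0 \<le> F z" for z by (simp add: F_def)
  have contF: "continuous_on UNIV F" unfolding F_def by (rule weighted_modulus_continuous[OF \<phi> x])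
  have sets\<mu> [measurable_cong]: "sets \<mu> = sets borel" using \<mu> by (simp add: locally_finite_borel_def)
  have [measurable]: "F \<in> borel_measurable borel" "\<phi> \<in> borel_measurable borel" "x \<in> borel_measurable borel"
    using contF hessian_bounds_continuous[OF \<phi>] entire_continuous[OF x]
    by (auto intro: borel_measurable_continuous_onI)
  have [measurable]: "P k \<in> sets borel" for k by (rule P)
  have I: "I k = (LINT w:ball (c k) (R + \<rho>)|lborel. F w)" for k
    unfolding I_def by (subst set_integral_ball_shift) (auto simp: F_def)
  have local: "F z \<le> C * I k" if z: "z \<in> P k" for z k
  proof -
    have "F z \<le> exp (M / 2 * \<rho>\<^sup>2) * ((LINT w:ball z \<rho>|lborel. F w) / V)"
      using weighted_modulus_le_ball_mean[OF \<phi> M x \<rho>, of z]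
      by (simp add: F_def V_def content_ball_center[of z \<rho> 0])
    also have "(LINT w:ball z \<rho>|lborel. F w) \<le> I k"
      unfolding I set_lebesgue_integral_def
    proof (rule integral_mono)
      show "integrable lborel (\<lambda>w. indicator (ball z \<rho>) w *\<^sub>R F w)" "integrable lborel (\<lambda>w. indicator (ball (c k) (R + \<rho>)) w *\<^sub>R F w)"
        using set_integrable_continuous_ball[OF contF] by (auto simp: set_integrable_def)
      fix w
      have "w \<in> ball (c k) (R + \<rho>)" if "w \<in> ball z \<rho>"
      proof -
        have "dist (c k) z < R" using z P(2)[of k] by auto
        then show ?thesis using that dist_triangle[of "c k" w z] by simp
      qed
      then show "indicator (ball z \<rho>) w *\<^sub>R F w \<le> indicator (ball (c k) (R + \<rho>)) w *\<^sub>R F w"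
        using F0[of w] by (auto simp: indicator_def)
    qed
    finally show ?thesis using V by (simp add: C_def divide_right_mono mult_left_mono)
  qed
  have I0: "0 \<le> I k" for k unfolding I using F0 by (auto simp: set_lebesgue_integral_def)
  define \<Sigma> where "\<Sigma> = (\<Sum>k. (\<beta> k * I k) powr q)"
  have \<Sigma>: "0 \<le> \<Sigma>" unfolding \<Sigma>_def by (intro suminf_nonneg summ) auto
  have "(\<integral>\<^sup>+z. ennreal (F z powr q) \<partial>\<mu>) \<le> (\<integral>\<^sup>+z. (\<Sum>k. ennreal ((C * I k) powr q) * indicator (P k) z) \<partial>\<mu>)"
  proof (rule nn_integral_mono)
    fix z
    obtain k where k: "z \<in> P k" using P(3) by blast
    define g where "g j = ennreal ((C * I j) powr q) * indicator (P j) z" for j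
    have "ennreal (F z powr q) \<le> g k"
      using local[OF k] F0 q k by (auto simp: g_def intro!: ennreal_leI powr_mono2)
    also have "\<dots> = sum g {k}" by simp
    also have "\<dots> \<le> suminf g" by (rule sum_le_suminf) auto
    also have "suminf g = (\<Sum>j. ennreal ((C * I j) powr q) * indicator (P j) z)" by (simp add: g_def[abs_def])
    finally show "ennreal (F z powr q) \<le> (\<Sum>k. ennreal ((C * I k) powr q) * indicator (P k) z)" .
  qed
  also have "\<dots> = (\<Sum>k. ennreal ((C * I k) powr q) * emeasure \<mu> (P k))"
    by (subst nn_integral_suminf) (auto simp: nn_integral_cmult)
  also have "\<dots> \<le> (\<Sum>k. ennreal (C powr q * B * (\<beta> k * I k) powr q))"
  proof (rule suminf_le)
    fix k
    have "(C * I k) powr q * measure \<mu> (P k) \<le> (C * I k) powr q * (B * \<beta> k powr q)"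
      using \<beta>(2) by (intro mult_left_mono) auto
    also have "\<dots> = C powr q * B * (\<beta> k * I k) powr q"
      using C I0 \<beta> by (simp add: powr_mult)
    finally show "ennreal ((C * I k) powr q) * emeasure \<mu> (P k) \<le> ennreal (C powr q * B * (\<beta> k * I k) powr q)"
      unfolding locally_finite_emeasure[OF \<mu> P(1) P(2)]
      by (subst ennreal_mult[symmetric]) (auto intro: ennreal_leI)
  qed auto
  also have "\<dots> = ennreal (C powr q * B * \<Sigma>)"
    unfolding \<Sigma>_def suminf_mult[OF summ, symmetric]
    using B by (intro suminf_ennreal2 summable_mult summ) auto
  finally have nn: "(\<integral>\<^sup>+z. ennreal (F z powr q) \<partial>\<mu>) \<le> ennreal (C powr q * B * \<Sigma>)" .
  then have int: "integrable \<mu> (\<lambda>z. F z powr q)"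
    by (intro integrableI_nonneg) (auto simp: less_top intro: le_less_trans)
  then show "x \<in> vecs (weighted_L \<phi> q \<mu>)"
    by (subst weighted_L_vecs_iff) (auto simp: F_def)
  have "(LINT z|\<mu>. F z powr q) \<le> C powr q * B * \<Sigma>"
    using nn B \<Sigma> nn_integral_eq_integral[OF int] by (simp add: ennreal_le_iff)
  then have "(LINT z|\<mu>. F z powr q) powr (1 / q) \<le> (C powr q * B * \<Sigma>) powr (1 / q)"
    using q by (intro powr_mono2) auto
  also have "\<dots> = C * B powr (1 / q) * \<Sigma> powr (1 / q)"
    using C B \<Sigma> q by (simp add: powr_mult powr_powr)
  finally show "nrm (weighted_L \<phi> q \<mu>) x \<le> exp (M / 2 * \<rho>\<^sup>2) / measure lborel (ball (0 :: complex ^ 'n) \<rho>) * B powr (1 / q)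
      * (\<Sum>k. (\<beta> k * I k) powr q) powr (1 / q)"
    by (subst weighted_L_nrm) (auto simp: F_def C_def V_def \<Sigma>_def)
qed

text \<open>
  The sequence \<open>I i\<close> is an integral over offsets \<open>t\<close> of samples at \<open>c k + t\<close>. For each \<open>t\<close> the weighted
  samples satisfy the summing inequality of the diagonal operator, and two applications of Minkowski's
  integral inequality, one for the exponent \<open>q\<close> and one for \<open>r\<close>, integrate it over \<open>t\<close>. Finite
  sections keep all integrands continuous.
\<close>

lemma local_means_summing:
  fixes \<phi> :: "complex ^ 'n \<Rightarrow> real" and c :: "nat \<Rightarrow> complex ^ 'n" and \<beta> :: "nat \<Rightarrow> real" and R :: real
  assumes \<phi>: "hessian_bounds m M \<phi>" and M: "0 \<le> M" and \<rho>: "0 < \<rho>"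
    and pqr: "1 \<le> p" "1 \<le> q" "1 \<le> r"
    and dis: "disjoint_family (\<lambda>k. ball (c k) \<rho>)" and \<beta>: "\<And>k. 0 \<le> \<beta> k"
    and lin: "linear_op (ell p) (ell q) (diag_op (\<lambda>k. complex_of_real (\<beta> k)))"
    and C: "C \<in> summing_consts r (ell p) (ell q) (diag_op (\<lambda>k. complex_of_real (\<beta> k)))"
    and xs: "set xs \<subseteq> vecs (fock \<phi> p)"
  defines "I \<equiv> \<lambda>i k. (LINT t:ball 0 R|lborel. norm ((xs ! i) (c k + t)) * exp (- \<phi> (c k + t)))"
  shows "\<And>i. i < length xs \<Longrightarrow> summable (\<lambda>k. (\<beta> k * I i k) powr q)"
    and "(\<Sum>i<length xs. ((\<Sum>k. (\<beta> k * I i k) powr q) powr (1 / q)) powr r) powr (1 / r)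
      \<le> measure lborel (ball (0 :: complex ^ 'n) R)
         * (exp (M / 2 * \<rho>\<^sup>2) powr p / measure lborel (ball (0 :: complex ^ 'n) \<rho>)) powr (1 / p)
         * C * weak_norm r (fock \<phi> p) xs"
proof -
  define D where "D = diag_op (\<lambda>k. complex_of_real (\<beta> k))"
  define V where "V = measure lborel (ball (0 :: complex ^ 'n) R)"
  define Cs where "Cs = (exp (M / 2 * \<rho>\<^sup>2) powr p / measure lborel (ball (0 :: complex ^ 'n) \<rho>)) powr (1 / p)"
  have Cs: "0 < Cs" using content_ball_gt_0[OF \<rho>, where z = "0 :: complex ^ 'n"] by (simp add: Cs_def)
  have C0: "0 \<le> C" using C by (simp add: summing_consts_def)
  define S where "S t x k = x (c k + t) * complex_of_real (exp (- \<phi> (c k + t)))"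
    for t :: "complex ^ 'n" and x :: "complex ^ 'n \<Rightarrow> complex" and k :: nat
  have S: "linear_op (fock \<phi> p) (ell p) (S t)" "\<And>x. x \<in> vecs (fock \<phi> p) \<Longrightarrow> nrm (ell p) (S t x) \<le> Cs * nrm (fock \<phi> p) x" for t
    using sampling_operator[where t = t, OF \<phi> M \<rho> pqr(1) dis] by (auto simp: S_def[abs_def] Cs_def)
  define F where "F i k t = \<beta> k * (norm ((xs ! i) (c k + t)) * exp (- \<phi> (c k + t)))" for i k and t :: "complex ^ 'n"
  have F0: "0 \<le> F i k t" for i k t by (simp add: F_def \<beta>)
  have contF: "continuous_on UNIV (F i k)" if "i < length xs" for i k
  proof -
    have "xs ! i \<in> vecs (fock \<phi> p)" using xs that by auto
    then have "entire (xs ! i)" by (simp add: fock_vecs_iff[OF hessian_bounds_continuous[OF \<phi>]])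
    note cont = weighted_modulus_continuous[OF \<phi> this]
    have "continuous_on UNIV (\<lambda>t. c k + t)" by (intro continuous_intros)
    note continuous_on_compose2[OF cont this subset_UNIV]
    from this show ?thesis unfolding F_def[abs_def] by (rule continuous_on_mult[OF continuous_on_const])
  qed
  define n where "n N i t = (\<Sum>k<N. F i k t powr q) powr (1 / q)" for N i t
  have n0: "0 \<le> n N i t" for N i t by (simp add: n_def)
  have contn: "continuous_on UNIV (n N i)" if "i < length xs" for N i
    unfolding n_def[abs_def]
    using pqr contF[OF that] F0 by (intro continuous_on_powr' continuous_on_sum continuous_on_const) (auto intro: sum_nonneg)
  define h where "h N t = (\<Sum>i<length xs. n N i t powr r) powr (1 / r)" for N t
  have conth: "continuous_on UNIV (h N)" for N
    unfolding h_def[abs_def]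
    using pqr contn n0 by (intro continuous_on_powr' continuous_on_sum continuous_on_const) (auto intro: sum_nonneg)
  define W where "W = C * (Cs * weak_norm r (fock \<phi> p) xs)"
  have W: "0 \<le> W" unfolding W_def
    using C0 Cs pqr weak_norm_nonneg[OF xs fock_nrm_nonneg, of r] by simp
  \<comment> \<open>For a fixed offset \<open>t\<close> the operator is the composition of sampling at \<open>c k + t\<close> with the diagonal operator.\<close>
  have hW: "h N t \<le> W" for N t
  proof -
    have Sx: "S t x \<in> vecs (ell p)" if "x \<in> vecs (fock \<phi> p)" for x
      using S(1)[of t] that by (auto simp: linear_op_def)
    have le: "n N i t \<le> nrm (ell q) (D (S t (xs ! i)))" if i: "i < length xs" for i
    proof -
      have "xs ! i \<in> vecs (fock \<phi> p)" using xs i by auto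
      then have DS: "D (S t (xs ! i)) \<in> vecs (ell q)" using lin Sx by (auto simp: linear_op_def D_def)
      have *: "norm (D (S t (xs ! i)) k) = F i k t" for k
        by (simp add: D_def diag_op_def S_def F_def norm_mult \<beta>)
      have "summable (\<lambda>k. F i k t powr q)" using DS by (simp add: ell_vecs_iff *)
      then have "(\<Sum>k<N. F i k t powr q) \<le> (\<Sum>k. F i k t powr q)" by (intro sum_le_suminf) auto
      then show ?thesis unfolding n_def ell_nrm[OF DS] * using pqr by (intro powr_mono2 sum_nonneg) auto
    qed
    have "h N t \<le> (\<Sum>i<length xs. nrm (ell q) (D (S t (xs ! i))) powr r) powr (1 / r)"
      unfolding h_def using pqr n0 le by (intro powr_mono2 sum_mono) (auto intro: sum_nonneg)
    also have "\<dots> = (\<Sum>y\<leftarrow>map (S t) xs. nrm (ell q) (D y) powr r) powr (1 / r)"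
      by (simp add: sum_list_powr_nth)
    also have "\<dots> \<le> C * weak_norm r (ell p) (map (S t) xs)"
      using xs Sx by (intro summing_constsD) (auto simp: D_def intro: C)
    also have "\<dots> \<le> W" unfolding W_def
      using C0 pqr by (intro mult_left_mono weak_norm_image_le S Cs xs Lspace_nrm_nonneg) auto
    finally show ?thesis .
  qed
  define T where "T = restrict_space lborel (ball (0 :: complex ^ 'n) R)"
  have int: "integrable T f" if "continuous_on UNIV f" for f :: "complex ^ 'n \<Rightarrow> real"
    using set_integrable_continuous_ball[OF that, of 0 R] by (simp add: T_def integrable_restrict_space set_integrable_def)
  have I: "\<beta> k * I i k = (LINT t|T. F i k t)" for i k
    by (simp add: I_def T_def F_def integral_restrict_space set_lebesgue_integral_def)
  have bd: "(\<Sum>i<length xs. ((\<Sum>k<N. (\<beta> k * I i k) powr q) powr (1 / q)) powr r) powr (1 / r) \<le> V * W" for N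
  proof -
    have "(\<Sum>k<N. (\<beta> k * I i k) powr q) powr (1 / q) \<le> (LINT t|T. n N i t)" if "i < length xs" for i
      unfolding I n_def using pqr contF[OF that] contn[OF that]
      by (intro minkowski_integral int F0) (auto simp: n_def[abs_def])
    then have "(\<Sum>i<length xs. ((\<Sum>k<N. (\<beta> k * I i k) powr q) powr (1 / q)) powr r) powr (1 / r)
      \<le> (\<Sum>i<length xs. (LINT t|T. n N i t) powr r) powr (1 / r)"
      using pqr by (intro powr_mono2 sum_mono) (auto intro: sum_nonneg)
    also have "\<dots> \<le> (LINT t|T. h N t)"
      unfolding h_def using pqr contn conth
      by (intro minkowski_integral int n0) (auto simp: h_def[abs_def])
    also have "\<dots> \<le> (LINT t|T. W)"
      by (intro integral_mono int conth continuous_on_const hW)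
    also have "\<dots> = V * W"
      by (simp add: T_def measure_restrict_space V_def)
    finally show ?thesis .
  qed
  have eq: "V * W = measure lborel (ball (0 :: complex ^ 'n) R)
         * (exp (M / 2 * \<rho>\<^sup>2) powr p / measure lborel (ball (0 :: complex ^ 'n) \<rho>)) powr (1 / p)
         * C * weak_norm r (fock \<phi> p) xs"
    by (simp add: V_def W_def Cs_def)
  note lim = mixed_norm_limit[of q r "{..<length xs}" "\<lambda>i k. (\<beta> k * I i k) powr q" "V * W"]
  show "summable (\<lambda>k. (\<beta> k * I i k) powr q)" if "i < length xs" for i
    using lim(1)[of i] pqr bd that by simp
  show "(\<Sum>i<length xs. ((\<Sum>k. (\<beta> k * I i k) powr q) powr (1 / q)) powr r) powr (1 / r)
      \<le> measure lborel (ball (0 :: complex ^ 'n) R)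
         * (exp (M / 2 * \<rho>\<^sup>2) powr p / measure lborel (ball (0 :: complex ^ 'n) \<rho>)) powr (1 / p)
         * C * weak_norm r (fock \<phi> p) xs"
    unfolding eq[symmetric] using lim(2) pqr bd by simp
qed

text \<open>
  The upper bound for the embedding. The pieces \<open>P k\<close>, the separation \<open>\<rho>\<close> and the factor \<open>B\<close> are left
  free so that the statement covers both lattice balls and unit cubes.
\<close>

proposition summing_norm_le_diag_norm:
  fixes p q r m M \<rho> R B :: real
  assumes pqr: "1 \<le> p" "1 \<le> q" "1 \<le> r" and m: "0 < m" "m \<le> M" and \<rho>: "0 < \<rho>" and R: "0 < R" and B: "0 < B"
  obtains K where "0 < K"
    and "\<And>(\<phi> :: complex ^ 'n \<Rightarrow> real) \<mu> c P \<beta>. \<lbrakk>hessian_bounds m M \<phi>; locally_finite_borel \<mu>;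
      disjoint_family (\<lambda>k. ball (c k) \<rho>); \<And>k. P k \<in> sets borel; \<And>k. P k \<subseteq> ball (c k) R;
      (\<Union>k::nat. P k) = UNIV; \<And>k. 0 \<le> \<beta> k; \<And>k. measure \<mu> (P k) \<le> B * \<beta> k powr q\<rbrakk> \<Longrightarrow>
      summing_norm r (fock \<phi> p) (weighted_L \<phi> q \<mu>) (\<lambda>g. g)
        \<le> ennreal K * diag_norm p q r (\<lambda>k. complex_of_real (\<beta> k))"
proof -
  have M: "0 \<le> M" using m by simp
  define C1 where "C1 = exp (M / 2 * \<rho>\<^sup>2) / measure lborel (ball (0 :: complex ^ 'n) \<rho>) * B powr (1 / q)"
  have C1: "0 < C1" using content_ball_gt_0[OF \<rho>, where z = "0 :: complex ^ 'n"] B by (simp add: C1_def)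
  define C2 where "C2 = measure lborel (ball (0 :: complex ^ 'n) (R + \<rho>))
         * (exp (M / 2 * \<rho>\<^sup>2) powr p / measure lborel (ball (0 :: complex ^ 'n) \<rho>)) powr (1 / p)"
  have C2: "0 < C2" using content_ball_gt_0[OF \<rho>, where z = "0 :: complex ^ 'n"]
      content_ball_gt_0[of "R + \<rho>" "0 :: complex ^ 'n"] R \<rho> by (simp add: C2_def)
  show ?thesis
  proof (rule that[of "C1 * C2"])
    show "0 < C1 * C2" using C1 C2 by simp
    fix \<phi> :: "complex ^ 'n \<Rightarrow> real" and \<mu> :: "(complex ^ 'n) measure" and c P and \<beta> :: "nat \<Rightarrow> real"
    assume \<phi>: "hessian_bounds m M \<phi>" and \<mu>: "locally_finite_borel \<mu>"
      and dis: "disjoint_family (\<lambda>k. ball (c k) \<rho>)"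
      and P: "\<And>k. P k \<in> sets borel" "\<And>k. P k \<subseteq> ball (c k) R" "(\<Union>k::nat. P k) = UNIV"
      and \<beta>: "\<And>k. 0 \<le> \<beta> k" "\<And>k. measure \<mu> (P k) \<le> B * \<beta> k powr q"
    show "summing_norm r (fock \<phi> p) (weighted_L \<phi> q \<mu>) (\<lambda>g. g)
        \<le> ennreal (C1 * C2) * diag_norm p q r (\<lambda>k. complex_of_real (\<beta> k))"
      unfolding diag_norm_def
    proof (rule summing_norm_le_mult)
      show "0 < C1 * C2" using C1 C2 by simp
      fix C
      assume lin: "linear_op (ell p) (ell q) (diag_op (\<lambda>k. complex_of_real (\<beta> k)))"
        and C: "C \<in> summing_consts r (ell p) (ell q) (diag_op (\<lambda>k. complex_of_real (\<beta> k)))"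
      have C0: "0 \<le> C" using C by (simp add: summing_consts_def)
      have key: "(\<forall>x\<in>set xs. x \<in> vecs (weighted_L \<phi> q \<mu>)) \<and>
         (\<Sum>x\<leftarrow>xs. nrm (weighted_L \<phi> q \<mu>) x powr r) powr (1 / r) \<le> C1 * C2 * C * weak_norm r (fock \<phi> p) xs"
        if xs: "set xs \<subseteq> vecs (fock \<phi> p)" for xs
      proof -
        define a where "a i = (\<Sum>k. (\<beta> k * (LINT t:ball 0 (R + \<rho>)|lborel.
          norm ((xs ! i) (c k + t)) * exp (- \<phi> (c k + t)))) powr q) powr (1 / q)" for i
        note ms = local_means_summing[where R = "R + \<rho>", OF \<phi> M \<rho> pqr dis \<beta>(1) lin C xs]
        have each: "xs ! i \<in> vecs (weighted_L \<phi> q \<mu>)" "nrm (weighted_L \<phi> q \<mu>) (xs ! i) \<le> C1 * a i"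
          if i: "i < length xs" for i
        proof -
          have "entire (xs ! i)"
            using subsetD[OF xs nth_mem[OF i]] by (simp add: fock_vecs_iff[OF hessian_bounds_continuous[OF \<phi>]])
          note wl = weighted_L_le_local_means[OF \<phi> M \<rho> pqr(2) \<mu> B P \<beta> this ms(1)[OF i]]
          show "xs ! i \<in> vecs (weighted_L \<phi> q \<mu>)" by (rule wl(1))
          show "nrm (weighted_L \<phi> q \<mu>) (xs ! i) \<le> C1 * a i" using wl(2) by (simp add: C1_def a_def)
        qed
        have "(\<Sum>x\<leftarrow>xs. nrm (weighted_L \<phi> q \<mu>) x powr r) powr (1 / r)
           = (\<Sum>i<length xs. nrm (weighted_L \<phi> q \<mu>) (xs ! i) powr r) powr (1 / r)"
          by (simp only: sum_list_powr_nth)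
        also have "\<dots> \<le> (\<Sum>i<length xs. (C1 * a i) powr r) powr (1 / r)"
          using pqr each(2) by (intro powr_mono2 sum_mono) (auto intro: sum_nonneg weighted_L_nrm_nonneg)
        also have "\<dots> = C1 * (\<Sum>i<length xs. a i powr r) powr (1 / r)"
          using C1 pqr by (simp add: powr_mult sum_distrib_left[symmetric] powr_powr a_def sum_nonneg)
        also have "\<dots> \<le> C1 * (C2 * C * weak_norm r (fock \<phi> p) xs)"
          using ms(2) C1 by (intro mult_left_mono) (auto simp: a_def C2_def)
        finally show ?thesis using each(1) by (auto simp: in_set_conv_nth mult.assoc)
      qed
      have "linear_op (fock \<phi> p) (weighted_L \<phi> q \<mu>) (\<lambda>g. g)"
        unfolding linear_op_def using key[of "[f]" for f] by auto
      moreover have "C1 * C2 * C \<in> summing_consts r (fock \<phi> p) (weighted_L \<phi> q \<mu>) (\<lambda>g. g)"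
        unfolding summing_consts_def using key C1 C2 C0 by (auto simp: weak_norm_def)
      ultimately show "linear_op (fock \<phi> p) (weighted_L \<phi> q \<mu>) (\<lambda>g. g) \<and>
         C1 * C2 * C \<in> summing_consts r (fock \<phi> p) (weighted_L \<phi> q \<mu>) (\<lambda>g. g)" ..
    qed
  qed
qed

section \<open>Lower bound: superposition of peak functions\<close>

text \<open>
  Superposition of peak functions at separated points is bounded from \<open>\<ell>\<^sup>p\<close> by the Schur test, with a
  bound that depends on the points only through their Gaussian sum and does not see the factors \<open>\<omega>\<close>.
\<close>

lemma synthesis_operator:
  fixes \<phi> :: "complex ^ 'n \<Rightarrow> real" and c :: "nat \<Rightarrow> complex ^ 'n" and \<omega> :: "nat \<Rightarrow> complex"
  assumes \<phi>: "hessian_bounds m M \<phi>" and m: "0 < m" and p: "1 \<le> p"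
    and \<kappa>: "\<And>a. entire (\<kappa> a)"
      "\<And>a z. norm (\<kappa> a z) * exp (- \<phi> z) \<le> exp (- (m / 2) * (norm (z - a))\<^sup>2)"
    and G: "\<And>z. (\<Sum>k<N. exp (- (m / 2) * (norm (z - c k))\<^sup>2)) \<le> G"
    and \<omega>: "\<And>k. norm (\<omega> k) \<le> 1"
  defines "T \<equiv> \<lambda>y z. \<Sum>k<N. \<omega> k * y k * \<kappa> (c k) z"
  shows "linear_op (ell p) (fock \<phi> p) T"
    and "y \<in> vecs (ell p) \<Longrightarrow> nrm (fock \<phi> p) (T y) \<le>
      (G powr (p - 1) * (LINT w::complex^'n|lborel. exp (- (m / 2) * (norm w)\<^sup>2))) powr (1 / p) * nrm (ell p) y"
proof -
  note cont\<phi> = hessian_bounds_continuous[OF \<phi>]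
  have [measurable]: "\<phi> \<in> borel_measurable borel" by (rule borel_measurable_continuous_onI[OF cont\<phi>])
  define g where "g k z = exp (- (m / 2) * (norm (z - c k))\<^sup>2)" for k z
  have ig: "integrable lborel (g k)" for k
    using gaussian_integrable[of "m / 2" "c k"] m by (simp add: g_def[abs_def] norm_minus_commute)
  define J where "J = (LINT w::complex^'n|lborel. exp (- (m / 2) * (norm w)\<^sup>2))"
  have J: "(LINT z|lborel. g k z) = J" for k
  proof -
    have "(LINT z|lborel. g k z) = (LINT z|distr lborel borel ((+) (c k)). g k z)" by (simp add: lborel_distr_plus)
    also have "\<dots> = J" unfolding J_def g_def by (subst integral_distr) auto
    finally show ?thesis .
  qed
  have J0: "0 \<le> J" by (simp add: J_def)
  have ent: "entire (T y)" for y
    unfolding T_def by (intro entire_sum entire_const_mult \<kappa>)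
  then have [measurable]: "T y \<in> borel_measurable borel" for y
    by (intro borel_measurable_continuous_onI entire_continuous)
  have pt: "(norm (T y z) * exp (- \<phi> z)) powr p \<le> G powr (p - 1) * (\<Sum>k<N. norm (y k) powr p * g k z)" for y z
  proof -
    have "norm (T y z) * exp (- \<phi> z) \<le> (\<Sum>k<N. norm (\<omega> k * y k * \<kappa> (c k) z)) * exp (- \<phi> z)"
      unfolding T_def by (intro mult_right_mono norm_sum) auto
    also have "\<dots> = (\<Sum>k<N. norm (\<omega> k) * (norm (y k) * (norm (\<kappa> (c k) z) * exp (- \<phi> z))))"
      by (simp add: sum_distrib_right sum_distrib_left norm_mult mult_ac)
    also have "\<dots> \<le> (\<Sum>k<N. 1 * (norm (y k) * g k z))"
      using \<omega> \<kappa>(2) by (intro sum_mono mult_mono) (auto simp: g_def)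
    finally have "(norm (T y z) * exp (- \<phi> z)) powr p \<le> (\<Sum>k<N. norm (y k) * g k z) powr p"
      using p by (intro powr_mono2) auto
    also have "\<dots> \<le> G powr (p - 1) * (\<Sum>k<N. norm (y k) powr p * g k z)"
      using p G[of z] by (intro weighted_sum_powr_le) (auto simp: g_def)
    finally show ?thesis .
  qed
  have ib: "integrable lborel (\<lambda>z. G powr (p - 1) * (\<Sum>k<N. norm (y k) powr p * g k z))" for y :: "nat \<Rightarrow> complex"
    using ig by simp
  have int: "integrable lborel (\<lambda>z. (norm (T y z) * exp (- \<phi> z)) powr p)" for y
  proof (rule Bochner_Integration.integrable_bound[OF ib[of y]])
    show "AE z in lborel. norm ((norm (T y z) * exp (- \<phi> z)) powr p) \<le> norm (G powr (p - 1) * (\<Sum>k<N. norm (y k) powr p * g k z))"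
      using pt by (intro AE_I2) (auto intro: order_trans[OF _ abs_ge_self])
  qed measurable
  have vec: "T y \<in> vecs (fock \<phi> p)" for y
    by (simp add: fock_vecs_iff[OF cont\<phi>] ent int)
  then show "linear_op (ell p) (fock \<phi> p) T"
    by (auto simp: linear_op_def T_def sum.distrib[symmetric] sum_distrib_left algebra_simps)
  show "nrm (fock \<phi> p) (T y) \<le>
      (G powr (p - 1) * (LINT w::complex^'n|lborel. exp (- (m / 2) * (norm w)\<^sup>2))) powr (1 / p) * nrm (ell p) y"
    if y: "y \<in> vecs (ell p)"
  proof -
    have summ: "summable (\<lambda>k. norm (y k) powr p)" using y by (simp add: ell_vecs_iff)
    have "(LINT z|lborel. (norm (T y z) * exp (- \<phi> z)) powr p)
        \<le> (LINT z|lborel. G powr (p - 1) * (\<Sum>k<N. norm (y k) powr p * g k z))"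
      by (intro integral_mono int ib pt)
    also have "\<dots> = G powr (p - 1) * J * (\<Sum>k<N. norm (y k) powr p)"
      using ig by (simp add: Bochner_Integration.integral_sum J sum_distrib_left mult_ac)
    also have "\<dots> \<le> G powr (p - 1) * J * (\<Sum>k. norm (y k) powr p)"
      using summ J0 by (intro mult_left_mono sum_le_suminf) auto
    finally have "nrm (fock \<phi> p) (T y) \<le> (G powr (p - 1) * J * (\<Sum>k. norm (y k) powr p)) powr (1 / p)"
      unfolding fock_nrm[OF cont\<phi> ent] using p by (intro powr_mono2) auto
    also have "\<dots> = (G powr (p - 1) * J) powr (1 / p) * nrm (ell p) y"
      unfolding ell_nrm[OF y] using J0 by (intro powr_mult[THEN trans] refl)
    finally show ?thesis by (simp add: J_def)
  qed
qed

lemma roots_of_unity_orthogonal: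
  assumes "j < N" "k < N"
  shows "(\<Sum>s<N. cnj (cis (2 * pi * real s * real k / real N)) * cis (2 * pi * real s * real j / real N))
    = (if j = k then of_nat N else 0)"
proof (cases "j = k")
  case True
  then show ?thesis by (simp add: cis_cnj cis_mult)
next
  case False
  define d where "d = cis (2 * pi * (real j - real k) / real N)"
  have N: "0 < N" using assms by simp
  have "cnj (cis (2 * pi * real s * real k / real N)) * cis (2 * pi * real s * real j / real N) = d ^ s" for s
  proof -
    have "cnj (cis (2 * pi * real s * real k / real N)) * cis (2 * pi * real s * real j / real N)
      = cis (2 * pi * real s * real j / real N - 2 * pi * real s * real k / real N)"
      by (simp add: cis_cnj cis_mult)
    also have "2 * pi * real s * real j / real N - 2 * pi * real s * real k / real N
      = real s * (2 * pi * (real j - real k) / real N)"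
      using N by (simp add: field_simps)
    finally show ?thesis by (simp only: d_def Complex.DeMoivre)
  qed
  moreover have "d ^ N = 1"
  proof -
    have "d ^ N = cis (2 * pi * of_int (int j - int k))" using N by (simp add: d_def Complex.DeMoivre)
    also have "\<dots> = 1" by (rule cis_multiple_2pi) (auto simp: Ints_of_int)
    finally show ?thesis .
  qed
  \<comment> \<open>\<open>j - k\<close> is a nonzero integer of modulus below \<open>N\<close>, hence not a multiple of \<open>N\<close>.\<close>
  moreover have "d \<noteq> 1"
  proof
    assume "d = 1"
    then have "cos (2 * pi * (real j - real k) / real N) = 1" by (simp add: d_def complex_eq_iff)
    then obtain i :: int where "2 * pi * (real j - real k) / real N = of_int i * 2 * pi"
      using cos_one_2pi_int by blast
    then have "2 * pi * ((real j - real k) / real N) = 2 * pi * of_int i" by (simp add: mult_ac)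
    then have "(real j - real k) / real N = of_int i" by (subst (asm) mult_cancel_left) simp
    then have "real_of_int (int j - int k) = real_of_int (i * int N)" using N by (simp add: field_simps)
    then have eq: "int j - int k = i * int N" by (simp only: of_int_eq_iff)
    have "\<bar>int j - int k\<bar> < int N" using assms by auto
    then have "\<bar>i\<bar> * int N < 1 * int N" unfolding eq abs_mult by simp
    then have "\<bar>i\<bar> < 1" using N by (subst (asm) mult_less_cancel_right) auto
    then show False using eq False by simp
  qed
  ultimately show ?thesis
    using False by (simp add: geometric_sum)
qed

text \<open>
  Twisting the superposition by the characters of the cyclic group of order \<open>N\<close> and averaging with the
  conjugate characters returns a single term \<open>y k * \<kappa> k\<close>. Hence the modulus of that term is at most the
  average of the moduli of the twisted superpositions, simultaneously for all \<open>k\<close>, and integrating over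
  balls of bounded overlap gives the inequality.
\<close>

lemma coefficients_le_average:
  fixes \<phi> :: "complex ^ 'n \<Rightarrow> real" and c :: "nat \<Rightarrow> complex ^ 'n" and \<beta> :: "nat \<Rightarrow> real" and y :: "nat \<Rightarrow> complex"
  assumes \<mu>: "locally_finite_borel \<mu>" and cont\<phi>: "continuous_on UNIV \<phi>" and q: "1 \<le> q" and N: "0 < N"
    and \<kappa>0: "\<And>k z. z \<in> ball (c k) R \<Longrightarrow> \<epsilon> \<le> norm (\<kappa> k z) * exp (- \<phi> z)" and \<epsilon>: "0 < \<epsilon>"
    and overlap: "\<And>z. (\<Sum>k<N. indicator (ball (c k) R) z) \<le> (L::real)"
    and \<beta>: "\<And>k. 0 \<le> \<beta> k" "\<And>k. \<beta> k powr q \<le> measure \<mu> (ball (c k) R)"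
  defines "T \<equiv> \<lambda>s z. \<Sum>k<N. cis (2 * pi * real s * real k / real N) * y k * \<kappa> k z"
  assumes T: "\<And>s. T s \<in> vecs (weighted_L \<phi> q \<mu>)"
  shows "(\<Sum>k<N. (\<beta> k * norm (y k)) powr q) powr (1 / q)
    \<le> L powr (1 / q) / \<epsilon> / real N * (\<Sum>s<N. nrm (weighted_L \<phi> q \<mu>) (T s))"
proof -
  have sets\<mu> [measurable_cong]: "sets \<mu> = sets borel" using \<mu> by (simp add: locally_finite_borel_def)
  have [measurable]: "\<phi> \<in> borel_measurable borel" by (rule borel_measurable_continuous_onI[OF cont\<phi>])
  have T' : "T s \<in> borel_measurable \<mu>" "integrable \<mu> (\<lambda>z. (norm (T s z) * exp (- \<phi> z)) powr q)" for s
    using T[of s] by (auto simp: weighted_L_vecs_iff)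
  note [measurable] = T'(1)
  have L0: "0 \<le> L" using overlap[of 0] by (rule order_trans[rotated]) (simp add: sum_nonneg)
  define u where "u s z = norm (T s z) * exp (- \<phi> z)" for s z
  have u0: "0 \<le> u s z" for s z by (simp add: u_def)
  have um [measurable]: "u s \<in> borel_measurable \<mu>" for s unfolding u_def by measurable
  have iu: "integrable \<mu> (\<lambda>z. u s z powr q)" for s using T'(2) by (simp add: u_def)
  define U where "U z = (\<Sum>s<N. u s z)" for z
  have U0: "0 \<le> U z" for z by (simp add: U_def u0 sum_nonneg)
  have iU: "integrable \<mu> (\<lambda>z. U z powr q)"
    unfolding U_def using minkowski_sum(1)[of q "{..<N}" u \<mu>] q u0 um iu by simp
  have nU: "(LINT z|\<mu>. U z powr q) powr (1 / q) \<le> (\<Sum>s<N. nrm (weighted_L \<phi> q \<mu>) (T s))"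
    unfolding U_def using minkowski_sum(2)[of q "{..<N}" u \<mu>] q u0 um iu
    by (simp add: weighted_L_nrm u_def)
  \<comment> \<open>Fourier inversion on the cyclic group of order \<open>N\<close> isolates the \<open>k\<close>-th term.\<close>
  have local: "\<epsilon> * norm (y k) \<le> U z / real N" if k: "k < N" and z: "z \<in> ball (c k) R" for k z
  proof -
    let ?w = "\<lambda>s k. cis (2 * pi * real s * real k / real N)"
    have "(\<Sum>s<N. cnj (?w s k) * T s z) = (\<Sum>s<N. \<Sum>j<N. cnj (?w s k) * ?w s j * (y j * \<kappa> j z))"
      by (simp add: T_def sum_distrib_left mult.assoc)
    also have "\<dots> = (\<Sum>j<N. (\<Sum>s<N. cnj (?w s k) * ?w s j) * (y j * \<kappa> j z))"
      by (subst sum.swap) (simp add: sum_distrib_right)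
    also have "\<dots> = (\<Sum>j<N. if j = k then of_nat N * (y j * \<kappa> j z) else 0)"
      using k by (intro sum.cong refl) (simp add: roots_of_unity_orthogonal)
    also have "\<dots> = of_nat N * (y k * \<kappa> k z)" using k by simp
    finally have "real N * norm (y k * \<kappa> k z) = norm (\<Sum>s<N. cnj (?w s k) * T s z)"
      by (simp add: norm_mult)
    also have "\<dots> \<le> (\<Sum>s<N. norm (T s z))"
      by (rule order_trans[OF norm_sum]) (simp add: norm_mult)
    finally have "real N * norm (y k * \<kappa> k z) * exp (- \<phi> z) \<le> U z"
      unfolding U_def u_def sum_distrib_right[symmetric] by (intro mult_right_mono) auto
    then have "norm (y k) * (norm (\<kappa> k z) * exp (- \<phi> z)) \<le> U z / real N"
      using N by (simp add: norm_mult field_simps)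
    moreover have "\<epsilon> * norm (y k) \<le> norm (y k) * (norm (\<kappa> k z) * exp (- \<phi> z))"
      using \<kappa>0[OF z] by (subst mult.commute) (intro mult_left_mono, auto)
    ultimately show ?thesis by simp
  qed
  have [measurable]: "ball (c k) R \<in> sets \<mu>" for k by (simp add: sets\<mu>)
  have "(\<Sum>k<N. (\<beta> k * norm (y k)) powr q) \<le> (\<Sum>k<N. LINT z|\<mu>. indicator (ball (c k) R) z * (U z / (real N * \<epsilon>)) powr q)"
  proof (rule sum_mono)
    fix k assume "k \<in> {..<N}" then have k: "k < N" by simp
    have fin: "emeasure \<mu> (ball (c k) R) < \<infinity>"
      using locally_finite_emeasure[OF \<mu> _ order_refl, of "c k" R] by simp
    have "(\<beta> k * norm (y k)) powr q \<le> norm (y k) powr q * measure \<mu> (ball (c k) R)"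
      using mult_left_mono[OF \<beta>(2)[of k], of "norm (y k) powr q"] by (simp add: powr_mult mult.commute)
    also have "\<dots> = (LINT z|\<mu>. indicator (ball (c k) R) z * norm (y k) powr q)"
      by (simp add: mult.commute)
    also have "\<dots> \<le> (LINT z|\<mu>. indicator (ball (c k) R) z * (U z / (real N * \<epsilon>)) powr q)"
    proof (rule integral_mono)
      show "integrable \<mu> (\<lambda>z. indicator (ball (c k) R) z * norm (y k) powr q)"
        using fin by simp
      show "integrable \<mu> (\<lambda>z. indicator (ball (c k) R) z * (U z / (real N * \<epsilon>)) powr q)"
        using iU U0 \<epsilon> integrable_real_mult_indicator[of "ball (c k) R" \<mu> "\<lambda>z. (U z / (real N * \<epsilon>)) powr q"]
        by (simp add: powr_divide mult.commute)
      fix z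
      show "indicator (ball (c k) R) z * norm (y k) powr q \<le> indicator (ball (c k) R) z * (U z / (real N * \<epsilon>)) powr q"
      proof (cases "z \<in> ball (c k) R")
        case True
        have "norm (y k) \<le> U z / (real N * \<epsilon>)"
          using local[OF k True] \<epsilon> N by (simp add: field_simps)
        then show ?thesis using q by (intro mult_left_mono powr_mono2) auto
      qed simp
    qed
    finally show "(\<beta> k * norm (y k)) powr q \<le> (LINT z|\<mu>. indicator (ball (c k) R) z * (U z / (real N * \<epsilon>)) powr q)" .
  qed
  also have "\<dots> = (LINT z|\<mu>. (\<Sum>k<N. indicator (ball (c k) R) z * (U z / (real N * \<epsilon>)) powr q))"
    using iU U0 \<epsilon> integrable_real_mult_indicator[of "ball (c k) R" \<mu> "\<lambda>z. (U z / (real N * \<epsilon>)) powr q" for k]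
    by (intro Bochner_Integration.integral_sum[symmetric]) (simp add: powr_divide mult.commute)
  also have "\<dots> \<le> (LINT z|\<mu>. L * (U z / (real N * \<epsilon>)) powr q)"
  proof (rule integral_mono)
    show "integrable \<mu> (\<lambda>z. \<Sum>k<N. indicator (ball (c k) R) z * (U z / (real N * \<epsilon>)) powr q)"
      using iU U0 \<epsilon> integrable_real_mult_indicator[of "ball (c k) R" \<mu> "\<lambda>z. (U z / (real N * \<epsilon>)) powr q" for k]
      by (intro Bochner_Integration.integrable_sum) (simp add: powr_divide mult.commute)
    show "integrable \<mu> (\<lambda>z. L * (U z / (real N * \<epsilon>)) powr q)"
      using iU U0 \<epsilon> by (simp add: powr_divide)
    show "(\<Sum>k<N. indicator (ball (c k) R) z * (U z / (real N * \<epsilon>)) powr q) \<le> L * (U z / (real N * \<epsilon>)) powr q" for z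
      unfolding sum_distrib_right[symmetric] using overlap[of z] by (intro mult_right_mono) auto
  qed
  also have "\<dots> = L / (real N * \<epsilon>) powr q * (LINT z|\<mu>. U z powr q)"
    using U0 \<epsilon> by (simp add: powr_divide)
  finally have "(\<Sum>k<N. (\<beta> k * norm (y k)) powr q) powr (1 / q)
      \<le> (L / (real N * \<epsilon>) powr q * (LINT z|\<mu>. U z powr q)) powr (1 / q)"
    using q by (intro powr_mono2 sum_nonneg) auto
  also have "\<dots> = L powr (1 / q) / (real N * \<epsilon>) * (LINT z|\<mu>. U z powr q) powr (1 / q)"
    using L0 \<epsilon> N q by (simp add: powr_mult powr_divide powr_powr)
  also have "\<dots> \<le> L powr (1 / q) / (real N * \<epsilon>) * (\<Sum>s<N. nrm (weighted_L \<phi> q \<mu>) (T s))"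
    using nU \<epsilon> by (intro mult_left_mono) auto
  finally show ?thesis by (simp add: field_simps)
qed

text \<open>
  The lower bound for the embedding: each twisted superposition is a bounded operator from \<open>\<ell>\<^sup>p\<close> to the
  Fock space, so the embedding composed with it satisfies a summing inequality with a constant independent of the twist, and
  averaging the twists recovers the diagonal operator. The overlap of the balls of radius
  \<open>R\<close> is controlled by the Gaussian sum of the centres.
\<close>

proposition diag_norm_le_summing_norm:
  fixes p q r m M \<rho> R :: real
  assumes pqr: "1 \<le> p" "1 \<le> q" "1 \<le> r" and m: "0 < m" "m \<le> M" and \<rho>: "0 < \<rho>"
  obtains K where "0 < K"
    and "\<And>(\<phi> :: complex ^ 'n \<Rightarrow> real) \<mu> c \<beta>. \<lbrakk>hessian_bounds m M \<phi>; locally_finite_borel \<mu>;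
      disjoint_family (\<lambda>k. ball (c k) \<rho>); \<And>k::nat. 0 \<le> \<beta> k; \<And>k. \<beta> k powr q \<le> measure \<mu> (ball (c k) R)\<rbrakk> \<Longrightarrow>
      diag_norm p q r (\<lambda>k. complex_of_real (\<beta> k))
        \<le> ennreal K * summing_norm r (fock \<phi> p) (weighted_L \<phi> q \<mu>) (\<lambda>g. g)"
proof -
  obtain G where G: "0 < G" and gauss: "\<And>(c :: nat \<Rightarrow> complex ^ 'n) K z. disjoint_family (\<lambda>k. ball (c k) \<rho>) \<Longrightarrow> finite K \<Longrightarrow>
     (\<Sum>k\<in>K. exp (- (m / 2) * (norm (z - c k))\<^sup>2)) \<le> G"
    using gaussian_sum_bounded[of \<rho> "m / 2", where 'a = "complex ^ 'n"] \<rho> m by auto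
  define \<epsilon> where "\<epsilon> = exp (- (M / 2) * R\<^sup>2)"
  have \<epsilon>: "0 < \<epsilon>" by (simp add: \<epsilon>_def)
  define L where "L = G * exp ((m / 2) * R\<^sup>2)"
  have L: "0 < L" using G by (simp add: L_def)
  define J where "J = (LINT w::complex^'n|lborel. exp (- (m / 2) * (norm w)\<^sup>2))"
  have J: "0 \<le> J" by (simp add: J_def)
  \<comment> \<open>The summand 1 keeps the constant positive.\<close>
  define C1 where "C1 = (G powr (p - 1) * J) powr (1 / p) + 1"
  have C1: "0 < C1" by (simp add: C1_def add_nonneg_pos)
  define C2 where "C2 = L powr (1 / q) / \<epsilon>"
  have C2: "0 < C2" using L \<epsilon> by (simp add: C2_def)
  show ?thesis
  proof (rule that[of "C1 * C2"])
    show "0 < C1 * C2" using C1 C2 by simp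
    fix \<phi> :: "complex ^ 'n \<Rightarrow> real" and \<mu> :: "(complex ^ 'n) measure" and c and \<beta> :: "nat \<Rightarrow> real"
    assume \<phi>: "hessian_bounds m M \<phi>" and \<mu>: "locally_finite_borel \<mu>"
      and dis: "disjoint_family (\<lambda>k. ball (c k) \<rho>)"
      and \<beta>: "\<And>k. 0 \<le> \<beta> k" "\<And>k. \<beta> k powr q \<le> measure \<mu> (ball (c k) R)"
    note cont\<phi> = hessian_bounds_continuous[OF \<phi>]
    obtain \<kappa> :: "complex ^ 'n \<Rightarrow> complex ^ 'n \<Rightarrow> complex" where \<kappa>: "\<And>a. entire (\<kappa> a)"
      and lo: "\<And>a z. exp (- (M / 2) * (norm (z - a))\<^sup>2) \<le> norm (\<kappa> a z) * exp (- \<phi> z)"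
      and up: "\<And>a z. norm (\<kappa> a z) * exp (- \<phi> z) \<le> exp (- (m / 2) * (norm (z - a))\<^sup>2)"
      using peak_functions[OF \<phi>] by metis
    have near: "(norm (z - a))\<^sup>2 \<le> R\<^sup>2" if "z \<in> ball a R" for z a :: "complex ^ 'n"
      using that by (intro power_mono) (auto simp: dist_norm norm_minus_commute)
    have lower: "\<epsilon> \<le> norm (\<kappa> (c k) z) * exp (- \<phi> z)" if "z \<in> ball (c k) R" for k z
    proof -
      have "M / 2 * (norm (z - c k))\<^sup>2 \<le> M / 2 * R\<^sup>2" using near[OF that] m by (intro mult_left_mono) auto
      then have "\<epsilon> \<le> exp (- (M / 2) * (norm (z - c k))\<^sup>2)" by (simp add: \<epsilon>_def)
      also note lo
      finally show ?thesis .
    qed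
    have overlap: "(\<Sum>k<N. indicator (ball (c k) R) z) \<le> L" for N z
    proof -
      have "indicator (ball (c k) R) z \<le> exp ((m / 2) * R\<^sup>2) * exp (- (m / 2) * (norm (z - c k))\<^sup>2)" for k
      proof (cases "z \<in> ball (c k) R")
        case True
        have "m / 2 * (norm (z - c k))\<^sup>2 \<le> m / 2 * R\<^sup>2" using near[OF True] m by (intro mult_left_mono) auto
        then show ?thesis using True by (simp add: exp_add[symmetric])
      qed simp
      then have "(\<Sum>k<N. indicator (ball (c k) R) z) \<le> (\<Sum>k<N. exp ((m / 2) * R\<^sup>2) * exp (- (m / 2) * (norm (z - c k))\<^sup>2))"
        by (rule sum_mono)
      also have "\<dots> \<le> exp ((m / 2) * R\<^sup>2) * G"
        unfolding sum_distrib_left[symmetric] using gauss[OF dis, of "{..<N}" z] by (intro mult_left_mono) auto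
      finally show ?thesis by (simp add: L_def mult.commute)
    qed
    show "diag_norm p q r (\<lambda>k. complex_of_real (\<beta> k))
        \<le> ennreal (C1 * C2) * summing_norm r (fock \<phi> p) (weighted_L \<phi> q \<mu>) (\<lambda>g. g)"
      unfolding diag_norm_def
    proof (rule summing_norm_le_mult)
      show "0 < C1 * C2" using C1 C2 by simp
      fix C
      assume lin: "linear_op (fock \<phi> p) (weighted_L \<phi> q \<mu>) (\<lambda>g. g)"
        and C: "C \<in> summing_consts r (fock \<phi> p) (weighted_L \<phi> q \<mu>) (\<lambda>g. g)"
      have C0: "0 \<le> C" using C by (simp add: summing_consts_def)
      define D where "D = diag_op (\<lambda>k. complex_of_real (\<beta> k))"
      have D: "norm (D y k) = \<beta> k * norm (y k)" for y k by (simp add: D_def diag_op_def norm_mult \<beta>)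
      have key: "(\<forall>y\<in>set ys. D y \<in> vecs (ell q)) \<and>
         (\<Sum>y\<leftarrow>ys. nrm (ell q) (D y) powr r) powr (1 / r) \<le> C1 * C2 * C * weak_norm r (ell p) ys"
        if ys: "set ys \<subseteq> vecs (ell p)" for ys
      proof -
        define W where "W = weak_norm r (ell p) ys"
        have bd: "(\<Sum>i<length ys. ((\<Sum>k<N. (\<beta> k * norm ((ys ! i) k)) powr q) powr (1 / q)) powr r) powr (1 / r)
          \<le> C1 * C2 * C * W" if N: "0 < N" for N
        proof -
          define T where "T s y z = (\<Sum>k<N. cis (2 * pi * real s * real k / real N) * y k * \<kappa> (c k) z)"
            for s :: nat and y :: "nat \<Rightarrow> complex" and z
          have linT: "linear_op (ell p) (fock \<phi> p) (T s)" for s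
            unfolding T_def[abs_def] by (rule synthesis_operator(1)[OF \<phi> m(1) pqr(1) \<kappa> up gauss[OF dis]]) auto
          have nT: "nrm (fock \<phi> p) (T s y) \<le> C1 * nrm (ell p) y" if y: "y \<in> vecs (ell p)" for s y
          proof -
            have "nrm (fock \<phi> p) (T s y) \<le> (G powr (p - 1) * J) powr (1 / p) * nrm (ell p) y"
              unfolding T_def[abs_def] J_def by (rule synthesis_operator(2)[OF \<phi> m(1) pqr(1) \<kappa> up gauss[OF dis] _ y]) auto
            also have "\<dots> \<le> C1 * nrm (ell p) y"
              unfolding C1_def by (intro mult_right_mono Lspace_nrm_nonneg) auto
            finally show ?thesis .
          qed
          have Tf: "T s y \<in> vecs (fock \<phi> p)" if "y \<in> vecs (ell p)" for s y
            using linT[of s] that by (auto simp: linear_op_def)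
          have Tw: "T s y \<in> vecs (weighted_L \<phi> q \<mu>)" if "y \<in> vecs (ell p)" for s y
            using lin Tf[OF that] by (auto simp: linear_op_def)
          define u where "u s i = nrm (weighted_L \<phi> q \<mu>) (T s (ys ! i))" for s i
          have u0: "0 \<le> u s i" for s i by (simp add: u_def weighted_L_nrm_nonneg)
          have one: "(\<Sum>k<N. (\<beta> k * norm ((ys ! i) k)) powr q) powr (1 / q) \<le> C2 / real N * (\<Sum>s<N. u s i)"
            if i: "i < length ys" for i
          proof -
            have y: "ys ! i \<in> vecs (ell p)" using ys nth_mem[OF i] by blast
            show ?thesis
              unfolding C2_def u_def T_def[abs_def]
              by (rule coefficients_le_average[where c = c and R = R,
                    OF \<mu> cont\<phi> pqr(2) N lower \<epsilon> overlap \<beta> Tw[OF y, unfolded T_def[abs_def]]])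
          qed
          have "(\<Sum>i<length ys. ((\<Sum>k<N. (\<beta> k * norm ((ys ! i) k)) powr q) powr (1 / q)) powr r) powr (1 / r)
             \<le> (\<Sum>i<length ys. (C2 / real N * (\<Sum>s<N. u s i)) powr r) powr (1 / r)"
            using one pqr by (intro powr_mono2 sum_mono) (auto intro: sum_nonneg)
          also have "\<dots> = C2 / real N * (\<Sum>i<length ys. (\<Sum>s<N. u s i) powr r) powr (1 / r)"
          proof -
            have "(\<Sum>i<length ys. (C2 / real N * (\<Sum>s<N. u s i)) powr r)
              = (C2 / real N) powr r * (\<Sum>i<length ys. (\<Sum>s<N. u s i) powr r)"
              by (simp only: powr_mult sum_distrib_left[symmetric])
            then show ?thesis
              using C2 pqr by (simp only: powr_mult) (simp add: powr_powr)
          qed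
          also have "\<dots> \<le> C2 / real N * (\<Sum>s<N. (\<Sum>i<length ys. u s i powr r) powr (1 / r))"
            using C2 pqr u0 by (intro mult_left_mono minkowski_sum_sum) auto
          also have "\<dots> \<le> C2 / real N * (\<Sum>s<N. C * (C1 * W))"
          proof (intro mult_left_mono sum_mono)
            fix s
            have "(\<Sum>i<length ys. u s i powr r) powr (1 / r)
               = (\<Sum>x\<leftarrow>map (T s) ys. nrm (weighted_L \<phi> q \<mu>) x powr r) powr (1 / r)"
              by (simp add: sum_list_powr_nth u_def)
            also have "\<dots> \<le> C * weak_norm r (fock \<phi> p) (map (T s) ys)"
              using ys Tf by (intro summing_constsD[OF C]) auto
            also have "\<dots> \<le> C * (C1 * W)" unfolding W_def
              using C0 pqr by (intro mult_left_mono weak_norm_image_le linT nT C1 ys fock_nrm_nonneg) auto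
            finally show "(\<Sum>i<length ys. u s i powr r) powr (1 / r) \<le> C * (C1 * W)" .
          qed (use C2 in auto)
          also have "\<dots> = C1 * C2 * C * W" using N by simp
          finally show ?thesis .
        qed
        note lim = mixed_norm_limit[of q r "{..<length ys}" "\<lambda>i k. (\<beta> k * norm ((ys ! i) k)) powr q" "C1 * C2 * C * W"]
        have vec: "D (ys ! i) \<in> vecs (ell q)" if "i < length ys" for i
          using lim(1)[of i] pqr bd that by (simp add: ell_vecs_iff D)
        have "(\<Sum>y\<leftarrow>ys. nrm (ell q) (D y) powr r) powr (1 / r)
          = (\<Sum>i<length ys. ((\<Sum>k. (\<beta> k * norm ((ys ! i) k)) powr q) powr (1 / q)) powr r) powr (1 / r)"
          using vec by (simp add: sum_list_powr_nth ell_nrm D)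
        also have "\<dots> \<le> C1 * C2 * C * W" using lim(2) pqr bd by simp
        finally show ?thesis using vec by (auto simp: in_set_conv_nth W_def)
      qed
      have "linear_op (ell p) (ell q) D"
        unfolding linear_op_def using key[of "[f]" for f] by (auto simp: D_def diag_op_def algebra_simps)
      moreover have "C1 * C2 * C \<in> summing_consts r (ell p) (ell q) D"
        unfolding summing_consts_def using key C1 C2 C0 by (auto simp: weak_norm_def)
      ultimately show "linear_op (ell p) (ell q) (diag_op (\<lambda>k. complex_of_real (\<beta> k))) \<and>
         C1 * C2 * C \<in> summing_consts r (ell p) (ell q) (diag_op (\<lambda>k. complex_of_real (\<beta> k)))"
        by (simp add: D_def)
    qed
  qed
qed

section \<open>Integer points, unit cubes and lattices\<close>

lemma countable_integer_points: "countable (integer_points :: (complex ^ 'n) set)"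
proof -
  have "(integer_points :: (complex ^ 'n) set) \<subseteq>
      range (\<lambda>f :: 'n \<Rightarrow> int \<times> int. \<chi> i. Complex (of_int (fst (f i))) (of_int (snd (f i))))"
  proof
    fix z :: "complex ^ 'n" assume "z \<in> integer_points"
    then have "z = (\<chi> i. Complex (of_int (fst (\<lfloor>Re (z $ i)\<rfloor>, \<lfloor>Im (z $ i)\<rfloor>))) (of_int (snd (\<lfloor>Re (z $ i)\<rfloor>, \<lfloor>Im (z $ i)\<rfloor>))))"
      by (auto simp: integer_points_def vec_eq_iff complex_eq_iff)
    then show "z \<in> range (\<lambda>f :: 'n \<Rightarrow> int \<times> int. \<chi> i. Complex (of_int (fst (f i))) (of_int (snd (f i))))"
      by (intro image_eqI[of _ _ "\<lambda>i. (\<lfloor>Re (z $ i)\<rfloor>, \<lfloor>Im (z $ i)\<rfloor>)"]) auto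
  qed
  then show ?thesis by (rule countable_subset) simp
qed

lemma infinite_integer_points: "infinite (integer_points :: (complex ^ 'n) set)"
proof
  assume "finite (integer_points :: (complex ^ 'n) set)"
  moreover have "range (\<lambda>k::nat. (\<chi> i. of_nat k) :: complex ^ 'n) \<subseteq> integer_points"
    by (auto simp: integer_points_def)
  ultimately have "finite (range (\<lambda>k::nat. (\<chi> i. of_nat k) :: complex ^ 'n))" by (rule rev_finite_subset)
  moreover have "inj (\<lambda>k::nat. (\<chi> i. of_nat k) :: complex ^ 'n)"
    by (auto simp: inj_def vec_eq_iff)
  ultimately show False using finite_imageD infinite_UNIV_nat by blast
qed

lemma from_nat_into_integer_points:
  "bij_betw (from_nat_into (integer_points :: (complex ^ 'n) set)) UNIV integer_points"
  by (rule bij_betw_from_nat_into[OF countable_integer_points infinite_integer_points])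

lemma integer_points_separated:
  assumes "z \<in> integer_points" "w \<in> integer_points" "z \<noteq> (w :: complex ^ 'n)"
  shows "1 \<le> norm (z - w)"
proof -
  obtain i where "z $ i \<noteq> w $ i" using assms(3) by (auto simp: vec_eq_iff)
  have int: "Re (z $ i) - Re (w $ i) \<in> \<int>" "Im (z $ i) - Im (w $ i) \<in> \<int>"
    using assms by (auto simp: integer_points_def)
  have "1 \<le> \<bar>Re (z $ i - w $ i)\<bar> \<or> 1 \<le> \<bar>Im (z $ i - w $ i)\<bar>"
    using \<open>z $ i \<noteq> w $ i\<close> Ints_nonzero_abs_ge1[OF int(1)] Ints_nonzero_abs_ge1[OF int(2)]
    by (auto simp: complex_eq_iff)
  then have "1 \<le> norm ((z - w) $ i)"
    using abs_Re_le_cmod[of "z $ i - w $ i"] abs_Im_le_cmod[of "z $ i - w $ i"] by auto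
  also have "\<dots> \<le> norm (z - w)" by (rule Finite_Cartesian_Product.norm_nth_le)
  finally show ?thesis .
qed

lemma integer_points_dist:
  assumes "i \<noteq> j"
  shows "1 \<le> norm (from_nat_into integer_points i - (from_nat_into integer_points j :: complex ^ 'n))"
  using from_nat_into_integer_points[where 'n = 'n] assms
  by (intro integer_points_separated) (auto simp: bij_betw_def inj_eq)

lemma mem_unit_cube_shift: "z \<in> unit_cube j \<longleftrightarrow> z - j \<in> unit_cube 0"
  by (simp add: unit_cube_def)

lemma unit_cube_norm_le:
  assumes "z \<in> unit_cube (j :: complex ^ 'n)"
  shows "norm (z - j) \<le> real CARD('n)"
proof -
  have "norm ((z - j) $ i) \<le> 1" for i
  proof -
    have "\<bar>Re ((z - j) $ i)\<bar> \<le> 1 / 2" "\<bar>Im ((z - j) $ i)\<bar> \<le> 1 / 2"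
    proof -
      have "- 1 / 2 \<le> Re (z $ i - j $ i) \<and> Re (z $ i - j $ i) < 1 / 2 \<and> - 1 / 2 \<le> Im (z $ i - j $ i) \<and> Im (z $ i - j $ i) < 1 / 2"
        using assms by (simp add: unit_cube_def)
      then show "\<bar>Re ((z - j) $ i)\<bar> \<le> 1 / 2" "\<bar>Im ((z - j) $ i)\<bar> \<le> 1 / 2"
        unfolding vector_minus_component by linarith+
    qed
    then show ?thesis using cmod_le[of "(z - j) $ i"] by linarith
  qed
  then have "(\<Sum>i\<in>UNIV. norm ((z - j) $ i)) \<le> (\<Sum>i\<in>(UNIV :: 'n set). 1)" by (intro sum_mono)
  moreover have "norm (z - j) \<le> (\<Sum>i\<in>UNIV. norm ((z - j) $ i))"
    unfolding norm_vec_def by (rule L2_set_le_sum) auto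
  ultimately show ?thesis by simp
qed

lemma unit_cubes_cover: "(\<Union>k. unit_cube (from_nat_into integer_points k)) = (UNIV :: (complex ^ 'n) set)"
proof -
  have "\<exists>k. z \<in> unit_cube (from_nat_into integer_points k)" for z :: "complex ^ 'n"
  proof -
    define j :: "complex ^ 'n" where "j = (\<chi> i. Complex (of_int \<lfloor>Re (z $ i) + 1 / 2\<rfloor>) (of_int \<lfloor>Im (z $ i) + 1 / 2\<rfloor>))"
    have "j \<in> integer_points" by (simp add: j_def integer_points_def)
    then obtain k where "j = from_nat_into integer_points k"
      using from_nat_into_integer_points[where 'n = 'n] unfolding bij_betw_def by blast
    moreover have "z \<in> unit_cube j"
    proof -
      have "x - of_int \<lfloor>x + 1 / 2\<rfloor> \<in> {- 1 / 2..<1 / 2}" for x :: real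
        using of_int_floor_le[of "x + 1 / 2"] real_of_int_floor_add_one_gt[of "x + 1 / 2"]
        unfolding atLeastLessThan_iff by linarith
      then show ?thesis by (simp add: unit_cube_def j_def)
    qed
    ultimately show ?thesis by blast
  qed
  then show ?thesis by blast
qed

lemma unit_cube_borel [measurable]: "unit_cube (j :: complex ^ 'n) \<in> sets borel"
proof -
  have "unit_cube j = (\<Inter>i. (\<lambda>z. Re (z $ i - j $ i)) -` {-1/2..<1/2} \<inter> space borel) \<inter> (\<Inter>i. (\<lambda>z. Im (z $ i - j $ i)) -` {-1/2..<1/2} \<inter> space borel)"
    by (auto simp: unit_cube_def)
  also have "\<dots> \<in> sets borel"
    by (intro sets.Int sets.finite_INT measurable_sets[OF borel_measurable_continuous_onI] continuous_intros) auto
  finally show ?thesis .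
qed

lemma convex_unit_cube: "convex (unit_cube (0 :: complex ^ 'n))"
proof (rule convexI)
  fix x y :: "complex ^ 'n" and u v :: real
  assume x: "x \<in> unit_cube 0" and y: "y \<in> unit_cube 0" and uv: "0 \<le> u" "0 \<le> v" "u + v = 1"
  have I: "u * a + v * b \<in> {- 1 / 2..<1 / 2}" if "a \<in> {- 1 / 2..<1 / 2}" "b \<in> {- 1 / 2..<1 / 2}" for a b :: real
    using convexD[OF convex_real_interval(7)[of "-1/2" "1/2"] that uv] by simp
  show "u *\<^sub>R x + v *\<^sub>R y \<in> unit_cube 0"
    using x y I by (simp add: unit_cube_def)
qed

lemma unit_cube_interior: "0 \<in> interior (unit_cube (0 :: complex ^ 'n))"
proof (rule interiorI[OF open_ball])
  show "0 \<in> ball (0 :: complex ^ 'n) (1 / 2)" by simp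
  show "ball (0 :: complex ^ 'n) (1 / 2) \<subseteq> unit_cube 0"
  proof
    fix z :: "complex ^ 'n" assume "z \<in> ball 0 (1 / 2)"
    then have "norm (z $ i) < 1 / 2" for i using Finite_Cartesian_Product.norm_nth_le[of z i] by simp
    then have "\<bar>Re (z $ i)\<bar> < 1 / 2" "\<bar>Im (z $ i)\<bar> < 1 / 2" for i
      using abs_Re_le_cmod[of "z $ i"] abs_Im_le_cmod[of "z $ i"] by (meson le_less_trans)+
    then have "- 1 / 2 \<le> Re (z $ i) \<and> Re (z $ i) < 1 / 2 \<and> - 1 / 2 \<le> Im (z $ i) \<and> Im (z $ i) < 1 / 2" for i
      by (smt (verit) divide_minus_left)
    then show "z \<in> unit_cube 0" by (simp add: unit_cube_def)
  qed
qed

text \<open>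
  The centres are taken in the interior so that each of the balls meets the cube in a set of positive
  measure, where an essential bound can be evaluated.
\<close>

lemma unit_cube_net:
  assumes "0 < e"
  obtains W where "finite W" "W \<subseteq> interior (unit_cube (0 :: complex ^ 'n))" "unit_cube 0 \<subseteq> (\<Union>w\<in>W. ball w e)"
proof -
  define Q where "Q = unit_cube (0 :: complex ^ 'n)"
  have "bounded Q" unfolding bounded_iff Q_def using unit_cube_norm_le[of _ 0] by auto
  then have "compact (closure Q)" by simp
  moreover have "closure Q \<subseteq> (\<Union>w\<in>interior Q. ball w e)"
  proof
    fix z assume "z \<in> closure Q"
    then have "z \<in> closure (interior Q)"
      using convex_closure_interior[of Q] convex_unit_cube unit_cube_interior by (auto simp: Q_def)
    then obtain w where "w \<in> interior Q" "dist w z < e" using assms by (auto simp: closure_approachable)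
    then show "z \<in> (\<Union>w\<in>interior Q. ball w e)" by auto
  qed
  ultimately obtain W where "W \<subseteq> interior Q" "finite W" "closure Q \<subseteq> (\<Union>w\<in>W. ball w e)"
    by (elim compactE_image) auto
  then show ?thesis using that closure_subset[of Q] by (auto simp: Q_def)
qed

text \<open>
  The cube is covered by a number of balls that depends only on \<open>\<delta>\<close> and the dimension, and each of them lies
  in a \<open>\<delta>\<close>-ball whose mass is controlled by the essential supremum.
\<close>

lemma cube_measure_le_cube_sup:
  fixes q \<delta> :: real
  assumes q: "1 \<le> q" and \<delta>: "0 < \<delta>"
  obtains B where "0 < B"
    and "\<And>(\<mu> :: (complex ^ 'n) measure) k. \<lbrakk>locally_finite_borel \<mu>; cube_sup (\<lambda>z. complex_of_real (ball_avg \<mu> q \<delta> z)) k < \<infinity>\<rbrakk> \<Longrightarrow>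
      measure \<mu> (unit_cube (from_nat_into integer_points k))
       \<le> B * enn2real (cube_sup (\<lambda>z. complex_of_real (ball_avg \<mu> q \<delta> z)) k) powr q"
proof -
  obtain W where W: "finite W" "W \<subseteq> interior (unit_cube (0 :: complex ^ 'n))" "unit_cube 0 \<subseteq> (\<Union>w\<in>W. ball w (\<delta> / 2))"
    using unit_cube_net[of "\<delta> / 2"] \<delta> by auto
  show ?thesis
  proof (rule that[of "real (card W) + 1"])
    fix \<mu> :: "(complex ^ 'n) measure" and k
    assume \<mu>: "locally_finite_borel \<mu>" and fin: "cube_sup (\<lambda>z. complex_of_real (ball_avg \<mu> q \<delta> z)) k < \<infinity>"
    define s where "s = enn2real (cube_sup (\<lambda>z. complex_of_real (ball_avg \<mu> q \<delta> z)) k)"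
    define j :: "complex ^ 'n" where "j = from_nat_into integer_points k"
    have sets\<mu>: "sets \<mu> = sets borel" using \<mu> by (simp add: locally_finite_borel_def)
    have finb: "emeasure \<mu> (ball z r) < \<infinity>" for z r
      using locally_finite_emeasure[OF \<mu> _ order_refl, of z r] by simp
    have ae: "AE z in lebesgue_on (unit_cube j). measure \<mu> (ball z \<delta>) powr (1 / q) \<le> s"
    proof -
      have "AE z in lebesgue_on (unit_cube j). ennreal (norm (complex_of_real (ball_avg \<mu> q \<delta> z)))
         \<le> cube_sup (\<lambda>z. complex_of_real (ball_avg \<mu> q \<delta> z)) k"
        unfolding cube_sup_def j_def by (rule esssup_AE)
      then show ?thesis
      proof eventually_elim
        case (elim z)
        have "cube_sup (\<lambda>z. complex_of_real (ball_avg \<mu> q \<delta> z)) k = ennreal s"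
          using fin by (simp add: s_def less_top)
        from elim[unfolded this] show ?case
          by (subst (asm) ennreal_le_iff) (simp_all add: ball_avg_def s_def)
      qed
    qed
    \<comment> \<open>A null set cannot contain the part of the ball around \<open>j + w\<close> inside the cube, so some \<open>z\<close> there obeys the
      essential bound, and its \<open>\<delta>\<close>-ball swallows the small ball.\<close>
    have piece: "measure \<mu> (ball (j + w) (\<delta> / 2)) \<le> s powr q" if w: "w \<in> W" for w
    proof -
      define U where "U = ball (j + w) (\<delta> / 2) \<inter> (+) j ` interior (unit_cube 0)"
      have lebU: "unit_cube j \<in> sets lebesgue" using unit_cube_borel[of j] by (simp add: sets_completionI_sets)
      have "open U" unfolding U_def by (intro open_Int open_translation open_ball open_interior)
      have "j + w \<in> U" unfolding U_def using subsetD[OF W(2) w] \<delta> by (intro IntI imageI) simp_all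
      moreover have "U \<subseteq> unit_cube j"
      proof
        fix x assume "x \<in> U"
        then obtain y where "x = j + y" "y \<in> interior (unit_cube 0)" unfolding U_def by blast
        then show "x \<in> unit_cube j"
          using subsetD[OF interior_subset, of y "unit_cube 0"] by (subst mem_unit_cube_shift) simp
      qed
      ultimately obtain z where z: "z \<in> U" "measure \<mu> (ball z \<delta>) powr (1 / q) \<le> s"
        using AE_lebesgue_on_open_witness[OF ae _ \<open>open U\<close>, of thesis] lebU by blast
      have "ball (j + w) (\<delta> / 2) \<subseteq> ball z \<delta>"
      proof
        fix x assume "x \<in> ball (j + w) (\<delta> / 2)"
        then show "x \<in> ball z \<delta>" using z(1) dist_triangle[of z x "j + w"] 
          by (simp add: U_def dist_commute)
      qed
      then have "measure \<mu> (ball (j + w) (\<delta> / 2)) \<le> measure \<mu> (ball z \<delta>)"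
        using finb by (intro measure_mono_fmeasurable) (auto simp: fmeasurable_def sets\<mu>)
      also have "\<dots> = (measure \<mu> (ball z \<delta>) powr (1 / q)) powr q" using q by (simp add: powr_powr)
      also have "\<dots> \<le> s powr q" using z(2) q by (intro powr_mono2) auto
      finally show ?thesis .
    qed
    have "unit_cube j \<subseteq> (\<Union>w\<in>W. ball (j + w) (\<delta> / 2))"
    proof
      fix z assume "z \<in> unit_cube j"
      then have "z - j \<in> unit_cube 0" by (simp add: mem_unit_cube_shift[of z j])
      then obtain w where "w \<in> W" "z - j \<in> ball w (\<delta> / 2)" using W(3) by blast
      then show "z \<in> (\<Union>w\<in>W. ball (j + w) (\<delta> / 2))" by (auto simp: dist_norm algebra_simps)
    qed
    then have "measure \<mu> (unit_cube j) \<le> measure \<mu> (\<Union>w\<in>W. ball (j + w) (\<delta> / 2))"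
    proof (rule measure_mono_fmeasurable)
      show "(\<Union>w\<in>W. ball (j + w) (\<delta> / 2)) \<in> fmeasurable \<mu>"
        by (rule fmeasurable.finite_UN[OF W(1)]) (use finb in \<open>simp add: fmeasurable_def sets\<mu>\<close>)
    qed (simp_all add: sets\<mu> unit_cube_borel)
    also have "\<dots> \<le> (\<Sum>w\<in>W. measure \<mu> (ball (j + w) (\<delta> / 2)))"
      using W(1) finb by (intro measure_UNION_le) (auto simp: sets\<mu>)
    also have "\<dots> \<le> real (card W) * s powr q"
      using piece by (rule sum_bounded_above)
    also have "\<dots> \<le> (real (card W) + 1) * s powr q" by (intro mult_right_mono) auto
    finally show "measure \<mu> (unit_cube (from_nat_into integer_points k))
       \<le> (real (card W) + 1) * enn2real (cube_sup (\<lambda>z. complex_of_real (ball_avg \<mu> q \<delta> z)) k) powr q"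
      by (simp add: s_def j_def)
  qed simp
qed

text \<open>
  A rescaled integer grid.
\<close>

lemma delta_lattice_exists:
  assumes \<delta>: "0 < \<delta>"
  shows "\<exists>a :: nat \<Rightarrow> complex ^ 'n. delta_lattice \<delta> a"
proof -
  define n where "n = real CARD('n)"
  have n: "1 \<le> n" unfolding n_def by (simp add: Suc_le_eq)
  \<comment> \<open>The cubes of side \<open>s\<close> have circumradius at most \<open>s n = \<delta> / 2\<close>, and distinct grid points are \<open>s\<close> apart.\<close>
  define s where "s = \<delta> / (2 * n)"
  have s: "0 < s" "s * n = \<delta> / 2" using \<delta> n by (auto simp: s_def)
  define a :: "nat \<Rightarrow> complex ^ 'n" where "a k = s *\<^sub>R from_nat_into integer_points k" for k
  have "separated_lattice (1 / (4 * n)) \<delta> a"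
    unfolding separated_lattice_def
  proof
    have "\<exists>j. z \<in> ball (a j) \<delta>" for z
    proof -
      obtain k where "(1 / s) *\<^sub>R z \<in> unit_cube (from_nat_into integer_points k)"
        using unit_cubes_cover[where 'n = 'n] by blast
      then have "norm ((1 / s) *\<^sub>R z - from_nat_into integer_points k) \<le> n"
        unfolding n_def by (rule unit_cube_norm_le)
      then have "s * norm ((1 / s) *\<^sub>R z - from_nat_into integer_points k) \<le> s * n"
        using s(1) by simp
      also have "s * norm ((1 / s) *\<^sub>R z - from_nat_into integer_points k) = norm (z - a k)"
        using s(1) norm_scaleR[of s "(1 / s) *\<^sub>R z - from_nat_into integer_points k"]
        by (simp add: a_def scaleR_diff_right)
      finally have "norm (z - a k) < \<delta>" using s(2) \<delta> by simp
      then show ?thesis by (auto simp: dist_norm norm_minus_commute)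
    qed
    then show "(\<Union>j. ball (a j) \<delta>) = UNIV" by blast
    show "disjoint_family (\<lambda>j. ball (a j) (1 / (4 * n) * \<delta>))"
    proof (rule disjoint_family_ballI)
      fix i j :: nat assume "i \<noteq> j"
      have "2 * (1 / (4 * n) * \<delta>) = s * 1" by (simp add: s_def)
      also have "\<dots> \<le> s * norm (from_nat_into integer_points i - (from_nat_into integer_points j :: complex ^ 'n))"
        using integer_points_dist[OF \<open>i \<noteq> j\<close>] s(1) by (intro mult_left_mono) auto
      also have "\<dots> = norm (a i - a j)" using s(1) by (simp add: a_def scaleR_diff_right[symmetric])
      finally show "2 * (1 / (4 * n) * \<delta>) \<le> norm (a i - a j)" .
    qed
  qed
  then show ?thesis using n unfolding delta_lattice_def by (intro exI[of _ a] exI[of _ "1 / (4 * n)"]) auto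
qed

section \<open>Comparison of the three norms\<close>

lemma summing_norm_le_symbol_norm:
  fixes p q r m M \<delta> :: real
  assumes pqr: "1 \<le> p" "1 \<le> q" "1 \<le> r" and m: "0 < m" "m \<le> M" and \<delta>: "0 < \<delta>"
  obtains K where "0 < K"
    and "\<And>(\<phi> :: complex ^ 'n \<Rightarrow> real) \<mu>. \<lbrakk>hessian_bounds m M \<phi>; locally_finite_borel \<mu>\<rbrakk> \<Longrightarrow>
      summing_norm r (fock \<phi> p) (weighted_L \<phi> q \<mu>) (\<lambda>g. g)
        \<le> ennreal K * symbol_norm p q r (\<lambda>z. complex_of_real (ball_avg \<mu> q \<delta> z))"
proof -
  define c :: "nat \<Rightarrow> complex ^ 'n" where "c = from_nat_into integer_points"
  obtain B where B: "0 < B"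
    and le: "\<And>(\<mu> :: (complex ^ 'n) measure) k. \<lbrakk>locally_finite_borel \<mu>; cube_sup (\<lambda>z. complex_of_real (ball_avg \<mu> q \<delta> z)) k < \<infinity>\<rbrakk> \<Longrightarrow>
      measure \<mu> (unit_cube (c k)) \<le> B * enn2real (cube_sup (\<lambda>z. complex_of_real (ball_avg \<mu> q \<delta> z)) k) powr q"
    using cube_measure_le_cube_sup[OF pqr(2) \<delta>, where 'n = 'n] unfolding c_def by blast
  define R where "R = real CARD('n) + 1"
  have R: "0 < R" by (simp add: R_def)
  obtain K where K: "0 < K" and main: "\<And>(\<phi> :: complex ^ 'n \<Rightarrow> real) \<mu> c P \<beta>. \<lbrakk>hessian_bounds m M \<phi>; locally_finite_borel \<mu>;
      disjoint_family (\<lambda>k. ball (c k) (1 / 2)); \<And>k. P k \<in> sets borel; \<And>k. P k \<subseteq> ball (c k) R;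
      (\<Union>k::nat. P k) = UNIV; \<And>k. 0 \<le> \<beta> k; \<And>k. measure \<mu> (P k) \<le> B * \<beta> k powr q\<rbrakk> \<Longrightarrow>
      summing_norm r (fock \<phi> p) (weighted_L \<phi> q \<mu>) (\<lambda>g. g)
        \<le> ennreal K * diag_norm p q r (\<lambda>k. complex_of_real (\<beta> k))"
    by (fact summing_norm_le_diag_norm[OF pqr m half_gt_zero[OF zero_less_one] R B])
  show ?thesis
  proof (rule that[OF K])
    fix \<phi> :: "complex ^ 'n \<Rightarrow> real" and \<mu> :: "(complex ^ 'n) measure"
    assume \<phi>: "hessian_bounds m M \<phi>" and \<mu>: "locally_finite_borel \<mu>"
    define u where "u z = complex_of_real (ball_avg \<mu> q \<delta> z)" for z
    show "summing_norm r (fock \<phi> p) (weighted_L \<phi> q \<mu>) (\<lambda>g. g)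
        \<le> ennreal K * symbol_norm p q r (\<lambda>z. complex_of_real (ball_avg \<mu> q \<delta> z))"
    proof (cases "\<forall>k. cube_sup u k < \<infinity>")
      case True
      have "summing_norm r (fock \<phi> p) (weighted_L \<phi> q \<mu>) (\<lambda>g. g)
        \<le> ennreal K * diag_norm p q r (\<lambda>k. complex_of_real (enn2real (cube_sup u k)))"
      proof (rule main[OF \<phi> \<mu>, where c = c and P = "\<lambda>k. unit_cube (c k)"])
        show "disjoint_family (\<lambda>k. ball (c k) (1 / 2))"
          using integer_points_dist[where 'n = 'n] by (intro disjoint_family_ballI) (auto simp: c_def)
        show "unit_cube (c k) \<subseteq> ball (c k) R" for k
          using unit_cube_norm_le[of _ "c k"] by (force simp: R_def dist_norm norm_minus_commute)
        show "(\<Union>k. unit_cube (c k)) = UNIV" unfolding c_def by (rule unit_cubes_cover)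
        show "measure \<mu> (unit_cube (c k)) \<le> B * enn2real (cube_sup u k) powr q" for k
          using le[OF \<mu>, of k] True by (simp add: u_def[abs_def])
      qed (simp_all add: unit_cube_borel)
      then show ?thesis using True by (simp add: symbol_norm_def u_def[abs_def])
    next
      case False
      then have "symbol_norm p q r u = \<infinity>" unfolding symbol_norm_def by (rule if_not_P)
      then show ?thesis using K by (simp add: u_def[abs_def] ennreal_mult_top)
    qed
  qed
qed

text \<open>
  All \<open>\<delta>\<close>-balls with centre in a cube lie in one ball around the centre of the cube.
\<close>

lemma symbol_norm_le_summing_norm:
  fixes p q r m M \<delta> :: real
  assumes pqr: "1 \<le> p" "1 \<le> q" "1 \<le> r" and m: "0 < m" "m \<le> M"
  obtains K where "0 < K"
    and "\<And>(\<phi> :: complex ^ 'n \<Rightarrow> real) \<mu>. \<lbrakk>hessian_bounds m M \<phi>; locally_finite_borel \<mu>\<rbrakk> \<Longrightarrow>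
      symbol_norm p q r (\<lambda>z. complex_of_real (ball_avg \<mu> q \<delta> z))
        \<le> ennreal K * summing_norm r (fock \<phi> p) (weighted_L \<phi> q \<mu>) (\<lambda>g. g)"
proof -
  define c :: "nat \<Rightarrow> complex ^ 'n" where "c = from_nat_into integer_points"
  define R where "R = real CARD('n) + \<delta>"
  obtain K where K: "0 < K" and main: "\<And>(\<phi> :: complex ^ 'n \<Rightarrow> real) \<mu> c \<beta>. \<lbrakk>hessian_bounds m M \<phi>; locally_finite_borel \<mu>;
      disjoint_family (\<lambda>k. ball (c k) (1 / 2)); \<And>k::nat. 0 \<le> \<beta> k; \<And>k. \<beta> k powr q \<le> measure \<mu> (ball (c k) R)\<rbrakk> \<Longrightarrow>
      diag_norm p q r (\<lambda>k. complex_of_real (\<beta> k))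
        \<le> ennreal K * summing_norm r (fock \<phi> p) (weighted_L \<phi> q \<mu>) (\<lambda>g. g)"
    by (fact diag_norm_le_summing_norm[OF pqr m half_gt_zero[OF zero_less_one]])
  show ?thesis
  proof (rule that[OF K])
    fix \<phi> :: "complex ^ 'n \<Rightarrow> real" and \<mu> :: "(complex ^ 'n) measure"
    assume \<phi>: "hessian_bounds m M \<phi>" and \<mu>: "locally_finite_borel \<mu>"
    have sets\<mu>: "sets \<mu> = sets borel" using \<mu> by (simp add: locally_finite_borel_def)
    define u where "u z = complex_of_real (ball_avg \<mu> q \<delta> z)" for z
    have [measurable]: "(\<lambda>z. measure \<mu> (ball z \<delta>)) \<in> borel_measurable borel" by (rule ball_measure_measurable[OF \<mu>])
    have sup: "cube_sup u k \<le> ennreal (measure \<mu> (ball (c k) R) powr (1 / q))" for k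
      unfolding cube_sup_def
    proof (rule esssup_I)
      have "(\<lambda>z. ennreal (norm (u z))) \<in> borel_measurable lborel"
        unfolding u_def ball_avg_def by measurable
      then show "(\<lambda>z. ennreal (norm (u z))) \<in> borel_measurable (lebesgue_on (unit_cube (from_nat_into integer_points k)))"
        by (intro measurable_restrict_space1 measurable_completion)
      show "AE z in lebesgue_on (unit_cube (from_nat_into integer_points k)). ennreal (norm (u z)) \<le> ennreal (measure \<mu> (ball (c k) R) powr (1 / q))"
      proof (rule AE_I2)
        fix z :: "complex ^ 'n" assume "z \<in> space (lebesgue_on (unit_cube (from_nat_into integer_points k)))"
        then have "norm (z - c k) \<le> real CARD('n)" by (simp add: space_restrict_space c_def unit_cube_norm_le)
        then have "ball z \<delta> \<subseteq> ball (c k) R"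
          by (intro ball_subset_ball_iff[THEN iffD2] disjI1) (simp add: R_def dist_norm)
        then have "measure \<mu> (ball z \<delta>) \<le> measure \<mu> (ball (c k) R)"
          using locally_finite_emeasure[OF \<mu> _ order_refl, of "c k" R]
          by (intro measure_mono_fmeasurable) (auto simp: fmeasurable_def sets\<mu>)
        then show "ennreal (norm (u z)) \<le> ennreal (measure \<mu> (ball (c k) R) powr (1 / q))"
          using pqr by (auto simp: u_def ball_avg_def intro!: ennreal_leI powr_mono2)
      qed
    qed
    have fin: "\<forall>k. cube_sup u k < \<infinity>" using le_less_trans[OF sup ennreal_less_top] by simp
    have "diag_norm p q r (\<lambda>k. complex_of_real (enn2real (cube_sup u k)))
        \<le> ennreal K * summing_norm r (fock \<phi> p) (weighted_L \<phi> q \<mu>) (\<lambda>g. g)"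
    proof (rule main[OF \<phi> \<mu>, where c = c])
      show "disjoint_family (\<lambda>k. ball (c k) (1 / 2))"
        using integer_points_dist[where 'n = 'n] by (intro disjoint_family_ballI) (auto simp: c_def)
      show "enn2real (cube_sup u k) powr q \<le> measure \<mu> (ball (c k) R)" for k
      proof -
        have "enn2real (cube_sup u k) \<le> measure \<mu> (ball (c k) R) powr (1 / q)"
          using enn2real_mono[OF sup[of k]] by simp
        then have "enn2real (cube_sup u k) powr q \<le> (measure \<mu> (ball (c k) R) powr (1 / q)) powr q"
          using pqr by (intro powr_mono2) auto
        then show ?thesis using pqr by (simp add: powr_powr)
      qed
    qed simp
    then show "symbol_norm p q r (\<lambda>z. complex_of_real (ball_avg \<mu> q \<delta> z))
        \<le> ennreal K * summing_norm r (fock \<phi> p) (weighted_L \<phi> q \<mu>) (\<lambda>g. g)"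
      using fin by (simp add: symbol_norm_def u_def[abs_def])
  qed
qed

lemma comparable_mono: "comparable K x y \<Longrightarrow> K \<le> K' \<Longrightarrow> comparable K' x y"
  unfolding comparable_def by (meson ennreal_leI mult_right_mono order_trans zero_le)

lemma comparable_join:
  assumes "comparable K x y" "comparable L x z" "0 \<le> K" "0 \<le> L"
  shows "comparable (K * L) y z"
proof -
  have "y \<le> ennreal K * (ennreal L * z)" "z \<le> ennreal L * (ennreal K * y)"
    using assms unfolding comparable_def by (meson mult_left_mono order_trans zero_le)+
  then show ?thesis using assms by (simp add: comparable_def ennreal_mult mult_ac)
qed

lemma comparable_finite:
  assumes "comparable K x y"
  shows "x < \<infinity> \<longleftrightarrow> y < \<infinity>"
proof -
  have "ennreal K * x < \<infinity>" if "x < \<infinity>" for x using that by (simp add: ennreal_mult_less_top)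
  then show ?thesis using assms unfolding comparable_def by (meson le_less_trans)
qed

lemma summing_norm_comparable_symbol_norm:
  fixes p q r m M \<delta> :: real
  assumes pqr: "1 \<le> p" "1 \<le> q" "1 \<le> r" and m: "0 < m" "m \<le> M" and \<delta>: "0 < \<delta>"
  obtains K where "0 < K"
    and "\<And>(\<phi> :: complex ^ 'n \<Rightarrow> real) \<mu>. \<lbrakk>hessian_bounds m M \<phi>; locally_finite_borel \<mu>\<rbrakk> \<Longrightarrow>
      comparable K (summing_norm r (fock \<phi> p) (weighted_L \<phi> q \<mu>) (\<lambda>g. g))
        (symbol_norm p q r (\<lambda>z. complex_of_real (ball_avg \<mu> q \<delta> z)))"
proof -
  obtain K where K: "0 < K" "\<And>(\<phi> :: complex ^ 'n \<Rightarrow> real) \<mu>. \<lbrakk>hessian_bounds m M \<phi>; locally_finite_borel \<mu>\<rbrakk> \<Longrightarrow>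
      summing_norm r (fock \<phi> p) (weighted_L \<phi> q \<mu>) (\<lambda>g. g)
        \<le> ennreal K * symbol_norm p q r (\<lambda>z. complex_of_real (ball_avg \<mu> q \<delta> z))"
    by (fact summing_norm_le_symbol_norm[OF pqr m \<delta>])
  obtain L where L: "0 < L" "\<And>(\<phi> :: complex ^ 'n \<Rightarrow> real) \<mu>. \<lbrakk>hessian_bounds m M \<phi>; locally_finite_borel \<mu>\<rbrakk> \<Longrightarrow>
      symbol_norm p q r (\<lambda>z. complex_of_real (ball_avg \<mu> q \<delta> z))
        \<le> ennreal L * summing_norm r (fock \<phi> p) (weighted_L \<phi> q \<mu>) (\<lambda>g. g)"
    by (fact symbol_norm_le_summing_norm[OF pqr m])
  show ?thesis
  proof (rule that[of "max K L"])
    fix \<phi> :: "complex ^ 'n \<Rightarrow> real" and \<mu> :: "(complex ^ 'n) measure"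
    assume "hessian_bounds m M \<phi>" "locally_finite_borel \<mu>"
    from K(2)[OF this] L(2)[OF this]
    show "comparable (max K L) (summing_norm r (fock \<phi> p) (weighted_L \<phi> q \<mu>) (\<lambda>g. g))
        (symbol_norm p q r (\<lambda>z. complex_of_real (ball_avg \<mu> q \<delta> z)))"
      unfolding comparable_def
      by (meson ennreal_leI max.cobounded1 max.cobounded2 mult_right_mono order_trans zero_le)
  qed (use K in auto)
qed

lemma summing_norm_comparable_diag_norm:
  fixes p q r m M \<delta> c :: real
  assumes pqr: "1 \<le> p" "1 \<le> q" "1 \<le> r" and m: "0 < m" "m \<le> M" and \<delta>: "0 < \<delta>" and c: "0 < c"
  obtains K where "0 < K"
    and "\<And>(\<phi> :: complex ^ 'n \<Rightarrow> real) \<mu> a. \<lbrakk>hessian_bounds m M \<phi>; locally_finite_borel \<mu>; separated_lattice c \<delta> a\<rbrakk> \<Longrightarrow>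
      comparable K (summing_norm r (fock \<phi> p) (weighted_L \<phi> q \<mu>) (\<lambda>g. g))
        (diag_norm p q r (\<lambda>j. complex_of_real (ball_avg \<mu> q \<delta> (a j))))"
proof -
  have \<rho>: "0 < c * \<delta>" using c \<delta> by simp
  obtain K where K: "0 < K" "\<And>(\<phi> :: complex ^ 'n \<Rightarrow> real) \<mu> a P \<beta>. \<lbrakk>hessian_bounds m M \<phi>; locally_finite_borel \<mu>;
      disjoint_family (\<lambda>k. ball (a k) (c * \<delta>)); \<And>k. P k \<in> sets borel; \<And>k. P k \<subseteq> ball (a k) \<delta>;
      (\<Union>k::nat. P k) = UNIV; \<And>k. 0 \<le> \<beta> k; \<And>k. measure \<mu> (P k) \<le> 1 * \<beta> k powr q\<rbrakk> \<Longrightarrow>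
      summing_norm r (fock \<phi> p) (weighted_L \<phi> q \<mu>) (\<lambda>g. g)
        \<le> ennreal K * diag_norm p q r (\<lambda>k. complex_of_real (\<beta> k))"
    by (fact summing_norm_le_diag_norm[OF pqr m \<rho> \<delta> zero_less_one])
  obtain L where L: "0 < L" "\<And>(\<phi> :: complex ^ 'n \<Rightarrow> real) \<mu> a \<beta>. \<lbrakk>hessian_bounds m M \<phi>; locally_finite_borel \<mu>;
      disjoint_family (\<lambda>k. ball (a k) (c * \<delta>)); \<And>k::nat. 0 \<le> \<beta> k; \<And>k. \<beta> k powr q \<le> measure \<mu> (ball (a k) \<delta>)\<rbrakk> \<Longrightarrow>
      diag_norm p q r (\<lambda>k. complex_of_real (\<beta> k))
        \<le> ennreal L * summing_norm r (fock \<phi> p) (weighted_L \<phi> q \<mu>) (\<lambda>g. g)"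
    by (fact diag_norm_le_summing_norm[OF pqr m \<rho>])
  show ?thesis
  proof (rule that[of "max K L"])
    fix \<phi> :: "complex ^ 'n \<Rightarrow> real" and \<mu> :: "(complex ^ 'n) measure" and a :: "nat \<Rightarrow> complex ^ 'n"
    assume \<phi>: "hessian_bounds m M \<phi>" and \<mu>: "locally_finite_borel \<mu>" and "separated_lattice c \<delta> a"
    then have a: "(\<Union>j. ball (a j) \<delta>) = UNIV" "disjoint_family (\<lambda>j. ball (a j) (c * \<delta>))"
      by (auto simp: separated_lattice_def)
    have eq: "ball_avg \<mu> q \<delta> (a k) powr q = measure \<mu> (ball (a k) \<delta>)" for k
      using pqr by (simp add: ball_avg_def powr_powr)
    have nn: "0 \<le> ball_avg \<mu> q \<delta> (a k)" for k by (simp add: ball_avg_def)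
    have "summing_norm r (fock \<phi> p) (weighted_L \<phi> q \<mu>) (\<lambda>g. g)
        \<le> ennreal K * diag_norm p q r (\<lambda>j. complex_of_real (ball_avg \<mu> q \<delta> (a j)))"
      by (rule K(2)[OF \<phi> \<mu> a(2) _ order_refl a(1)]) (simp_all add: eq nn)
    moreover have "diag_norm p q r (\<lambda>j. complex_of_real (ball_avg \<mu> q \<delta> (a j)))
        \<le> ennreal L * summing_norm r (fock \<phi> p) (weighted_L \<phi> q \<mu>) (\<lambda>g. g)"
      by (rule L(2)[OF \<phi> \<mu> a(2)]) (simp_all add: eq nn)
    ultimately show "comparable (max K L) (summing_norm r (fock \<phi> p) (weighted_L \<phi> q \<mu>) (\<lambda>g. g))
        (diag_norm p q r (\<lambda>j. complex_of_real (ball_avg \<mu> q \<delta> (a j))))"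
      unfolding comparable_def
      by (meson ennreal_leI max.cobounded1 max.cobounded2 mult_right_mono order_trans zero_le)
  qed (use K in auto)
qed

lemma summing_norm_finite_iff: "summing_norm r X Y A < \<infinity> \<longleftrightarrow> A \<in> summing_ops r X Y"
  by (simp add: summing_norm_def)

lemma diag_norm_finite_iff: "diag_norm p q r b < \<infinity> \<longleftrightarrow> b \<in> diag_space p q r"
  unfolding diag_norm_def diag_space_def mem_Collect_eq by (rule summing_norm_finite_iff)

lemma symbol_norm_finite_iff:
  assumes "locally_finite_borel \<mu>"
  shows "symbol_norm p q r (\<lambda>z. complex_of_real (ball_avg \<mu> q \<delta> z)) < \<infinity>
    \<longleftrightarrow> (\<lambda>z. complex_of_real (ball_avg \<mu> q \<delta> z)) \<in> symbol_space p q r"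
proof -
  note [measurable] = ball_measure_measurable[OF assms]
  have "(\<lambda>z. complex_of_real (ball_avg \<mu> q \<delta> z)) \<in> borel_measurable lborel"
    unfolding ball_avg_def by measurable
  then show ?thesis by (simp add: symbol_space_def measurable_completion)
qed

theorem theorem3p4:
  fixes p q r m M :: real
  assumes "1 \<le> p" and "1 \<le> q" and "1 \<le> r" and "0 < m" and "m \<le> M"
  shows
    "(\<forall>(\<phi> :: complex ^ 'n \<Rightarrow> real) \<mu>.
        hessian_bounds m M \<phi> \<and> locally_finite_borel \<mu> \<longrightarrow>
          ((\<lambda>g. g) \<in> summing_ops r (fock \<phi> p) (weighted_L \<phi> q \<mu>) \<longleftrightarrow>
             (\<exists>\<delta>>0. (\<lambda>z. complex_of_real (ball_avg \<mu> q \<delta> z)) \<in> symbol_space p q r)) \<and>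
          ((\<lambda>g. g) \<in> summing_ops r (fock \<phi> p) (weighted_L \<phi> q \<mu>) \<longleftrightarrow>
             (\<forall>\<delta>>0. (\<lambda>z. complex_of_real (ball_avg \<mu> q \<delta> z)) \<in> symbol_space p q r)) \<and>
          (\<forall>\<delta>>0. (\<lambda>g. g) \<in> summing_ops r (fock \<phi> p) (weighted_L \<phi> q \<mu>) \<longleftrightarrow>
             (\<exists>a. delta_lattice \<delta> a \<and>
                (\<lambda>j. complex_of_real (ball_avg \<mu> q \<delta> (a j))) \<in> diag_space p q r)) \<and>
          (\<forall>\<delta>>0. (\<lambda>g. g) \<in> summing_ops r (fock \<phi> p) (weighted_L \<phi> q \<mu>) \<longleftrightarrow>
             (\<forall>a. delta_lattice \<delta> a \<longrightarrow>
                (\<lambda>j. complex_of_real (ball_avg \<mu> q \<delta> (a j))) \<in> diag_space p q r))) \<and>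
     (\<forall>\<delta>>0. \<exists>K>0. \<forall>(\<phi> :: complex ^ 'n \<Rightarrow> real) \<mu>.
        hessian_bounds m M \<phi> \<and> locally_finite_borel \<mu> \<longrightarrow>
          comparable K (summing_norm r (fock \<phi> p) (weighted_L \<phi> q \<mu>) (\<lambda>g. g))
            (symbol_norm p q r (\<lambda>z. complex_of_real (ball_avg \<mu> q \<delta> z)))) \<and>
     (\<forall>\<delta>>0. \<forall>c. 0 < c \<and> c < 1 \<longrightarrow> (\<exists>K>0. \<forall>(\<phi> :: complex ^ 'n \<Rightarrow> real) \<mu> a.
        hessian_bounds m M \<phi> \<and> locally_finite_borel \<mu> \<and> separated_lattice c \<delta> a \<longrightarrow>
          comparable K (symbol_norm p q r (\<lambda>z. complex_of_real (ball_avg \<mu> q \<delta> z)))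
            (diag_norm p q r (\<lambda>j. complex_of_real (ball_avg \<mu> q \<delta> (a j)))) \<and>
          comparable K (summing_norm r (fock \<phi> p) (weighted_L \<phi> q \<mu>) (\<lambda>g. g))
            (diag_norm p q r (\<lambda>j. complex_of_real (ball_avg \<mu> q \<delta> (a j))))))"
proof (intro conjI)
  let ?J = "\<lambda>(\<phi> :: complex ^ 'n \<Rightarrow> real) \<mu>. (\<lambda>g. g) \<in> summing_ops r (fock \<phi> p) (weighted_L \<phi> q \<mu>)"
  have sym: "?J \<phi> \<mu> \<longleftrightarrow> (\<lambda>z. complex_of_real (ball_avg \<mu> q \<delta> z)) \<in> symbol_space p q r"
    if \<phi>: "hessian_bounds m M \<phi>" and \<mu>: "locally_finite_borel \<mu>" and \<delta>: "0 < \<delta>" for \<phi> \<mu> \<delta>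
  proof -
    obtain K where "comparable K (summing_norm r (fock \<phi> p) (weighted_L \<phi> q \<mu>) (\<lambda>g. g))
        (symbol_norm p q r (\<lambda>z. complex_of_real (ball_avg \<mu> q \<delta> z)))"
      using summing_norm_comparable_symbol_norm[OF assms \<delta>, where 'n = 'n] \<phi> \<mu> by metis
    from comparable_finite[OF this] show ?thesis
      unfolding summing_norm_finite_iff symbol_norm_finite_iff[OF \<mu>] .
  qed
  have diag: "?J \<phi> \<mu> \<longleftrightarrow> (\<lambda>j. complex_of_real (ball_avg \<mu> q \<delta> (a j))) \<in> diag_space p q r"
    if \<phi>: "hessian_bounds m M \<phi>" and \<mu>: "locally_finite_borel \<mu>" and \<delta>: "0 < \<delta>" and a: "delta_lattice \<delta> a" for \<phi> \<mu> \<delta> a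
  proof -
    obtain c where c: "0 < c" "separated_lattice c \<delta> a" using a by (auto simp: delta_lattice_def)
    obtain K where "comparable K (summing_norm r (fock \<phi> p) (weighted_L \<phi> q \<mu>) (\<lambda>g. g))
        (diag_norm p q r (\<lambda>j. complex_of_real (ball_avg \<mu> q \<delta> (a j))))"
      using summing_norm_comparable_diag_norm[OF assms \<delta> c(1), where 'n = 'n] \<phi> \<mu> c(2) by metis
    from comparable_finite[OF this] show ?thesis
      unfolding summing_norm_finite_iff diag_norm_finite_iff .
  qed
  show "\<forall>(\<phi> :: complex ^ 'n \<Rightarrow> real) \<mu>.
        hessian_bounds m M \<phi> \<and> locally_finite_borel \<mu> \<longrightarrow>
          (?J \<phi> \<mu> \<longleftrightarrow> (\<exists>\<delta>>0. (\<lambda>z. complex_of_real (ball_avg \<mu> q \<delta> z)) \<in> symbol_space p q r)) \<and>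
          (?J \<phi> \<mu> \<longleftrightarrow> (\<forall>\<delta>>0. (\<lambda>z. complex_of_real (ball_avg \<mu> q \<delta> z)) \<in> symbol_space p q r)) \<and>
          (\<forall>\<delta>>0. ?J \<phi> \<mu> \<longleftrightarrow> (\<exists>a. delta_lattice \<delta> a \<and>
                (\<lambda>j. complex_of_real (ball_avg \<mu> q \<delta> (a j))) \<in> diag_space p q r)) \<and>
          (\<forall>\<delta>>0. ?J \<phi> \<mu> \<longleftrightarrow> (\<forall>a. delta_lattice \<delta> a \<longrightarrow>
                (\<lambda>j. complex_of_real (ball_avg \<mu> q \<delta> (a j))) \<in> diag_space p q r))"
    using sym diag delta_lattice_exists[where 'n = 'n] zero_less_one by meson
  show "\<forall>\<delta>>0. \<exists>K>0. \<forall>(\<phi> :: complex ^ 'n \<Rightarrow> real) \<mu>.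
        hessian_bounds m M \<phi> \<and> locally_finite_borel \<mu> \<longrightarrow>
          comparable K (summing_norm r (fock \<phi> p) (weighted_L \<phi> q \<mu>) (\<lambda>g. g))
            (symbol_norm p q r (\<lambda>z. complex_of_real (ball_avg \<mu> q \<delta> z)))"
    using summing_norm_comparable_symbol_norm[OF assms, where 'n = 'n] by metis
  show "\<forall>\<delta>>0. \<forall>c. 0 < c \<and> c < 1 \<longrightarrow> (\<exists>K>0. \<forall>(\<phi> :: complex ^ 'n \<Rightarrow> real) \<mu> a.
        hessian_bounds m M \<phi> \<and> locally_finite_borel \<mu> \<and> separated_lattice c \<delta> a \<longrightarrow>
          comparable K (symbol_norm p q r (\<lambda>z. complex_of_real (ball_avg \<mu> q \<delta> z)))
            (diag_norm p q r (\<lambda>j. complex_of_real (ball_avg \<mu> q \<delta> (a j)))) \<and>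
          comparable K (summing_norm r (fock \<phi> p) (weighted_L \<phi> q \<mu>) (\<lambda>g. g))
            (diag_norm p q r (\<lambda>j. complex_of_real (ball_avg \<mu> q \<delta> (a j)))))"
  proof (intro allI impI, elim conjE)
    fix \<delta> c :: real assume \<delta>: "0 < \<delta>" and c: "0 < c" "c < 1"
    obtain K where K: "0 < K" "\<And>(\<phi> :: complex ^ 'n \<Rightarrow> real) \<mu>. \<lbrakk>hessian_bounds m M \<phi>; locally_finite_borel \<mu>\<rbrakk> \<Longrightarrow>
      comparable K (summing_norm r (fock \<phi> p) (weighted_L \<phi> q \<mu>) (\<lambda>g. g))
        (symbol_norm p q r (\<lambda>z. complex_of_real (ball_avg \<mu> q \<delta> z)))"
      by (fact summing_norm_comparable_symbol_norm[OF assms \<delta>])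
    obtain L where L: "0 < L" "\<And>(\<phi> :: complex ^ 'n \<Rightarrow> real) \<mu> a. \<lbrakk>hessian_bounds m M \<phi>; locally_finite_borel \<mu>; separated_lattice c \<delta> a\<rbrakk> \<Longrightarrow>
      comparable L (summing_norm r (fock \<phi> p) (weighted_L \<phi> q \<mu>) (\<lambda>g. g))
        (diag_norm p q r (\<lambda>j. complex_of_real (ball_avg \<mu> q \<delta> (a j))))"
      by (fact summing_norm_comparable_diag_norm[OF assms \<delta> c(1)])
    show "\<exists>K>0. \<forall>(\<phi> :: complex ^ 'n \<Rightarrow> real) \<mu> a.
        hessian_bounds m M \<phi> \<and> locally_finite_borel \<mu> \<and> separated_lattice c \<delta> a \<longrightarrow>
          comparable K (symbol_norm p q r (\<lambda>z. complex_of_real (ball_avg \<mu> q \<delta> z)))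
            (diag_norm p q r (\<lambda>j. complex_of_real (ball_avg \<mu> q \<delta> (a j)))) \<and>
          comparable K (summing_norm r (fock \<phi> p) (weighted_L \<phi> q \<mu>) (\<lambda>g. g))
            (diag_norm p q r (\<lambda>j. complex_of_real (ball_avg \<mu> q \<delta> (a j))))"
    proof (intro exI[of _ "K * L + L"] conjI allI impI; (elim conjE)?)
      show "0 < K * L + L" using K L by (simp add: add_pos_pos)
      fix \<phi> :: "complex ^ 'n \<Rightarrow> real" and \<mu> :: "(complex ^ 'n) measure" and a :: "nat \<Rightarrow> complex ^ 'n"
      assume \<phi>: "hessian_bounds m M \<phi>" and \<mu>: "locally_finite_borel \<mu>" and a: "separated_lattice c \<delta> a"
      show "comparable (K * L + L) (symbol_norm p q r (\<lambda>z. complex_of_real (ball_avg \<mu> q \<delta> z)))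
            (diag_norm p q r (\<lambda>j. complex_of_real (ball_avg \<mu> q \<delta> (a j))))"
        using comparable_join[OF K(2)[OF \<phi> \<mu>] L(2)[OF \<phi> \<mu> a]] K L by (auto intro: comparable_mono)
      show "comparable (K * L + L) (summing_norm r (fock \<phi> p) (weighted_L \<phi> q \<mu>) (\<lambda>g. g))
            (diag_norm p q r (\<lambda>j. complex_of_real (ball_avg \<mu> q \<delta> (a j))))"
        using L(2)[OF \<phi> \<mu> a] K L by (auto intro: comparable_mono)
    qed
  qed
qed

end
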